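(* Let $N$ be a six-dimensional, compact, connected manifold endowed with a coupled $\mathrm{SU}(3)$-structure $(\omega,\psi_+)$ with $d\omega = c\,\psi_+$ ($c\in\mathbb{R}$, $c\neq 0$), and let $\nu : N \to N$ be a diffeomorphism such that $\nu^*\omega=\omega$. Then the mapping torus $N_\nu$ admits a locally conformal calibrated $G_2$-structure $\varphi$. Moreover, $\mathcal{L}_\xi\varphi = 0$, where $\xi$ is the distinguished vector field on $N_\nu$ induced by $\frac{d}{dt}$ and $\mathcal{L}$ denotes the Lie derivative.
   Context: Notation: $e^{ij\cdots}=e^i\wedge e^j\wedge\cdots$. An $\mathrm{SU}(3)$-structure on a 6-manifold $N$ is given by a pair $(\omega,\psi_+)\in\Lambda^2(N)\times\Lambda^3(N)$ of differential forms which, at each point, can be written as $\omega=e^{12}+e^{34}+e^{56}$, $\psi_+=e^{135}-e^{146}-e^{236}-e^{245}$ with respect to some local coframe $\{e^1,\ldots,e^6\}$ (equivalently: a pair of stable, compatible, normalized forms inducing a Riemannian metric). On a connected six-dimensional manifold, it is called coupled if $d\omega=c\,\psi_+$ for some nonzero real constant $c$. A $G_2$-structure on a 7-manifold $M$ is a 3-form $\varphi$ which at each point can be written as $\varphi=e^{127}+e^{347}+e^{567}+e^{135}-e^{146}-e^{236}-e^{245}$ with respect to some local coframe $\{e^1,\ldots,e^7\}$. It is locally conformal calibrated if $d\varphi=-\theta\wedge\varphi$ for a closed non-vanishing (i.e. nowhere zero) 1-form $\theta$, called the Lee form. The mapping torus $N_\nu$ of a diffeomorphism $\nu$ of $N$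 is the quotient of $N\times[0,1]$ in which $(p,0)$ is identified with $(\nu(p),1)$; equivalently, the quotient of $N\times\mathbb{R}$ by the infinite cyclic group generated by the diffeomorphism $(p,t)\mapsto(\nu(p),t+1)$. The vector field $\frac{d}{dt}$ on the $\mathbb{R}$ factor of $N\times\mathbb{R}$ is invariant under this group and induces a vector field $\xi$ on $N_\nu$. *)

theory Defs
  imports "HOL-Analysis.Analysis"
begin

section \<open>Smooth maps between Euclidean spaces\<close>

text \<open>Only used for open sets \<open>S\<close>, where \<open>Ck_on k S f\<close> says that \<open>f\<close> is of class \<open>C\<^sup>k\<close> on \<open>S\<close>.\<close>

primrec Ck_on :: "nat \<Rightarrow> 'a::euclidean_space set \<Rightarrow> ('a \<Rightarrow> 'b::real_normed_vector) \<Rightarrow> bool" where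
  "Ck_on 0 S f \<longleftrightarrow> continuous_on S f"
| "Ck_on (Suc k) S f \<longleftrightarrow>
     (\<forall>x\<in>S. f differentiable (at x)) \<and> (\<forall>v. Ck_on k S (\<lambda>x. frechet_derivative f (at x) v))"

definition smooth_on :: "'a::euclidean_space set \<Rightarrow> ('a \<Rightarrow> 'b::real_normed_vector) \<Rightarrow> bool" where
  "smooth_on S f \<longleftrightarrow> (\<forall>k. Ck_on k S f)"


section \<open>Smooth manifolds\<close>

text \<open>
  A chart is a pair of its domain and its coordinate map (whose values outside the domain are
  irrelevant). The atlas of a manifold is not required to be maximal; the structure it describes
  is the one given by the maximal atlas containing it. The dimension is \<open>DIM('e)\<close>.
\<close>

type_synonym ('a, 'e) chart = "'a set \<times> ('a \<Rightarrow> 'e)"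

record ('a, 'e) manifold =
  mtop :: "'a topology"
  atlas :: "('a, 'e) chart set"

abbreviation cdom :: "('a, 'e) chart \<Rightarrow> 'a set" where "cdom c \<equiv> fst c"
abbreviation coord :: "('a, 'e) chart \<Rightarrow> 'a \<Rightarrow> 'e" where "coord c \<equiv> snd c"
abbreviation cimg :: "('a, 'e) chart \<Rightarrow> 'e set" where "cimg c \<equiv> coord c ` cdom c"

definition coord_inv :: "('a, 'e) chart \<Rightarrow> 'e \<Rightarrow> 'a" where
  "coord_inv c = inv_into (cdom c) (coord c)"

definition local_rep :: "('a, 'e) chart \<Rightarrow> ('b, 'f) chart \<Rightarrow> ('a \<Rightarrow> 'b) \<Rightarrow> 'e \<Rightarrow> 'f" where
  "local_rep c d f = (\<lambda>x. coord d (f (coord_inv c x)))"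

definition smooth_manifold :: "('a, 'e::euclidean_space) manifold \<Rightarrow> bool" where
  "smooth_manifold M \<longleftrightarrow>
     Hausdorff_space (mtop M) \<and> second_countable (mtop M) \<and>
     (\<Union>c\<in>atlas M. cdom c) = topspace (mtop M) \<and>
     (\<forall>c\<in>atlas M. openin (mtop M) (cdom c) \<and> open (cimg c) \<and>
        homeomorphic_map (subtopology (mtop M) (cdom c)) (top_of_set (cimg c)) (coord c)) \<and>
     (\<forall>c\<in>atlas M. \<forall>d\<in>atlas M. smooth_on (coord c ` (cdom c \<inter> cdom d)) (local_rep c d (\<lambda>p. p)))"

definition smooth_map ::
  "('a, 'e::euclidean_space) manifold \<Rightarrow> ('b, 'f::euclidean_space) manifold \<Rightarrow> ('a \<Rightarrow> 'b) \<Rightarrow> bool" where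
  "smooth_map M M' f \<longleftrightarrow>
     continuous_map (mtop M) (mtop M') f \<and>
     (\<forall>c\<in>atlas M. \<forall>d\<in>atlas M'. smooth_on (coord c ` {p \<in> cdom c. f p \<in> cdom d}) (local_rep c d f))"

definition diffeomorphism ::
  "('a, 'e::euclidean_space) manifold \<Rightarrow> ('b, 'f::euclidean_space) manifold \<Rightarrow> ('a \<Rightarrow> 'b) \<Rightarrow> bool" where
  "diffeomorphism M M' f \<longleftrightarrow>
     smooth_map M M' f \<and>
     (\<exists>g. smooth_map M' M g \<and> (\<forall>p\<in>topspace (mtop M). g (f p) = p) \<and>
        (\<forall>q\<in>topspace (mtop M'). f (g q) = q))"


section \<open>Exterior algebra of a Euclidean space\<close>

text \<open>
  A \<open>k\<close>-linear form takes its arguments from the first \<open>k\<close> entries of a sequence of vectors.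
\<close>

type_synonym 'e mform = "(nat \<Rightarrow> 'e) \<Rightarrow> real"

definition alternating_form :: "nat \<Rightarrow> 'e::euclidean_space mform \<Rightarrow> bool" where
  "alternating_form k \<alpha> \<longleftrightarrow>
     (\<forall>v w. (\<forall>i<k. v i = w i) \<longrightarrow> \<alpha> v = \<alpha> w) \<and>
     (\<forall>v. \<forall>i<k. linear (\<lambda>x. \<alpha> (v(i := x)))) \<and>
     (\<forall>v. \<forall>i<k. \<forall>j<k. i \<noteq> j \<and> v i = v j \<longrightarrow> \<alpha> v = 0)"

text \<open>
  Normalised so that \<open>(e\<^sup>1 \<and> e\<^sup>2)(v, w) = e\<^sup>1(v) e\<^sup>2(w) - e\<^sup>1(w) e\<^sup>2(v)\<close>.
\<close>

definition wedge :: "nat \<Rightarrow> nat \<Rightarrow> 'e mform \<Rightarrow> 'e mform \<Rightarrow> 'e mform" where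
  "wedge k l \<alpha> \<beta> = (\<lambda>v. (\<Sum>\<sigma> | \<sigma> permutes {..<k + l}.
     of_int (sign \<sigma>) * \<alpha> (\<lambda>i. v (\<sigma> i)) * \<beta> (\<lambda>i. v (\<sigma> (k + i)))) / (fact k * fact l))"

text \<open>\<open>cowedge e [i, j, \<dots>]\<close> is the basis form \<open>e\<^sup>i \<and> e\<^sup>j \<and> \<dots>\<close>.\<close>

primrec cowedge :: "(nat \<Rightarrow> 'e::euclidean_space \<Rightarrow>\<^sub>L real) \<Rightarrow> nat list \<Rightarrow> 'e mform" where
  "cowedge e [] = (\<lambda>v. 1)"
| "cowedge e (i # is) = wedge 1 (length is) (\<lambda>v. blinfun_apply (e i) (v 0)) (cowedge e is)"

definition coframe :: "nat \<Rightarrow> (nat \<Rightarrow> 'e::euclidean_space \<Rightarrow>\<^sub>L real) \<Rightarrow> bool" where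
  "coframe n e \<longleftrightarrow> inj_on e {1..n} \<and> independent (e ` {1..n}) \<and> span (e ` {1..n}) = UNIV"

definition pullback_lin :: "('e \<Rightarrow> 'f) \<Rightarrow> 'f mform \<Rightarrow> 'e mform" where
  "pullback_lin A \<alpha> = (\<lambda>v. \<alpha> (\<lambda>i. A (v i)))"


section \<open>Differential forms and vector fields on manifolds\<close>

text \<open>
  A differential form is the family of its local representatives, one on the image of each chart
  of the atlas, which are related by pullback along the transition maps. Likewise for vector
  fields. Values outside the images of the charts are irrelevant.
\<close>

type_synonym ('a, 'e) dform = "('a, 'e) chart \<Rightarrow> 'e \<Rightarrow> 'e mform"
type_synonym ('a, 'e) vfield = "('a, 'e) chart \<Rightarrow> 'e \<Rightarrow> 'e"

definition diff_form :: "('a, 'e::euclidean_space) manifold \<Rightarrow> nat \<Rightarrow> ('a, 'e) dform \<Rightarrow> bool" where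
  "diff_form M k \<alpha> \<longleftrightarrow>
     (\<forall>c\<in>atlas M. (\<forall>x\<in>cimg c. alternating_form k (\<alpha> c x)) \<and> (\<forall>v. smooth_on (cimg c) (\<lambda>x. \<alpha> c x v))) \<and>
     (\<forall>c\<in>atlas M. \<forall>d\<in>atlas M. \<forall>x\<in>coord c ` (cdom c \<inter> cdom d).
        \<alpha> c x = pullback_lin (frechet_derivative (local_rep c d (\<lambda>p. p)) (at x))
                  (\<alpha> d (local_rep c d (\<lambda>p. p) x)))"

definition vector_field :: "('a, 'e::euclidean_space) manifold \<Rightarrow> ('a, 'e) vfield \<Rightarrow> bool" where
  "vector_field M X \<longleftrightarrow>
     (\<forall>c\<in>atlas M. smooth_on (cimg c) (X c)) \<and>
     (\<forall>c\<in>atlas M. \<forall>d\<in>atlas M. \<forall>x\<in>coord c ` (cdom c \<inter> cdom d).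
        X d (local_rep c d (\<lambda>p. p) x) = frechet_derivative (local_rep c d (\<lambda>p. p)) (at x) (X c x))"

definition form_eq :: "('a, 'e) manifold \<Rightarrow> ('a, 'e) dform \<Rightarrow> ('a, 'e) dform \<Rightarrow> bool" where
  "form_eq M \<alpha> \<beta> \<longleftrightarrow> (\<forall>c\<in>atlas M. \<forall>x\<in>cimg c. \<alpha> c x = \<beta> c x)"

definition zero_form :: "('a, 'e) dform" where
  "zero_form = (\<lambda>c x v. 0)"

definition scale_form :: "real \<Rightarrow> ('a, 'e) dform \<Rightarrow> ('a, 'e) dform" where
  "scale_form r \<alpha> = (\<lambda>c x v. r * \<alpha> c x v)"

definition wedge_form :: "nat \<Rightarrow> nat \<Rightarrow> ('a, 'e) dform \<Rightarrow> ('a, 'e) dform \<Rightarrow> ('a, 'e) dform" where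
  "wedge_form k l \<alpha> \<beta> = (\<lambda>c x. wedge k l (\<alpha> c x) (\<beta> c x))"

definition nowhere_zero :: "('a, 'e) manifold \<Rightarrow> ('a, 'e) dform \<Rightarrow> bool" where
  "nowhere_zero M \<alpha> \<longleftrightarrow> (\<forall>c\<in>atlas M. \<forall>x\<in>cimg c. \<exists>v. \<alpha> c x v \<noteq> 0)"

text \<open>
  The differential of a \<open>k\<close>-form, in coordinates and with constant vectors \<open>v\<^sub>0, \<dots>, v\<^sub>k\<close>:
  the alternating sum of the derivatives in direction \<open>v\<^sub>i\<close> of \<open>\<alpha>\<close> applied to the
  remaining vectors.
\<close>

definition ext_deriv :: "nat \<Rightarrow> ('a, 'e::euclidean_space) dform \<Rightarrow> ('a, 'e) dform" where
  "ext_deriv k \<alpha> = (\<lambda>c x v. \<Sum>i\<le>k. (-1) ^ i *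
     frechet_derivative (\<lambda>y. \<alpha> c y (\<lambda>j. if j < i then v j else v (Suc j))) (at x) (v i))"

text \<open>
  The pullback is computed at a point \<open>p\<close> using an arbitrary chart \<open>d\<close> around \<open>f p\<close>; for a
  differential form \<open>\<alpha>\<close> and \<open>f\<close> smooth near \<open>p\<close> the choice of \<open>d\<close> is immaterial.
\<close>

definition pullback_form ::
  "('b, 'f::euclidean_space) manifold \<Rightarrow> ('a \<Rightarrow> 'b) \<Rightarrow> ('b, 'f) dform \<Rightarrow> ('a, 'e::euclidean_space) dform" where
  "pullback_form M' f \<alpha> = (\<lambda>c x.
     let d = (SOME d. d \<in> atlas M' \<and> f (coord_inv c x) \<in> cdom d)
     in pullback_lin (frechet_derivative (local_rep c d f) (at x)) (\<alpha> d (local_rep c d f x)))"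


section \<open>Flows and the Lie derivative\<close>

text \<open>\<open>\<Phi>\<close> is a flow of \<open>X\<close> defined on \<open>(-\<epsilon>, \<epsilon>) \<times> W\<close>.\<close>

definition local_flow ::
  "('a, 'e::euclidean_space) manifold \<Rightarrow> ('a, 'e) vfield \<Rightarrow> real \<Rightarrow> 'a set \<Rightarrow> (real \<Rightarrow> 'a \<Rightarrow> 'a) \<Rightarrow> bool" where
  "local_flow M X \<epsilon> W \<Phi> \<longleftrightarrow>
     \<epsilon> > 0 \<and> openin (mtop M) W \<and>
     (\<forall>q\<in>W. \<Phi> 0 q = q) \<and>
     (\<forall>q\<in>W. \<forall>s\<in>{-\<epsilon><..<\<epsilon>}. \<forall>c\<in>atlas M. \<Phi> s q \<in> cdom c \<longrightarrow>
        ((\<lambda>r. coord c (\<Phi> r q)) has_vector_derivative X c (coord c (\<Phi> s q))) (at s)) \<and>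
     continuous_map (prod_topology (top_of_set {-\<epsilon><..<\<epsilon>}) (subtopology (mtop M) W)) (mtop M)
       (\<lambda>(s, q). \<Phi> s q) \<and>
     (\<forall>c\<in>atlas M. \<forall>d\<in>atlas M.
        smooth_on {(s, x). s \<in> {-\<epsilon><..<\<epsilon>} \<and> x \<in> coord c ` (cdom c \<inter> W) \<and> \<Phi> s (coord_inv c x) \<in> cdom d}
          (\<lambda>(s, x). local_rep c d (\<Phi> s) x))"

text \<open>
  \<open>has_Lie_derivative M X \<alpha> \<beta>\<close> states \<open>L\<^sub>X \<alpha> = \<beta>\<close>, that is, at every point \<open>p\<close> the derivative at
  \<open>s = 0\<close> of \<open>\<Phi>\<^sub>s\<^sup>* \<alpha>\<close> is \<open>\<beta>\<close>, for \<open>\<Phi>\<close> the local flow of \<open>X\<close> around \<open>p\<close>. As \<open>X\<close> is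
  smooth, local flows exist and any two of them agree near \<open>(0, p)\<close>.
\<close>

definition has_Lie_derivative ::
  "('a, 'e::euclidean_space) manifold \<Rightarrow> ('a, 'e) vfield \<Rightarrow> ('a, 'e) dform \<Rightarrow> ('a, 'e) dform \<Rightarrow> bool" where
  "has_Lie_derivative M X \<alpha> \<beta> \<longleftrightarrow>
     vector_field M X \<and>
     (\<forall>p\<in>topspace (mtop M). \<exists>\<epsilon> W \<Phi>. local_flow M X \<epsilon> W \<Phi> \<and> p \<in> W \<and>
        (\<forall>c\<in>atlas M. p \<in> cdom c \<longrightarrow> (\<forall>v.
           ((\<lambda>s. pullback_form M (\<Phi> s) \<alpha> c (coord c p) v) has_real_derivative \<beta> c (coord c p) v) (at 0))))"


section \<open>\<open>SU(3)\<close>- and \<open>G\<^sub>2\<close>-structures\<close>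

definition SU3_structure ::
  "('a, 'e::euclidean_space) manifold \<Rightarrow> ('a, 'e) dform \<Rightarrow> ('a, 'e) dform \<Rightarrow> bool" where
  "SU3_structure N \<omega> \<psi> \<longleftrightarrow>
     smooth_manifold N \<and> DIM('e) = 6 \<and> diff_form N 2 \<omega> \<and> diff_form N 3 \<psi> \<and>
     (\<forall>c\<in>atlas N. \<forall>x\<in>cimg c. \<exists>e. coframe 6 e \<and>
        \<omega> c x = (\<lambda>v. cowedge e [1,2] v + cowedge e [3,4] v + cowedge e [5,6] v) \<and>
        \<psi> c x = (\<lambda>v. cowedge e [1,3,5] v - cowedge e [1,4,6] v
                    - cowedge e [2,3,6] v - cowedge e [2,4,5] v))"

definition coupled_SU3_structure ::
  "('a, 'e::euclidean_space) manifold \<Rightarrow> ('a, 'e) dform \<Rightarrow> ('a, 'e) dform \<Rightarrow> real \<Rightarrow> bool" where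
  "coupled_SU3_structure N \<omega> \<psi> c \<longleftrightarrow>
     SU3_structure N \<omega> \<psi> \<and> c \<noteq> 0 \<and> form_eq N (ext_deriv 2 \<omega>) (scale_form c \<psi>)"

definition G2_structure :: "('a, 'e::euclidean_space) manifold \<Rightarrow> ('a, 'e) dform \<Rightarrow> bool" where
  "G2_structure M \<phi> \<longleftrightarrow>
     smooth_manifold M \<and> DIM('e) = 7 \<and> diff_form M 3 \<phi> \<and>
     (\<forall>c\<in>atlas M. \<forall>x\<in>cimg c. \<exists>e. coframe 7 e \<and>
        \<phi> c x = (\<lambda>v. cowedge e [1,2,7] v + cowedge e [3,4,7] v + cowedge e [5,6,7] v
                    + cowedge e [1,3,5] v - cowedge e [1,4,6] v
                    - cowedge e [2,3,6] v - cowedge e [2,4,5] v))"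

definition locally_conformal_calibrated_G2 ::
  "('a, 'e::euclidean_space) manifold \<Rightarrow> ('a, 'e) dform \<Rightarrow> bool" where
  "locally_conformal_calibrated_G2 M \<phi> \<longleftrightarrow>
     G2_structure M \<phi> \<and>
     (\<exists>\<theta>. diff_form M 1 \<theta> \<and> form_eq M (ext_deriv 1 \<theta>) zero_form \<and> nowhere_zero M \<theta> \<and>
        form_eq M (ext_deriv 3 \<phi>) (scale_form (-1) (wedge_form 1 3 \<theta> \<phi>)))"


section \<open>The mapping torus\<close>

definition quotient_topology :: "'a topology \<Rightarrow> ('a \<Rightarrow> 'b) \<Rightarrow> 'b topology" where
  "quotient_topology X q =
     topology (\<lambda>U. U \<subseteq> q ` topspace X \<and> openin X {x \<in> topspace X. q x \<in> U})"

lemma openin_quotient_topology: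
  "openin (quotient_topology X q) U \<longleftrightarrow> U \<subseteq> q ` topspace X \<and> openin X {x \<in> topspace X. q x \<in> U}"
proof -
  have "istopology (\<lambda>U. U \<subseteq> q ` topspace X \<and> openin X {x \<in> topspace X. q x \<in> U})"
    unfolding istopology_def
  proof (intro conjI allI impI)
    fix S T
    assume S: "S \<subseteq> q ` topspace X \<and> openin X {x \<in> topspace X. q x \<in> S}"
      and T: "T \<subseteq> q ` topspace X \<and> openin X {x \<in> topspace X. q x \<in> T}"
    have "{x \<in> topspace X. q x \<in> S \<inter> T} = {x \<in> topspace X. q x \<in> S} \<inter> {x \<in> topspace X. q x \<in> T}"
      by auto
    then show "openin X {x \<in> topspace X. q x \<in> S \<inter> T}"
      using S T by (simp only: openin_Int)
    show "S \<inter> T \<subseteq> q ` topspace X"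
      using S by auto
  next
    fix K
    assume K: "\<forall>S\<in>K. S \<subseteq> q ` topspace X \<and> openin X {x \<in> topspace X. q x \<in> S}"
    have "{x \<in> topspace X. q x \<in> \<Union>K} = (\<Union>S\<in>K. {x \<in> topspace X. q x \<in> S})"
      by auto
    moreover have "openin X (\<Union>S\<in>K. {x \<in> topspace X. q x \<in> S})"
      using K by (intro openin_Union) blast
    ultimately show "openin X {x \<in> topspace X. q x \<in> \<Union>K}"
      by (simp only:)
    show "\<Union>K \<subseteq> q ` topspace X"
      using K by auto
  qed
  then show ?thesis
    unfolding quotient_topology_def by (simp add: topology_inverse')
qed

lemma topspace_quotient_topology: "topspace (quotient_topology X q) = q ` topspace X"
proof
  show "topspace (quotient_topology X q) \<subseteq> q ` topspace X"
    using openin_quotient_topology[of X q] openin_topspace by blast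
  have "{x \<in> topspace X. q x \<in> q ` topspace X} = topspace X"
    by auto
  then have "openin (quotient_topology X q) (q ` topspace X)"
    by (simp add: openin_quotient_topology)
  then show "q ` topspace X \<subseteq> topspace (quotient_topology X q)"
    by (rule openin_subset)
qed

lemma quotient_map_quotient_topology: "quotient_map X (quotient_topology X q) q"
  by (auto simp: quotient_map_def openin_quotient_topology topspace_quotient_topology)

text \<open>
  The orbit relation of the group generated by \<open>(p, t) \<mapsto> (\<nu> p, t + 1)\<close> on \<open>N \<times> \<real>\<close>; the two
  disjuncts are the non-negative and the non-positive powers of the generator.
\<close>

definition torus_rel ::
  "('a, 'e) manifold \<Rightarrow> ('a \<Rightarrow> 'a) \<Rightarrow> (('a \<times> real) \<times> ('a \<times> real)) set" where
  "torus_rel N \<nu> = {((p, s), (q, t)). p \<in> topspace (mtop N) \<and> q \<in> topspace (mtop N) \<and>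
     (\<exists>n::nat. (q = (\<nu> ^^ n) p \<and> t = s + real n) \<or> (p = (\<nu> ^^ n) q \<and> s = t + real n))}"

definition torus_proj :: "('a, 'e) manifold \<Rightarrow> ('a \<Rightarrow> 'a) \<Rightarrow> 'a \<times> real \<Rightarrow> ('a \<times> real) set" where
  "torus_proj N \<nu> x = torus_rel N \<nu> `` {x}"

text \<open>
  For a chart \<open>c\<close> of \<open>N\<close> and \<open>a \<in> \<real>\<close>, the projection is injective on \<open>cdom c \<times> (a, a + 1)\<close>, and
  the product chart there descends to a chart of the mapping torus.
\<close>

definition torus_chart ::
  "('a, 'e) manifold \<Rightarrow> ('a \<Rightarrow> 'a) \<Rightarrow> ('a, 'e) chart \<Rightarrow> real \<Rightarrow> (('a \<times> real) set, 'e \<times> real) chart" where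
  "torus_chart N \<nu> c a =
     (torus_proj N \<nu> ` (cdom c \<times> {a<..<a + 1}),
      map_prod (coord c) (\<lambda>t. t) \<circ> inv_into (cdom c \<times> {a<..<a + 1}) (torus_proj N \<nu>))"

definition mapping_torus ::
  "('a, 'e) manifold \<Rightarrow> ('a \<Rightarrow> 'a) \<Rightarrow> (('a \<times> real) set, 'e \<times> real) manifold" where
  "mapping_torus N \<nu> =
     \<lparr>mtop = quotient_topology (prod_topology (mtop N) euclideanreal) (torus_proj N \<nu>),
      atlas = {torus_chart N \<nu> c a |c a. c \<in> atlas N}\<rparr>"

text \<open>
  The image of \<open>d/dt\<close> under the differential of the projection: at the class of \<open>(p, t)\<close> it is the
  velocity at \<open>s = 0\<close> of the curve of classes of \<open>(p, t + s)\<close>, read in the chart \<open>c\<close>. The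
  representative \<open>(p, t)\<close> is arbitrary because \<open>d/dt\<close> is invariant under the group.
\<close>

definition torus_field ::
  "('a, 'e::euclidean_space) manifold \<Rightarrow> ('a \<Rightarrow> 'a) \<Rightarrow> (('a \<times> real) set, 'e \<times> real) vfield" where
  "torus_field N \<nu> = (\<lambda>c x.
     let (p, t) = (SOME y. y \<in> coord_inv c x)
     in vector_derivative (\<lambda>s. coord c (torus_proj N \<nu> (p, t + s))) (at 0))"

end

theory Submission
  imports Defs
begin

text \<open>
  On \<open>N \<times> \<real>\<close> consider \<open>\<phi> = \<omega> \<and> dt + \<psi> = dt \<and> \<omega> + \<psi>\<close>. A coframe of \<open>N\<close> adapted to the
  \<open>SU(3)\<close>-structure, completed by \<open>e\<^sup>7 = dt\<close>, brings \<open>\<phi>\<close> into the standard form of a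
  \<open>G\<^sub>2\<close>-structure (\<open>g2_form_standard\<close>). From \<open>d\<omega> = c \<psi>\<close> and \<open>c \<noteq> 0\<close> follows \<open>d\<psi> = 0\<close>
  (\<open>ed_ed_two_form\<close>), so that \<open>d\<phi> = -dt \<and> d\<omega> = -(c dt) \<and> \<phi>\<close> (\<open>ed_g2_form\<close>,
  \<open>wedge_dt_g2_form\<close>): the Lee form is \<open>\<theta> = c dt\<close>, which is closed and vanishes nowhere.

  The form \<open>\<phi>\<close> descends to the mapping torus if the deck transformation \<open>(p, t) \<mapsto> (\<nu> p, t + 1)\<close>
  preserves it. By assumption \<open>\<nu>\<^sup>*\<omega> = \<omega>\<close>, and since pullback commutes with \<open>d\<close>
  (\<open>ed_pullback_two_form\<close>) also \<open>c \<nu>\<^sup>*\<psi> = \<nu>\<^sup>*d\<omega> = d\<omega> = c \<psi>\<close> (\<open>preserves_ed\<close>). Moreover \<open>\<phi>\<close> does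
  not change under translations in \<open>t\<close>. These translations induce the flow of \<open>\<xi>\<close>, and so the Lie
  derivative of \<open>\<phi>\<close> along \<open>\<xi>\<close> vanishes.

  The mapping torus has to be shown to be a smooth manifold. The geometric input for this, and for the
  descent of forms, is one statement: between any two charts the flow looks locally like
  \<open>(x, t) \<mapsto> (\<nu>\<^sup>n x, t + s + n)\<close> with one integer \<open>n\<close> (\<open>flow_local_rep\<close>). At time \<open>0\<close> it describes the
  transition maps, so that invariance under the flow at all times covers both the compatibility of the
  local representatives of a form and the vanishing of its Lie derivative (\<open>flow_invariant\<close>,
  \<open>lift_form\<close>).

  The calculus behind this consists of the closure of smooth maps under composition and the symmetry
  of second derivatives (\<open>second_derivative_symmetric\<close>), which makes \<open>d\<close> natural and \<open>d \<circ> d = 0\<close>.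
\<close>

section \<open>Smooth maps\<close>

lemma frechet_derivative_eqI:
  "(f has_derivative f') (at x) \<Longrightarrow> frechet_derivative f (at x) = f'"
  by (metis frechet_derivative_at)

lemma frechet_derivative_cong_open:
  assumes "open U" "x \<in> U" "\<And>y. y \<in> U \<Longrightarrow> f y = g y"
  shows "frechet_derivative f (at x) = frechet_derivative g (at x)"
proof -
  have "(f has_derivative f') (at x) \<longleftrightarrow> (g has_derivative f') (at x)" for f'
    using assms has_derivative_transform_within_open[of f f' x UNIV U g]
      has_derivative_transform_within_open[of g f' x UNIV U f] by auto
  then show ?thesis by (simp add: frechet_derivative_def)
qed

lemma differentiable_cong_open:
  assumes "open U" "x \<in> U" "\<And>y. y \<in> U \<Longrightarrow> f y = g y"
  shows "f differentiable at x \<longleftrightarrow> g differentiable at x"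
  using assms has_derivative_transform_within_open[of f _ x UNIV U g]
      has_derivative_transform_within_open[of g _ x UNIV U f]
  by (auto simp: differentiable_def)

lemma Ck_on_cong:
  assumes "open S" "\<And>x. x \<in> S \<Longrightarrow> f x = g x"
  shows "Ck_on k S f \<longleftrightarrow> Ck_on k S g"
  using assms(2)
proof (induction k arbitrary: f g)
  case 0
  then show ?case by (simp cong: continuous_on_cong)
next
  case (Suc k)
  have "frechet_derivative f (at x) = frechet_derivative g (at x)" if "x \<in> S" for x
    using frechet_derivative_cong_open[OF assms(1) that Suc.prems] .
  then have "Ck_on k S (\<lambda>x. frechet_derivative f (at x) v) \<longleftrightarrow>
    Ck_on k S (\<lambda>x. frechet_derivative g (at x) v)" for v
    by (intro Suc.IH) auto
  moreover have "f differentiable at x \<longleftrightarrow> g differentiable at x" if "x \<in> S" for x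
    using differentiable_cong_open[OF assms(1) that Suc.prems] .
  ultimately show ?case by auto
qed

lemma Ck_on_subset: "Ck_on k S f \<Longrightarrow> T \<subseteq> S \<Longrightarrow> Ck_on k T f"
  by (induction k arbitrary: f) (auto intro: continuous_on_subset)

lemma Ck_on_locally:
  assumes "\<And>x. x \<in> S \<Longrightarrow> \<exists>U. open U \<and> x \<in> U \<and> Ck_on k U f"
  shows "Ck_on k S f"
  using assms
proof (induction k arbitrary: f)
  case 0
  then have "continuous (at x) f" if "x \<in> S" for x
    using that continuous_on_eq_continuous_at by fastforce
  then show ?case by (simp add: continuous_at_imp_continuous_on)
next
  case (Suc k)
  have "Ck_on k S (\<lambda>x. frechet_derivative f (at x) v)" for v
    using Suc.prems by (intro Suc.IH) fastforce
  moreover have "f differentiable at x" if "x \<in> S" for x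
    using Suc.prems[OF that] by auto
  ultimately show ?case by auto
qed

lemma Ck_on_SucD: "Ck_on (Suc k) S f \<Longrightarrow> Ck_on k S f"
proof (induction k arbitrary: f)
  case 0
  then show ?case
    by (simp add: continuous_at_imp_continuous_on differentiable_imp_continuous_within)
next
  case (Suc k)
  then show ?case by (metis Ck_on.simps(2))
qed

lemma Ck_on_const: "Ck_on k S (\<lambda>x. a)"
  by (induction k arbitrary: a) auto

lemma Ck_on_add:
  assumes "open S"
  shows "Ck_on k S f \<Longrightarrow> Ck_on k S g \<Longrightarrow> Ck_on k S (\<lambda>x. f x + g x)"
proof (induction k arbitrary: f g)
  case 0
  then show ?case by (simp add: continuous_on_add)
next
  case (Suc k)
  have D: "frechet_derivative (\<lambda>x. f x + g x) (at x) =
     (\<lambda>v. frechet_derivative f (at x) v + frechet_derivative g (at x) v)" if "x \<in> S" for x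
    by (rule frechet_derivative_eqI, rule has_derivative_add)
      (use Suc.prems that in \<open>auto simp: frechet_derivative_works[symmetric]\<close>)
  have "Ck_on k S (\<lambda>x. frechet_derivative (\<lambda>x. f x + g x) (at x) v)" for v
    using Suc.prems by (subst Ck_on_cong[OF assms, where g =
      "\<lambda>x. frechet_derivative f (at x) v + frechet_derivative g (at x) v"])
       (auto simp: D intro: Suc.IH)
  then show ?case using Suc.prems by auto
qed

text \<open>The product rule reproduces the same shape one order lower, so the induction has to be on all
  pairs of factors at once.\<close>

lemma Ck_on_scaleR:
  assumes "open S"
  shows "Ck_on k S u \<Longrightarrow> Ck_on k S f \<Longrightarrow> Ck_on k S (\<lambda>x. u x *\<^sub>R f x)"
proof (induction k arbitrary: u f)
  case 0
  then show ?case by (simp add: continuous_on_scaleR)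
next
  case (Suc k)
  have d: "(u has_derivative frechet_derivative u (at x)) (at x)"
    "(f has_derivative frechet_derivative f (at x)) (at x)" if "x \<in> S" for x
    using Suc.prems that by (auto simp: frechet_derivative_works[symmetric])
  have D: "frechet_derivative (\<lambda>x. u x *\<^sub>R f x) (at x) =
     (\<lambda>v. u x *\<^sub>R frechet_derivative f (at x) v + frechet_derivative u (at x) v *\<^sub>R f x)"
    if "x \<in> S" for x
    by (rule frechet_derivative_eqI, rule has_derivative_scaleR[OF d[OF that]])
  have C: "Ck_on k S u" "Ck_on k S f"
    using Suc.prems Ck_on_SucD by blast+
  have "Ck_on k S (\<lambda>x. frechet_derivative (\<lambda>x. u x *\<^sub>R f x) (at x) v)" for v
    using Suc.prems C by (subst Ck_on_cong[OF assms, where g =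
      "\<lambda>x. u x *\<^sub>R frechet_derivative f (at x) v + frechet_derivative u (at x) v *\<^sub>R f x"])
       (auto simp: D intro!: Ck_on_add[OF assms] Suc.IH)
  moreover have "(\<lambda>x. u x *\<^sub>R f x) differentiable at x" if "x \<in> S" for x
    using has_derivative_scaleR[OF d[OF that]] by (auto simp: differentiable_def)
  ultimately show ?case by auto
qed

lemma Ck_on_bounded_linear:
  assumes "open S" "bounded_linear h"
  shows "Ck_on k S f \<Longrightarrow> Ck_on k S (\<lambda>x. h (f x))"
proof (induction k arbitrary: f)
  case 0
  then show ?case using bounded_linear.continuous_on[OF assms(2)] by simp
next
  case (Suc k)
  have d: "((\<lambda>x. h (f x)) has_derivative (\<lambda>v. h (frechet_derivative f (at x) v))) (at x)"
    if "x \<in> S" for x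
    by (rule bounded_linear.has_derivative[OF assms(2)])
      (use Suc.prems that in \<open>auto simp: frechet_derivative_works[symmetric]\<close>)
  have D: "frechet_derivative (\<lambda>x. h (f x)) (at x) = (\<lambda>v. h (frechet_derivative f (at x) v))"
    if "x \<in> S" for x
    by (rule frechet_derivative_eqI[OF d[OF that]])
  have "Ck_on k S (\<lambda>x. frechet_derivative (\<lambda>x. h (f x)) (at x) v)" for v
    using Suc.prems by (subst Ck_on_cong[OF assms(1), where g =
      "\<lambda>x. h (frechet_derivative f (at x) v)"]) (auto simp: D intro: Suc.IH)
  then show ?case using d by (auto simp: differentiable_def)
qed

lemma Ck_on_sum:
  assumes "open S" "\<And>i. i \<in> I \<Longrightarrow> Ck_on k S (f i)"
  shows "Ck_on k S (\<lambda>x. \<Sum>i\<in>I. f i x)"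
  using assms(2) by (induction I rule: infinite_finite_induct)
    (auto intro: Ck_on_const Ck_on_add[OF assms(1)])

lemma Ck_on_linear:
  assumes "bounded_linear h" shows "Ck_on k S h"
proof (cases k)
  case 0
  then show ?thesis using bounded_linear.continuous_on[OF assms continuous_on_id] by simp
next
  case (Suc m)
  have d: "(h has_derivative h) (at x)" for x
    using assms by (rule bounded_linear.has_derivative[of h "\<lambda>x. x", OF _ has_derivative_ident])
  then have "frechet_derivative h (at x) = h" for x
    by (rule frechet_derivative_eqI)
  with d Suc show ?thesis by (auto simp: differentiable_def intro: Ck_on_const)
qed

lemma linear_eq_sum_Basis:
  fixes L :: "'a::euclidean_space \<Rightarrow> 'b::real_vector"
  assumes "linear L"
  shows "L v = (\<Sum>b\<in>Basis. (v \<bullet> b) *\<^sub>R L b)"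
  by (subst (1) euclidean_representation[symmetric])
    (simp add: linear_sum[OF assms] linear_scale[OF assms])

text \<open>In a basis, the directional derivative of a composition is a sum of products of
  directional derivatives of the two maps, so the induction on the order of differentiability
  needs only the closure under sums and products.\<close>

lemma Ck_on_compose:
  fixes g :: "'a::euclidean_space \<Rightarrow> 'b::euclidean_space" and f :: "'b \<Rightarrow> 'c::real_normed_vector"
  assumes "open S" "open T" "g ` S \<subseteq> T"
  shows "Ck_on k S g \<Longrightarrow> Ck_on k T f \<Longrightarrow> Ck_on k S (\<lambda>x. f (g x))"
proof (induction k arbitrary: f)
  case 0
  then show ?case
    using continuous_on_compose2[of T f S g] assms(3) by simp
next
  case (Suc k)
  have d: "((\<lambda>x. f (g x)) has_derivative
      (\<lambda>v. frechet_derivative f (at (g x)) (frechet_derivative g (at x) v))) (at x)"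
    if "x \<in> S" for x
    by (rule has_derivative_compose)
      (use Suc.prems that assms(3) in \<open>auto simp: frechet_derivative_works[symmetric]\<close>)
  have D: "frechet_derivative (\<lambda>x. f (g x)) (at x) v =
      (\<Sum>b\<in>Basis. (frechet_derivative g (at x) v \<bullet> b) *\<^sub>R frechet_derivative f (at (g x)) b)"
    if "x \<in> S" for x v
    unfolding frechet_derivative_eqI[OF d[OF that]]
    by (rule linear_eq_sum_Basis, rule linear_frechet_derivative)
      (use Suc.prems that assms(3) in auto)
  have "Ck_on k S (\<lambda>x. frechet_derivative (\<lambda>x. f (g x)) (at x) v)" for v
    using Suc.prems Ck_on_SucD[OF Suc.prems(1)]
    by (subst Ck_on_cong[OF assms(1), where g = "\<lambda>x. \<Sum>b\<in>Basis.
       (frechet_derivative g (at x) v \<bullet> b) *\<^sub>R frechet_derivative f (at (g x)) b"])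
      (auto simp: D intro!: Ck_on_sum assms(1) Ck_on_scaleR Suc.IH
        Ck_on_bounded_linear[where h = "\<lambda>w. w \<bullet> _"] bounded_linear_inner_left)
  then show ?case using d by (auto simp: differentiable_def)
qed

lemma smooth_on_cong:
  "open S \<Longrightarrow> (\<And>x. x \<in> S \<Longrightarrow> f x = g x) \<Longrightarrow> smooth_on S f \<longleftrightarrow> smooth_on S g"
  unfolding smooth_on_def using Ck_on_cong by blast

lemma smooth_on_subset: "smooth_on S f \<Longrightarrow> T \<subseteq> S \<Longrightarrow> smooth_on T f"
  unfolding smooth_on_def using Ck_on_subset by blast

lemma smooth_on_locally:
  "(\<And>x. x \<in> S \<Longrightarrow> \<exists>U. open U \<and> x \<in> U \<and> smooth_on U f) \<Longrightarrow> smooth_on S f"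
  unfolding smooth_on_def by (meson Ck_on_locally)

lemma smooth_on_const: "smooth_on S (\<lambda>x. a)"
  by (simp add: smooth_on_def Ck_on_const)

lemma smooth_on_linear: "bounded_linear h \<Longrightarrow> smooth_on S h"
  by (simp add: smooth_on_def Ck_on_linear)

lemma smooth_on_add:
  "open S \<Longrightarrow> smooth_on S f \<Longrightarrow> smooth_on S g \<Longrightarrow> smooth_on S (\<lambda>x. f x + g x)"
  by (simp add: smooth_on_def Ck_on_add)

lemma smooth_on_scaleR:
  "open S \<Longrightarrow> smooth_on S u \<Longrightarrow> smooth_on S f \<Longrightarrow> smooth_on S (\<lambda>x. u x *\<^sub>R f x)"
  by (simp add: smooth_on_def Ck_on_scaleR)

lemma smooth_on_bounded_linear:
  "open S \<Longrightarrow> bounded_linear h \<Longrightarrow> smooth_on S f \<Longrightarrow> smooth_on S (\<lambda>x. h (f x))"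
  by (simp add: smooth_on_def Ck_on_bounded_linear)

lemma smooth_on_compose:
  "open S \<Longrightarrow> open T \<Longrightarrow> g ` S \<subseteq> T \<Longrightarrow> smooth_on S g \<Longrightarrow> smooth_on T f \<Longrightarrow>
    smooth_on S (\<lambda>x. f (g x))"
  unfolding smooth_on_def using Ck_on_compose by blast

lemma smooth_on_Pair:
  assumes "open S" "smooth_on S f" "smooth_on S g"
  shows "smooth_on S (\<lambda>x. (f x, g x))"
proof -
  have "smooth_on S (\<lambda>x. (f x, 0) + (0, g x))"
    using assms by (intro smooth_on_add
        smooth_on_bounded_linear[where h = "\<lambda>y. (y, 0)"]
        smooth_on_bounded_linear[where h = "\<lambda>y. (0, y)"] bounded_linear_Pair
        bounded_linear_ident bounded_linear_zero)
  then show ?thesis by simp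
qed

lemma smooth_on_imp_continuous_on: "smooth_on S f \<Longrightarrow> continuous_on S f"
  unfolding smooth_on_def by (metis Ck_on.simps(1))

lemma smooth_on_has_derivative:
  "smooth_on S f \<Longrightarrow> x \<in> S \<Longrightarrow> (f has_derivative frechet_derivative f (at x)) (at x)"
  unfolding smooth_on_def using Ck_on.simps(2) frechet_derivative_works by blast

lemma smooth_on_derivative:
  "smooth_on S f \<Longrightarrow> smooth_on S (\<lambda>x. frechet_derivative f (at x) v)"
  unfolding smooth_on_def using Ck_on.simps(2) by blast

text \<open>The mean value theorem, applied in each of the two directions in turn, expresses the second
  difference of \<open>f\<close> over a small parallelogram by one value of its second derivative. The
  second difference does not depend on the order of the directions; as the parallelogram shrinks,
  this gives the symmetry of the second derivative.\<close>

lemma second_difference_mean_value: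
  fixes f :: "'a::euclidean_space \<Rightarrow> real"
  assumes f: "smooth_on S f" and h: "0 < h"
    and S: "\<And>s t. 0 \<le> s \<Longrightarrow> s \<le> h \<Longrightarrow> 0 \<le> t \<Longrightarrow> t \<le> h \<Longrightarrow> x + s *\<^sub>R u + t *\<^sub>R v \<in> S"
  obtains s t where "0 < s" "s < h" "0 < t" "t < h"
    "f (x + h *\<^sub>R u + h *\<^sub>R v) - f (x + h *\<^sub>R u) - f (x + h *\<^sub>R v) + f x =
     h * h * frechet_derivative (\<lambda>y. frechet_derivative f (at y) u) (at (x + s *\<^sub>R u + t *\<^sub>R v)) v"
proof -
  define G where "G = (\<lambda>y. frechet_derivative f (at y) u)"
  have G: "smooth_on S G"
    unfolding G_def by (rule smooth_on_derivative[OF f])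
  have df: "((\<lambda>s. f (x + s *\<^sub>R u + t *\<^sub>R v)) has_real_derivative G (x + s *\<^sub>R u + t *\<^sub>R v)) (at s)"
    if "0 \<le> s" "s \<le> h" "0 \<le> t" "t \<le> h" for s t
  proof -
    note d = smooth_on_has_derivative[OF f S[OF that]]
    have "((\<lambda>s. f (x + s *\<^sub>R u + t *\<^sub>R v)) has_derivative
       (\<lambda>r. frechet_derivative f (at (x + s *\<^sub>R u + t *\<^sub>R v)) (r *\<^sub>R u))) (at s)"
      by (rule has_derivative_compose[where g = f and f = "\<lambda>s. x + s *\<^sub>R u + t *\<^sub>R v", OF _ d])
        (auto intro!: derivative_eq_intros)
    moreover have "linear (frechet_derivative f (at (x + s *\<^sub>R u + t *\<^sub>R v)))"
      using d has_derivative_linear by blast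
    ultimately show ?thesis
      by (simp add: has_field_derivative_def G_def linear_scale mult.commute[of _ "frechet_derivative _ _ _"])
  qed
  have dG: "((\<lambda>t. G (x + s *\<^sub>R u + t *\<^sub>R v)) has_real_derivative
      frechet_derivative G (at (x + s *\<^sub>R u + t *\<^sub>R v)) v) (at t)"
    if "0 \<le> s" "s \<le> h" "0 \<le> t" "t \<le> h" for s t
  proof -
    note d = smooth_on_has_derivative[OF G S[OF that]]
    have "((\<lambda>t. G (x + s *\<^sub>R u + t *\<^sub>R v)) has_derivative
       (\<lambda>r. frechet_derivative G (at (x + s *\<^sub>R u + t *\<^sub>R v)) (r *\<^sub>R v))) (at t)"
      by (rule has_derivative_compose[where g = G and f = "\<lambda>t. x + s *\<^sub>R u + t *\<^sub>R v", OF _ d])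
        (auto intro!: derivative_eq_intros)
    moreover have "linear (frechet_derivative G (at (x + s *\<^sub>R u + t *\<^sub>R v)))"
      using d has_derivative_linear by blast
    ultimately show ?thesis
      by (simp add: has_field_derivative_def linear_scale mult.commute[of _ "frechet_derivative _ _ _"])
  qed
  have "\<exists>s>0. s < h \<and> (f (x + h *\<^sub>R u + h *\<^sub>R v) - f (x + h *\<^sub>R u + 0 *\<^sub>R v)) -
      (f (x + 0 *\<^sub>R u + h *\<^sub>R v) - f (x + 0 *\<^sub>R u + 0 *\<^sub>R v)) =
     (h - 0) * (G (x + s *\<^sub>R u + h *\<^sub>R v) - G (x + s *\<^sub>R u + 0 *\<^sub>R v))"
    by (rule MVT2[OF h, of "\<lambda>s. f (x + s *\<^sub>R u + h *\<^sub>R v) - f (x + s *\<^sub>R u + 0 *\<^sub>R v)"])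
      (use h in \<open>intro DERIV_diff df, auto\<close>)
  then obtain s where s: "0 < s" "s < h"
    "f (x + h *\<^sub>R u + h *\<^sub>R v) - f (x + h *\<^sub>R u) - f (x + h *\<^sub>R v) + f x =
     h * (G (x + s *\<^sub>R u + h *\<^sub>R v) - G (x + s *\<^sub>R u + 0 *\<^sub>R v))"
    by (auto simp: algebra_simps)
  have "\<exists>t>0. t < h \<and> G (x + s *\<^sub>R u + h *\<^sub>R v) - G (x + s *\<^sub>R u + 0 *\<^sub>R v) =
      (h - 0) * frechet_derivative G (at (x + s *\<^sub>R u + t *\<^sub>R v)) v"
    by (rule MVT2[OF h, of "\<lambda>t. G (x + s *\<^sub>R u + t *\<^sub>R v)"]) (use s in \<open>intro dG, auto\<close>)
  then obtain t where "0 < t" "t < h" "G (x + s *\<^sub>R u + h *\<^sub>R v) - G (x + s *\<^sub>R u + 0 *\<^sub>R v) =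
      h * frechet_derivative G (at (x + s *\<^sub>R u + t *\<^sub>R v)) v"
    by auto
  with s show thesis
    by (intro that[of s t]) (auto simp: G_def)
qed

lemma second_derivative_symmetric_real:
  fixes f :: "'a::euclidean_space \<Rightarrow> real"
  assumes "open S" "x \<in> S" and f: "smooth_on S f"
  shows "frechet_derivative (\<lambda>y. frechet_derivative f (at y) u) (at x) v =
         frechet_derivative (\<lambda>y. frechet_derivative f (at y) v) (at x) u"
proof -
  define D where "D = (\<lambda>u v y. frechet_derivative (\<lambda>y. frechet_derivative f (at y) u) (at y) v)"
  have D: "isCont (D u v) x" for u v
    unfolding D_def using assms continuous_on_eq_continuous_at[OF assms(1)]
    by (blast intro: smooth_on_imp_continuous_on smooth_on_derivative)
  have "\<bar>D u v x - D v u x\<bar> < e" if "0 < e" for e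
  proof -
    have "\<forall>\<^sub>F y in nhds x. dist (D u v y) (D u v x) < e / 2 \<and> dist (D v u y) (D v u x) < e / 2 \<and> y \<in> S"
      using D[of u v] D[of v u] that eventually_nhds_in_open[OF assms(1,2)]
      by (intro eventually_conj) (auto simp: isCont_def tendsto_at_iff_tendsto_nhds dest!: tendstoD[where e = "e / 2"])
    then obtain d where d: "d > 0" "\<And>y. dist y x < d \<Longrightarrow>
        dist (D u v y) (D u v x) < e / 2 \<and> dist (D v u y) (D v u x) < e / 2 \<and> y \<in> S"
      unfolding eventually_nhds_metric by blast
    define h where "h = d / (1 + norm u + norm v)"
    have h: "0 < h" "h * (norm u + norm v) < d"
      using d(1) by (auto simp: h_def field_simps add_pos_nonneg)
    have near: "dist (x + s *\<^sub>R u + t *\<^sub>R v) x < d" if "0 \<le> s" "s \<le> h" "0 \<le> t" "t \<le> h" for s t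
    proof -
      have "dist (x + s *\<^sub>R u + t *\<^sub>R v) x \<le> norm (s *\<^sub>R u) + norm (t *\<^sub>R v)"
        by (simp add: dist_norm add.assoc) (metis norm_scaleR norm_triangle_ineq)
      also have "\<dots> \<le> h * (norm u + norm v)"
        using that by (auto simp: distrib_left intro!: add_mono mult_right_mono)
      finally show ?thesis using h by simp
    qed
    obtain s t where st: "0 < s" "s < h" "0 < t" "t < h"
      "f (x + h *\<^sub>R u + h *\<^sub>R v) - f (x + h *\<^sub>R u) - f (x + h *\<^sub>R v) + f x =
       h * h * D u v (x + s *\<^sub>R u + t *\<^sub>R v)"
      unfolding D_def
      by (rule second_difference_mean_value[OF f h(1), of x u v]) (use near d in auto)
    obtain s' t' where st': "0 < s'" "s' < h" "0 < t'" "t' < h"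
      "f (x + h *\<^sub>R v + h *\<^sub>R u) - f (x + h *\<^sub>R v) - f (x + h *\<^sub>R u) + f x =
       h * h * D v u (x + s' *\<^sub>R v + t' *\<^sub>R u)"
      unfolding D_def
    proof (rule second_difference_mean_value[OF f h(1), of x v u])
      show "x + s *\<^sub>R v + t *\<^sub>R u \<in> S" if "0 \<le> s" "s \<le> h" "0 \<le> t" "t \<le> h" for s t
        using near[of t s] d(2)[of "x + s *\<^sub>R v + t *\<^sub>R u"] that by (simp add: ac_simps)
    qed
    have "D u v (x + s *\<^sub>R u + t *\<^sub>R v) = D v u (x + s' *\<^sub>R v + t' *\<^sub>R u)"
    proof -
      have "f (x + h *\<^sub>R v + h *\<^sub>R u) = f (x + h *\<^sub>R u + h *\<^sub>R v)"
        by (simp add: ac_simps)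
      then have "h * h * D u v (x + s *\<^sub>R u + t *\<^sub>R v) =
          h * h * D v u (x + s' *\<^sub>R v + t' *\<^sub>R u)"
        unfolding st(5)[symmetric] st'(5)[symmetric] by simp
      then show ?thesis using h(1) by simp
    qed
    moreover have "dist (D u v (x + s *\<^sub>R u + t *\<^sub>R v)) (D u v x) < e / 2"
      using d(2) near st by auto
    moreover have "dist (D v u (x + s' *\<^sub>R v + t' *\<^sub>R u)) (D v u x) < e / 2"
      using d(2)[of "x + s' *\<^sub>R v + t' *\<^sub>R u"] near[of t' s'] st' by (simp add: ac_simps)
    ultimately show ?thesis unfolding dist_real_def by linarith
  qed
  from this[of "\<bar>D u v x - D v u x\<bar>"] show ?thesis
    by (auto simp: D_def)
qed

lemma second_derivative_symmetric:
  fixes f :: "'a::euclidean_space \<Rightarrow> 'b::euclidean_space"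
  assumes "open S" "x \<in> S" and f: "smooth_on S f"
  shows "frechet_derivative (\<lambda>y. frechet_derivative f (at y) u) (at x) v =
         frechet_derivative (\<lambda>y. frechet_derivative f (at y) v) (at x) u"
proof (rule euclidean_eqI)
  fix b :: 'b assume "b \<in> Basis"
  have fb: "smooth_on S (\<lambda>y. f y \<bullet> b)"
    by (intro smooth_on_bounded_linear[where h = "\<lambda>w. w \<bullet> b"] assms bounded_linear_inner_left)
  have inner: "frechet_derivative (\<lambda>y. g y \<bullet> b) (at y) w = frechet_derivative g (at y) w \<bullet> b"
    if "smooth_on S g" "y \<in> S" for g :: "'a \<Rightarrow> 'b" and y w
    using frechet_derivative_eqI[OF has_derivative_inner_left[OF smooth_on_has_derivative[OF that]]]
    by simp
  have second: "frechet_derivative (\<lambda>y. frechet_derivative (\<lambda>y. f y \<bullet> b) (at y) u) (at x) v =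
      frechet_derivative (\<lambda>y. frechet_derivative f (at y) u) (at x) v \<bullet> b" for u v
    using frechet_derivative_cong_open[OF assms(1,2), where f = "\<lambda>y. frechet_derivative (\<lambda>y. f y \<bullet> b) (at y) u"
        and g = "\<lambda>y. frechet_derivative f (at y) u \<bullet> b"]
    by (simp add: inner f assms(2) smooth_on_derivative)
  show "frechet_derivative (\<lambda>y. frechet_derivative f (at y) u) (at x) v \<bullet> b =
        frechet_derivative (\<lambda>y. frechet_derivative f (at y) v) (at x) u \<bullet> b"
    using second_derivative_symmetric_real[OF assms(1,2) fb, of u v] by (simp add: second)
qed

section \<open>Exterior algebra\<close>

definition omit :: "nat \<Rightarrow> (nat \<Rightarrow> 'e) \<Rightarrow> nat \<Rightarrow> 'e" where
  "omit i v = (\<lambda>j. if j < i then v j else v (Suc j))"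

lemma alternating_form_cong:
  "alternating_form k \<alpha> \<Longrightarrow> (\<And>i. i < k \<Longrightarrow> v i = w i) \<Longrightarrow> \<alpha> v = \<alpha> w"
  by (simp add: alternating_form_def)

lemma alternating_form_linear:
  "alternating_form k \<alpha> \<Longrightarrow> i < k \<Longrightarrow> linear (\<lambda>x. \<alpha> (v(i := x)))"
  by (simp add: alternating_form_def)

lemma alternating_form_eq_0:
  "alternating_form k \<alpha> \<Longrightarrow> i < k \<Longrightarrow> j < k \<Longrightarrow> i \<noteq> j \<Longrightarrow> v i = v j \<Longrightarrow> \<alpha> v = 0"
  unfolding alternating_form_def by blast

lemma alternating_form_pullback_lin:
  assumes \<alpha>: "alternating_form k \<alpha>" and A: "linear A"
  shows "alternating_form k (pullback_lin A \<alpha>)"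
  unfolding alternating_form_def
proof (intro conjI allI impI)
  show "pullback_lin A \<alpha> v = pullback_lin A \<alpha> w" if "\<forall>i<k. v i = w i" for v w
    unfolding pullback_lin_def using that by (intro alternating_form_cong[OF \<alpha>]) simp
  show "linear (\<lambda>x. pullback_lin A \<alpha> (v(i := x)))" if "i < k" for v i
  proof -
    have "(\<lambda>x. pullback_lin A \<alpha> (v(i := x))) = (\<lambda>y. \<alpha> ((\<lambda>j. A (v j))(i := y))) \<circ> A"
      by (auto simp: fun_eq_iff pullback_lin_def intro!: arg_cong[where f = \<alpha>])
    then show ?thesis
      using linear_compose[OF A alternating_form_linear[OF \<alpha> that]] by simp
  qed
  show "pullback_lin A \<alpha> v = 0" if "i < k" "j < k" "i \<noteq> j \<and> v i = v j" for v i j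
    unfolding pullback_lin_def using that by (intro alternating_form_eq_0[OF \<alpha> that(1,2)]) auto
qed

text \<open>Polarisation: the form vanishes when both slots hold the sum of the two vectors.\<close>

lemma alternating_form_swap:
  assumes \<alpha>: "alternating_form k \<alpha>" and ij: "i < k" "j < k" "i \<noteq> j"
    and w: "w i = v j" "w j = v i" "\<And>m. m < k \<Longrightarrow> m \<noteq> i \<Longrightarrow> m \<noteq> j \<Longrightarrow> w m = v m"
  shows "\<alpha> w = - \<alpha> v"
proof -
  define F where "F = (\<lambda>a b. \<alpha> (v(i := a, j := b)))"
  have add2: "F a (b + b') = F a b + F a b'" for a b b'
    unfolding F_def using linear_add[OF alternating_form_linear[OF \<alpha> ij(2)]] by blast
  have swap: "F a b = \<alpha> (v(j := b, i := a))" for a b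
    using ij(3) by (simp add: F_def fun_upd_twist)
  have add1: "F (a + a') b = F a b + F a' b" for a a' b
    unfolding swap using linear_add[OF alternating_form_linear[OF \<alpha> ij(1)]] by blast
  have zero: "F a a = 0" for a
    unfolding F_def using ij by (intro alternating_form_eq_0[OF \<alpha> ij]) auto
  have "F (v i + v j) (v i + v j) = F (v i) (v i) + F (v i) (v j) + (F (v j) (v i) + F (v j) (v j))"
    by (simp add: add1 add2)
  then have "F (v j) (v i) = - F (v i) (v j)"
    by (simp add: zero)
  moreover have "F (v j) (v i) = \<alpha> w"
    unfolding F_def using w ij by (intro alternating_form_cong[OF \<alpha>]) auto
  ultimately show ?thesis
    by (simp add: F_def)
qed

text \<open>The indices are shifted by one because the permutations of interest act on \<open>{..l}\<close> and fix the
  index \<open>0\<close>, which belongs to the one-form in a wedge product.\<close>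

lemma alternating_form_permute_tail:
  assumes \<beta>: "alternating_form l \<beta>" and q: "q permutes {1..l}"
  shows "\<beta> (\<lambda>i. v (q (Suc i))) = of_int (sign q) * \<beta> (\<lambda>i. v (Suc i))"
  using q finite_atLeastAtMost
proof (induction q arbitrary: v rule: permutes_induct)
  case id
  then show ?case by (simp add: sign_id)
next
  case (swap a b p)
  let ?t = "Transposition.transpose a b"
  have "\<beta> (\<lambda>i. v ((?t \<circ> p) (Suc i))) = of_int (sign p) * \<beta> (\<lambda>i. v (?t (Suc i)))"
    using swap.IH[of "\<lambda>i. v (?t i)"] by simp
  also have "\<beta> (\<lambda>i. v (?t (Suc i))) = - \<beta> (\<lambda>i. v (Suc i))"
    using swap.hyps by (intro alternating_form_swap[OF \<beta>, of "a - 1" "b - 1"])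
      (auto simp: transpose_def)
  also have "of_int (sign p) * - \<beta> (\<lambda>i. v (Suc i)) = of_int (sign (?t \<circ> p)) * \<beta> (\<lambda>i. v (Suc i))"
  proof -
    have "sign (?t \<circ> p) = - sign p"
      using swap.hyps sign_compose[OF permutation_swap_id[of a b], of p]
        permutation_permutes[of p] by (auto simp: sign_swap_id)
    then show ?thesis by simp
  qed
  finally show ?case .
qed

text \<open>Swapping \<open>0\<close> with \<open>b + 1\<close> and then dropping the first entry leaves the entry \<open>0\<close> in place \<open>b\<close>; it
  takes \<open>b\<close> adjacent swaps to bring it back to the front.\<close>

lemma alternating_form_omit:
  assumes \<beta>: "alternating_form l \<beta>" and b: "b < l"
  shows "\<beta> (\<lambda>i. v (Transposition.transpose 0 (Suc b) (Suc i))) = (-1) ^ b * \<beta> (omit (Suc b) v)"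
  using b
proof (induction b arbitrary: v)
  case 0
  then show ?case
    by (auto intro!: alternating_form_cong[OF \<beta>] simp: omit_def transpose_def)
next
  case (Suc b)
  define w where "w = v \<circ> Transposition.transpose (Suc b) (Suc (Suc b))"
  have "\<beta> (\<lambda>i. v (Transposition.transpose 0 (Suc (Suc b)) (Suc i))) =
      - \<beta> (\<lambda>i. w (Transposition.transpose 0 (Suc b) (Suc i)))"
    using Suc.prems by (intro alternating_form_swap[OF \<beta>, of b "Suc b"])
      (auto simp: w_def transpose_def)
  also have "\<dots> = - ((-1) ^ b * \<beta> (omit (Suc b) w))"
    using Suc by simp
  also have "omit (Suc b) w = omit (Suc (Suc b)) v"
    by (auto simp: fun_eq_iff omit_def w_def transpose_def less_Suc_eq)
  finally show ?case by simp
qed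

text \<open>Grouping the permutations by the index \<open>b\<close> of the vector that is fed to the one-form, the
  remaining \<open>l!\<close> permutations all contribute the same amount, which cancels the normalisation.\<close>

lemma wedge_one_form:
  assumes \<beta>: "alternating_form l \<beta>"
  shows "wedge 1 l (\<lambda>v. a (v 0)) \<beta> v = (\<Sum>i\<le>l. (-1) ^ i * a (v i) * \<beta> (omit i v))"
proof -
  let ?T = "\<lambda>b. Transposition.transpose 0 b :: nat \<Rightarrow> nat"
  define f where "f = (\<lambda>\<sigma>. of_int (sign \<sigma>) * a (v (\<sigma> 0)) * \<beta> (\<lambda>i. v (\<sigma> (1 + i))))"
  have ins: "{..<1 + l} = insert 0 {1..l}"
    by auto
  have summand: "f (?T b \<circ> q) = of_int (sign (?T b)) * a (v b) * \<beta> (\<lambda>i. v (?T b (Suc i)))"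
    if q: "q permutes {1..l}" for b q
  proof -
    have "q 0 = 0"
      using q by (simp add: permutes_not_in)
    moreover have "sign (?T b \<circ> q) = sign (?T b) * sign q"
      using q permutation_permutes[of q] by (intro sign_compose permutation_swap_id) auto
    moreover have "\<beta> (\<lambda>i. v (?T b (q (Suc i)))) = of_int (sign q) * \<beta> (\<lambda>i. v (?T b (Suc i)))"
      by (rule alternating_form_permute_tail[OF \<beta> q, of "\<lambda>i. v (?T b i)"])
    moreover have "of_int (sign q) * of_int (sign q) = (1::real)"
      by (simp add: sign_def)
    ultimately show ?thesis
      by (simp add: f_def)
  qed
  have "sum f {\<sigma>. \<sigma> permutes {..<1 + l}} =
      (\<Sum>b\<in>insert 0 {1..l}. \<Sum>q | q permutes {1..l}. f (?T b \<circ> q))"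
    unfolding ins by (rule sum_over_permutations_insert) auto
  also have "\<dots> = (\<Sum>b\<in>insert 0 {1..l}. fact l *
      (of_int (sign (?T b)) * a (v b) * \<beta> (\<lambda>i. v (?T b (Suc i)))))"
    using card_permutations[of "{1..l}" l] by (intro sum.cong refl) (simp add: summand)
  also have "\<dots> = fact l * (\<Sum>b\<in>insert 0 {1..l}.
      of_int (sign (?T b)) * a (v b) * \<beta> (\<lambda>i. v (?T b (Suc i))))"
    by (simp only: sum_distrib_left)
  also have "(\<Sum>b\<in>insert 0 {1..l}. of_int (sign (?T b)) * a (v b) * \<beta> (\<lambda>i. v (?T b (Suc i)))) =
      (\<Sum>i\<in>insert 0 {1..l}. (-1) ^ i * a (v i) * \<beta> (omit i v))"
  proof (intro sum.cong refl)
    fix b assume "b \<in> insert 0 {1..l}"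
    then consider "b = 0" | m where "b = Suc m" "m < l"
      by (cases b) auto
    then show "of_int (sign (?T b)) * a (v b) * \<beta> (\<lambda>i. v (?T b (Suc i))) =
        (-1) ^ b * a (v b) * \<beta> (omit b v)"
    proof cases
      case 1
      then show ?thesis by (simp add: omit_def sign_id)
    next
      case 2
      then show ?thesis
        using alternating_form_omit[OF \<beta> 2(2), of v] by (simp add: sign_swap_id)
    qed
  qed
  also have "insert 0 {1..l} = {..l}"
    by auto
  finally show ?thesis
    by (simp add: wedge_def f_def)
qed

subsection \<open>Forms of degree two and three\<close>

text \<open>A two-form reads only the first two entries of a sequence, so any continuation of the pair will
  do.\<close>

definition pair_seq :: "'e \<Rightarrow> 'e \<Rightarrow> nat \<Rightarrow> 'e" where
  "pair_seq a b = (\<lambda>i. if i = 0 then a else b)"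

lemma pair_seq_simps [simp]: "pair_seq a b 0 = a" "pair_seq a b (Suc i) = b"
  by (simp_all add: pair_seq_def)

lemma two_form_eq_pair:
  "alternating_form 2 \<alpha> \<Longrightarrow> \<alpha> v = \<alpha> (pair_seq (v 0) (v 1))"
  by (rule alternating_form_cong[of 2]) (auto simp: less_2_cases_iff)

lemma two_form_bilinear:
  assumes "alternating_form 2 \<alpha>"
  shows "linear (\<lambda>a. \<alpha> (pair_seq a b))" "linear (\<lambda>b. \<alpha> (pair_seq a b))"
proof -
  have "(\<lambda>a. \<alpha> (pair_seq a b)) = (\<lambda>a. \<alpha> ((pair_seq 0 b)(0 := a)))"
    by (intro ext alternating_form_cong[OF assms]) (auto simp: less_2_cases_iff)
  then show "linear (\<lambda>a. \<alpha> (pair_seq a b))"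
    using alternating_form_linear[OF assms, of 0] by simp
  have "(\<lambda>b. \<alpha> (pair_seq a b)) = (\<lambda>b. \<alpha> ((pair_seq a 0)(1 := b)))"
    by (intro ext alternating_form_cong[OF assms]) (auto simp: less_2_cases_iff)
  then show "linear (\<lambda>b. \<alpha> (pair_seq a b))"
    using alternating_form_linear[OF assms, of 1] by simp
qed

lemma two_form_antisym:
  assumes "alternating_form 2 \<alpha>"
  shows "\<alpha> (pair_seq a b) = - \<alpha> (pair_seq b a)"
  by (rule alternating_form_swap[OF assms, of 0 1]) auto

lemma alternating_form_add:
  assumes "alternating_form k \<alpha>" "alternating_form k \<beta>"
  shows "alternating_form k (\<lambda>v. \<alpha> v + \<beta> v)"
  unfolding alternating_form_def
proof (intro conjI allI impI)
  show "\<alpha> v + \<beta> v = \<alpha> w + \<beta> w" if "\<forall>i<k. v i = w i" for v w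
    using that by (intro arg_cong2[where f = "(+)"] alternating_form_cong[OF assms(1)]
      alternating_form_cong[OF assms(2)]) auto
  show "linear (\<lambda>x. \<alpha> (v(i := x)) + \<beta> (v(i := x)))" if "i < k" for v i
    using that assms by (intro linear_compose_add alternating_form_linear)
  show "\<alpha> v + \<beta> v = 0" if "i < k" "j < k" "i \<noteq> j \<and> v i = v j" for v i j
    using that alternating_form_eq_0[OF assms(1), of i j v]
      alternating_form_eq_0[OF assms(2), of i j v] by simp
qed

lemma all_less_3: "(\<forall>i<(3::nat). P i) \<longleftrightarrow> P 0 \<and> P 1 \<and> P 2"
  by (auto simp: numeral_eq_Suc less_Suc_eq)

text \<open>The only case that is not immediate is that of equal outer vectors: there the two remaining terms
  cancel because \<open>\<omega>\<close> is antisymmetric.\<close>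

lemma alternating_form_dt_wedge:
  assumes \<omega>: "alternating_form 2 \<omega>"
  shows "alternating_form 3 (\<lambda>v. snd (v 0) * \<omega> (pair_seq (fst (v 1)) (fst (v 2)))
     - snd (v 1) * \<omega> (pair_seq (fst (v 0)) (fst (v 2)))
     + snd (v 2) * \<omega> (pair_seq (fst (v 0)) (fst (v 1))) :: real)"
    (is "alternating_form 3 ?F")
proof -
  note B = two_form_bilinear[OF \<omega>]
  have B': "linear (\<lambda>x. \<omega> (pair_seq (fst x) b))" "linear (\<lambda>x. \<omega> (pair_seq b (fst x)))" for b
    using linear_compose[OF linear_fst B(1)] linear_compose[OF linear_fst B(2)]
    by (simp_all add: o_def)
  have s: "linear (\<lambda>x. snd x * r)" for r :: real
    by (intro linearI) (auto simp: algebra_simps)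
  have B'': "linear (\<lambda>x. r * \<omega> (pair_seq (fst x) b))" "linear (\<lambda>x. r * \<omega> (pair_seq b (fst x)))" for b r
    using linear_compose_scale_right[OF B'(1), of r] linear_compose_scale_right[OF B'(2), of r]
    by simp_all
  have "\<forall>v. \<forall>i<3. linear (\<lambda>x. ?F (v(i := x)))"
    unfolding all_less_3 by (auto intro!: linear_compose_sub linear_compose_add s B'')
  moreover have "\<forall>v. \<forall>i<3. \<forall>j<3. i \<noteq> j \<and> v i = v j \<longrightarrow> ?F v = 0"
  proof
    fix v :: "nat \<Rightarrow> 'a \<times> real"
    have "\<omega> (pair_seq a a) = 0" for a
      by (rule alternating_form_eq_0[OF \<omega>, of 0 1]) auto
    moreover have "\<omega> (pair_seq (fst (v 1)) (fst (v 0))) = - \<omega> (pair_seq (fst (v 0)) (fst (v 1)))"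
      by (rule two_form_antisym[OF \<omega>])
    ultimately show "\<forall>i<3. \<forall>j<3. i \<noteq> j \<and> v i = v j \<longrightarrow> ?F v = 0"
      unfolding all_less_3 by auto
  qed
  moreover have "\<forall>v w. (\<forall>i<3. v i = w i) \<longrightarrow> ?F v = ?F w"
    unfolding all_less_3 by simp
  ultimately show ?thesis
    unfolding alternating_form_def by (intro conjI)
qed

subsection \<open>The three-form on the product\<close>

text \<open>The form \<open>dt \<and> \<omega> + \<psi> = \<omega> \<and> dt + \<psi>\<close> on \<open>E \<times> \<real>\<close>.\<close>

definition g2_form :: "'e mform \<Rightarrow> 'e mform \<Rightarrow> ('e \<times> real) mform" where
  "g2_form \<omega> \<psi> = (\<lambda>v. snd (v 0) * \<omega> (pair_seq (fst (v 1)) (fst (v 2)))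
     - snd (v 1) * \<omega> (pair_seq (fst (v 0)) (fst (v 2)))
     + snd (v 2) * \<omega> (pair_seq (fst (v 0)) (fst (v 1))) + \<psi> (\<lambda>i. fst (v i)))"

lemma alternating_form_g2_form:
  assumes "alternating_form 2 \<omega>" "alternating_form 3 \<psi>"
  shows "alternating_form 3 (g2_form \<omega> \<psi>)"
proof -
  have "alternating_form 3 (pullback_lin (fst :: 'a \<times> real \<Rightarrow> 'a) \<psi>)"
    by (rule alternating_form_pullback_lin[OF assms(2) linear_fst])
  from alternating_form_add[OF alternating_form_dt_wedge[OF assms(1)] this] show ?thesis
    by (simp only: g2_form_def pullback_lin_def)
qed

lemma cowedge_1: "cowedge e [i] v = e i (v 0)"
proof -
  have "alternating_form 0 (\<lambda>v. 1 :: real)"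
    by (simp add: alternating_form_def)
  from wedge_one_form[OF this, of "blinfun_apply (e i)" v] show ?thesis by simp
qed

lemma alternating_cowedge_1: "alternating_form 1 (cowedge e [i])"
  using blinfun.bounded_linear_right[of "e i"]
  unfolding alternating_form_def by (auto simp del: cowedge.simps simp: cowedge_1
    intro: bounded_linear.linear)

lemma cowedge_2: "cowedge e [i, j] v = e i (v 0) * e j (v 1) - e i (v 1) * e j (v 0)"
proof -
  have "cowedge e [i, j] v = wedge 1 1 (\<lambda>v. e i (v 0)) (cowedge e [j]) v"
    by (simp del: cowedge.simps(1))
  then show ?thesis
    unfolding wedge_one_form[OF alternating_cowedge_1]
    by (simp del: cowedge.simps add: cowedge_1 omit_def)
qed

lemma alternating_cowedge_2: "alternating_form 2 (cowedge e [i, j])"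
proof -
  have *: "(\<forall>i<(2::nat). P i) \<longleftrightarrow> P 0 \<and> P 1" for P
    by (auto simp: less_2_cases_iff)
  have lin: "linear (\<lambda>x. e i x * r)" "linear (\<lambda>x. r * e i x)" for i r
    by (auto intro!: linearI simp: blinfun.bilinear_simps algebra_simps)
  show ?thesis
    unfolding alternating_form_def *
    by (auto simp del: cowedge.simps simp: cowedge_2 intro!: linear_compose_sub lin)
qed

lemma cowedge_3: "cowedge e [i, j, k] v =
    e i (v 0) * (e j (v 1) * e k (v 2) - e j (v 2) * e k (v 1))
  - e i (v 1) * (e j (v 0) * e k (v 2) - e j (v 2) * e k (v 0))
  + e i (v 2) * (e j (v 0) * e k (v 1) - e j (v 1) * e k (v 0))"
proof -
  have "cowedge e [i, j, k] v = wedge 1 2 (\<lambda>v. e i (v 0)) (cowedge e [j, k]) v"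
    by (simp del: cowedge.simps(1) add: numeral_2_eq_2)
  then show ?thesis
    unfolding wedge_one_form[OF alternating_cowedge_2]
    by (simp del: cowedge.simps add: cowedge_2 omit_def numeral_2_eq_2)
qed

text \<open>The covectors of \<open>E\<close> pulled back to \<open>E \<times> \<real>\<close>, followed by \<open>dt\<close>: the coframe in which
  \<open>dt \<and> \<omega> + \<psi>\<close> takes the standard form of a \<open>G\<^sub>2\<close>-structure.\<close>

definition product_coframe ::
    "nat \<Rightarrow> (nat \<Rightarrow> 'e::euclidean_space \<Rightarrow>\<^sub>L real) \<Rightarrow> nat \<Rightarrow> ('e \<times> real) \<Rightarrow>\<^sub>L real" where
  "product_coframe n e i = (if i \<le> n then e i o\<^sub>L Blinfun fst else Blinfun snd)"

lemma product_coframe_apply [simp]: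
  "product_coframe n e i x = (if i \<le> n then e i (fst x) else snd x)"
  by (simp add: product_coframe_def bounded_linear_Blinfun_apply bounded_linear_fst
      bounded_linear_snd)

text \<open>The pulled back covectors are the linear forms that vanish on the vector \<open>(0, 1)\<close>, and \<open>dt\<close> does not
  vanish there. This separates \<open>dt\<close> from their span, and subtracting a multiple of \<open>dt\<close> moves any
  linear form into that span.\<close>

lemma coframe_product_coframe:
  fixes e :: "nat \<Rightarrow> 'e::euclidean_space \<Rightarrow>\<^sub>L real"
  assumes "coframe n e"
  shows "coframe (Suc n) (product_coframe n e)"
proof -
  let ?e = "product_coframe n e"
  define P :: "('e \<Rightarrow>\<^sub>L real) \<Rightarrow> ('e \<times> real) \<Rightarrow>\<^sub>L real" where "P = (\<lambda>f. f o\<^sub>L Blinfun fst)"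
  define s :: "('e \<times> real) \<Rightarrow>\<^sub>L real" where "s = Blinfun snd"
  have Pa: "P f x = f (fst x)" for f x
    by (simp add: P_def bounded_linear_Blinfun_apply bounded_linear_fst)
  have sa: "s x = snd x" for x
    by (simp add: s_def bounded_linear_Blinfun_apply bounded_linear_snd)
  have P: "linear P"
    by (intro linearI blinfun_eqI) (auto simp: Pa blinfun.bilinear_simps)
  have injP: "inj P"
  proof (rule injI, rule blinfun_eqI)
    fix f g x assume "P f = P g"
    then have "P f (x, 0) = P g (x, 0)" by simp
    then show "f x = g x" by (simp add: Pa)
  qed
  have split: "{1..Suc n} = insert (Suc n) {1..n}"
    by auto
  have eP: "?e i = P (e i)" if "i \<in> {1..n}" for i
    using that by (simp add: product_coframe_def P_def)
  have es: "?e (Suc n) = s"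
    by (simp add: product_coframe_def s_def)
  have img: "?e ` {1..Suc n} = insert s (P ` (e ` {1..n}))"
    unfolding split by (auto simp: es eP image_image cong: image_cong_simp)
  have "P f (0, 1) = 0" for f
    by (simp add: Pa blinfun.zero_right)
  then have notin: "s \<noteq> P f" for f
    using sa[of "(0, 1)"] by (metis snd_conv zero_neq_one)
  have spanP: "span (P ` (e ` {1..n})) = range P"
    using assms by (simp add: linear_span_image[OF P] coframe_def)
  have "inj_on ?e {1..n}"
  proof (rule inj_onI)
    fix i j assume ij: "i \<in> {1..n}" "j \<in> {1..n}" "?e i = ?e j"
    then have "P (e i) = P (e j)"
      using eP by metis
    then show "i = j"
      using assms ij(1,2) by (auto simp: coframe_def dest: inj_onD injD[OF injP])
  qed
  then have "inj_on ?e {1..Suc n}"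
    unfolding split by (auto simp: es eP notin)
  moreover have "independent (?e ` {1..Suc n})"
    unfolding img
  proof (rule independent_insertI)
    show "s \<notin> span (P ` (e ` {1..n}))"
      unfolding spanP using notin by auto
    show "independent (P ` (e ` {1..n}))"
      using assms P inj_on_subset[OF injP]
      by (intro linear_independent_injective_image) (auto simp: coframe_def)
  qed
  moreover have "f \<in> span (?e ` {1..Suc n})" for f
  proof -
    have "f = P (f o\<^sub>L Blinfun (\<lambda>x. (x, 0))) + f (0, 1) *\<^sub>R s"
    proof (rule blinfun_eqI)
      fix x :: "'e \<times> real"
      have "bounded_linear (\<lambda>x::'e. (x, 0::real))"
        by (intro bounded_linear_Pair bounded_linear_ident bounded_linear_zero)
      moreover have "f x = f ((fst x, 0) + snd x *\<^sub>R (0, 1))"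
        by (cases x) simp
      ultimately show "f x = (P (f o\<^sub>L Blinfun (\<lambda>x. (x, 0))) + f (0, 1) *\<^sub>R s) x"
        by (simp add: Pa sa blinfun.bilinear_simps bounded_linear_Blinfun_apply del: scaleR_Pair add_Pair)
    qed
    moreover have "P g \<in> span (insert s (P ` (e ` {1..n})))" for g
      using spanP span_mono[of "P ` (e ` {1..n})" "insert s (P ` (e ` {1..n}))"] by blast
    ultimately show ?thesis
      unfolding img by (metis insertI1 span_add span_base span_scale)
  qed
  ultimately show ?thesis
    unfolding coframe_def by blast
qed

text \<open>Since \<open>e\<^sup>i \<and> e\<^sup>j \<and> dt = dt \<and> e\<^sup>i \<and> e\<^sup>j\<close>, the terms of the standard form that contain \<open>dt\<close> make up
  \<open>dt \<and> \<omega>\<close>.\<close>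

lemma cowedge_product_coframe_last:
  assumes "i \<le> n" "j \<le> n"
  shows "cowedge (product_coframe n e) [i, j, Suc n] v =
     snd (v 0) * cowedge e [i, j] (pair_seq (fst (v 1)) (fst (v 2)))
   - snd (v 1) * cowedge e [i, j] (pair_seq (fst (v 0)) (fst (v 2)))
   + snd (v 2) * cowedge e [i, j] (pair_seq (fst (v 0)) (fst (v 1)))"
  using assms by (simp del: cowedge.simps add: cowedge_2 cowedge_3 algebra_simps)

lemma cowedge_product_coframe_first:
  assumes "i \<le> n" "j \<le> n" "k \<le> n"
  shows "cowedge (product_coframe n e) [i, j, k] v = cowedge e [i, j, k] (\<lambda>m. fst (v m))"
  using assms by (simp del: cowedge.simps add: cowedge_3)

lemma g2_form_standard:
  assumes e: "coframe 6 e"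
    and \<omega>: "\<omega> = (\<lambda>v. cowedge e [1,2] v + cowedge e [3,4] v + cowedge e [5,6] v)"
    and \<psi>: "\<psi> = (\<lambda>v. cowedge e [1,3,5] v - cowedge e [1,4,6] v
                    - cowedge e [2,3,6] v - cowedge e [2,4,5] v)"
  shows "\<exists>e. coframe 7 e \<and>
     g2_form \<omega> \<psi> = (\<lambda>v. cowedge e [1,2,7] v + cowedge e [3,4,7] v + cowedge e [5,6,7] v
                    + cowedge e [1,3,5] v - cowedge e [1,4,6] v
                    - cowedge e [2,3,6] v - cowedge e [2,4,5] v)"
proof (intro exI conjI ext)
  show "coframe 7 (product_coframe 6 e)"
    using coframe_product_coframe[OF e] by simp
  fix v :: "nat \<Rightarrow> 'a \<times> real"
  show "g2_form \<omega> \<psi> v = cowedge (product_coframe 6 e) [1,2,7] v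
     + cowedge (product_coframe 6 e) [3,4,7] v + cowedge (product_coframe 6 e) [5,6,7] v
     + cowedge (product_coframe 6 e) [1,3,5] v - cowedge (product_coframe 6 e) [1,4,6] v
     - cowedge (product_coframe 6 e) [2,3,6] v - cowedge (product_coframe 6 e) [2,4,5] v"
    using cowedge_product_coframe_last[of 1 6 2 e v] cowedge_product_coframe_last[of 3 6 4 e v]
      cowedge_product_coframe_last[of 5 6 6 e v]
    by (simp del: cowedge.simps add: \<omega> \<psi> g2_form_def cowedge_product_coframe_first)
      (simp del: cowedge.simps add: algebra_simps)
qed

lemma sum_atMost_3: "(\<Sum>i\<le>(3::nat). f i) = f 0 + f 1 + f 2 + (f 3 :: 'a::comm_monoid_add)"
  by (simp add: numeral_eq_Suc)

text \<open>In the wedge product with \<open>dt\<close> the part \<open>dt \<and> \<omega>\<close> drops out because \<open>dt \<and> dt = 0\<close>.\<close>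

lemma wedge_dt_g2_form:
  assumes "alternating_form 2 \<omega>" "alternating_form 3 \<psi>"
  shows "wedge 1 3 (\<lambda>v. c * snd (v 0)) (g2_form \<omega> \<psi>) v =
    c * (\<Sum>i\<le>3. (-1) ^ i * snd (v i) * \<psi> (omit i (\<lambda>j. fst (v j))))"
proof -
  define u where "u = (\<lambda>j. fst (v j))"
  define w where "w = (\<lambda>i j. \<omega> (pair_seq (u i) (u j)))"
  have \<psi>: "\<psi> (\<lambda>j. fst (omit i v j)) = \<psi> (omit i u)" for i
    by (rule arg_cong[where f = \<psi>]) (auto simp: omit_def u_def)
  have g: "g2_form \<omega> \<psi> (omit 0 v) = snd (v 1) * w 2 3 - snd (v 2) * w 1 3 + snd (v 3) * w 1 2 + \<psi> (omit 0 u)"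
    "g2_form \<omega> \<psi> (omit 1 v) = snd (v 0) * w 2 3 - snd (v 2) * w 0 3 + snd (v 3) * w 0 2 + \<psi> (omit 1 u)"
    "g2_form \<omega> \<psi> (omit 2 v) = snd (v 0) * w 1 3 - snd (v 1) * w 0 3 + snd (v 3) * w 0 1 + \<psi> (omit 2 u)"
    "g2_form \<omega> \<psi> (omit 3 v) = snd (v 0) * w 1 2 - snd (v 1) * w 0 2 + snd (v 2) * w 0 1 + \<psi> (omit 3 u)"
    unfolding g2_form_def \<psi> by (simp_all add: omit_def u_def w_def numeral_2_eq_2 numeral_3_eq_3)
  show ?thesis
    unfolding wedge_one_form[OF alternating_form_g2_form[OF assms], where a = "\<lambda>x. c * snd x"]
      sum_atMost_3 g u_def[symmetric]
    by (simp add: algebra_simps)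
qed

text \<open>The linear maps \<open>A \<times> id\<close> are the derivatives of the coordinate changes of the mapping torus.\<close>

lemma g2_form_pullback:
  assumes "pullback_lin A \<omega> = \<omega>'" "pullback_lin A \<psi> = \<psi>'"
    and B: "\<And>w. fst (B w) = A (fst w)" "\<And>w. snd (B w) = snd w"
  shows "pullback_lin B (g2_form \<omega> \<psi>) = g2_form \<omega>' \<psi>'"
proof -
  have "(\<lambda>i. A (pair_seq a b i)) = pair_seq (A a) (A b)" for a b
    by (auto simp: pair_seq_def)
  then show ?thesis
    unfolding assms(1,2)[symmetric] by (simp add: g2_form_def pullback_lin_def B)
qed

section \<open>Exterior derivatives in coordinates\<close>

text \<open>The exterior derivative on an open set, of which \<open>ext_deriv\<close> is the chartwise version.\<close>

definition ed :: "nat \<Rightarrow> ('e::euclidean_space \<Rightarrow> 'e mform) \<Rightarrow> 'e \<Rightarrow> 'e mform" where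
  "ed k \<alpha> x v = (\<Sum>i\<le>k. (-1) ^ i * frechet_derivative (\<lambda>y. \<alpha> y (omit i v)) (at x) (v i))"

lemma ext_deriv_eq_ed: "ext_deriv k \<alpha> c = ed k (\<alpha> c)"
  by (auto simp: ext_deriv_def ed_def omit_def fun_eq_iff)

lemma ed_cong_open:
  assumes "open U" "x \<in> U" "\<And>y. y \<in> U \<Longrightarrow> \<alpha> y = \<beta> y"
  shows "ed k \<alpha> x = ed k \<beta> x"
  unfolding ed_def fun_eq_iff
  using frechet_derivative_cong_open[OF assms(1,2), of "\<lambda>y. \<alpha> y _" "\<lambda>y. \<beta> y _"] assms(3) by simp

definition smooth_form_on :: "nat \<Rightarrow> 'e::euclidean_space set \<Rightarrow> ('e \<Rightarrow> 'e mform) \<Rightarrow> bool" where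
  "smooth_form_on k S \<alpha> \<longleftrightarrow>
     (\<forall>x\<in>S. alternating_form k (\<alpha> x)) \<and> (\<forall>v. smooth_on S (\<lambda>x. \<alpha> x v))"

lemma smooth_form_onD:
  assumes "smooth_form_on k S \<alpha>"
  shows "x \<in> S \<Longrightarrow> alternating_form k (\<alpha> x)" "smooth_on S (\<lambda>x. \<alpha> x v)"
  using assms by (auto simp: smooth_form_on_def)

lemma sum_atMost_2: "(\<Sum>i\<le>(2::nat). f i) = f 0 + f 1 + (f 2 :: 'a::comm_monoid_add)"
  by (simp add: numeral_eq_Suc)

lemma ed_two_form:
  assumes "open S" "x \<in> S" "smooth_form_on 2 S \<alpha>"
  shows "ed 2 \<alpha> x v =
      frechet_derivative (\<lambda>y. \<alpha> y (pair_seq (v 1) (v 2))) (at x) (v 0)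
    - frechet_derivative (\<lambda>y. \<alpha> y (pair_seq (v 0) (v 2))) (at x) (v 1)
    + frechet_derivative (\<lambda>y. \<alpha> y (pair_seq (v 0) (v 1))) (at x) (v 2)"
proof -
  have "frechet_derivative (\<lambda>y. \<alpha> y w) (at x) =
      frechet_derivative (\<lambda>y. \<alpha> y (pair_seq (w 0) (w 1))) (at x)" for w
    using assms two_form_eq_pair by (intro frechet_derivative_cong_open) (auto simp: smooth_form_on_def)
  from this[of "omit 0 v"] this[of "omit 1 v"] this[of "omit 2 v"] show ?thesis
    by (simp add: ed_def sum_atMost_2) (simp add: omit_def numeral_2_eq_2)
qed

lemma two_form_expand:
  fixes \<alpha> :: "'e::euclidean_space mform"
  assumes "alternating_form 2 \<alpha>"
  shows "\<alpha> (pair_seq a b) =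
     (\<Sum>p\<in>Basis. \<Sum>q\<in>Basis. (a \<bullet> p) * (b \<bullet> q) * \<alpha> (pair_seq p q))"
proof -
  have "\<alpha> (pair_seq a b) = (\<Sum>p\<in>Basis. (a \<bullet> p) * \<alpha> (pair_seq p b))"
    by (rule linear_eq_sum_Basis[OF two_form_bilinear(1)[OF assms], unfolded real_scaleR_def])
  also have "\<dots> = (\<Sum>p\<in>Basis. (a \<bullet> p) * (\<Sum>q\<in>Basis. (b \<bullet> q) * \<alpha> (pair_seq p q)))"
    by (intro sum.cong refl arg_cong2[where f = "(*)"]
        linear_eq_sum_Basis[OF two_form_bilinear(2)[OF assms], unfolded real_scaleR_def])
  finally show ?thesis
    by (simp add: sum_distrib_left mult.assoc)
qed

text \<open>Differentiating a two-form along a map, applied to two vector fields along that map: the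
  expansion in a basis reduces this to the product rule for finitely many real functions.\<close>

lemma has_derivative_two_form:
  fixes F :: "'a::euclidean_space \<Rightarrow> 'e::euclidean_space"
  assumes S: "open S" "F x \<in> S" "smooth_form_on 2 S \<beta>"
    and F: "(F has_derivative F') (at x)"
    and a: "(a has_derivative a') (at x)" and b: "(b has_derivative b') (at x)"
  shows "((\<lambda>y. \<beta> (F y) (pair_seq (a y) (b y))) has_derivative
     (\<lambda>u. frechet_derivative (\<lambda>z. \<beta> z (pair_seq (a x) (b x))) (at (F x)) (F' u)
        + \<beta> (F x) (pair_seq (a' u) (b x)) + \<beta> (F x) (pair_seq (a x) (b' u)))) (at x)"
proof -
  let ?D = "\<lambda>w. frechet_derivative (\<lambda>z. \<beta> z w) (at (F x))"
  have D: "((\<lambda>z. \<beta> z w) has_derivative ?D w) (at (F x))" for w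
    using S by (intro smooth_on_has_derivative[of S]) (auto simp: smooth_form_on_def)
  have DF: "((\<lambda>y. \<beta> (F y) w) has_derivative (\<lambda>u. ?D w (F' u))) (at x)" for w
    by (rule has_derivative_compose[OF F D])
  have expand: "\<beta> z (pair_seq r s) =
     (\<Sum>p\<in>Basis. \<Sum>q\<in>Basis. (r \<bullet> p) * (s \<bullet> q) * \<beta> z (pair_seq p q))" if "z \<in> S" for z r s
    using S that by (intro two_form_expand) (auto simp: smooth_form_on_def)
  have Dexpand: "?D (pair_seq r s) u =
     (\<Sum>p\<in>Basis. \<Sum>q\<in>Basis. (r \<bullet> p) * (s \<bullet> q) * ?D (pair_seq p q) u)" for r s u
  proof -
    have "((\<lambda>z. \<Sum>p\<in>Basis. \<Sum>q\<in>Basis. (r \<bullet> p) * (s \<bullet> q) * \<beta> z (pair_seq p q)) has_derivative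
       (\<lambda>u. \<Sum>p\<in>Basis. \<Sum>q\<in>Basis. (r \<bullet> p) * (s \<bullet> q) * ?D (pair_seq p q) u)) (at (F x))"
      by (intro has_derivative_sum has_derivative_mult_right D)
    then have "((\<lambda>z. \<beta> z (pair_seq r s)) has_derivative
       (\<lambda>u. \<Sum>p\<in>Basis. \<Sum>q\<in>Basis. (r \<bullet> p) * (s \<bullet> q) * ?D (pair_seq p q) u)) (at (F x))"
      by (rule has_derivative_transform_within_open[OF _ S(1,2)]) (rule expand[symmetric])
    from frechet_derivative_eqI[OF this] show ?thesis by simp
  qed
  have cont: "\<forall>\<^sub>F y in at x. F y \<in> S"
    using has_derivative_continuous[OF F] S(1,2)
    by (auto simp: continuous_at tendsto_def)
  have "((\<lambda>y. \<Sum>p\<in>Basis. \<Sum>q\<in>Basis. (a y \<bullet> p) * (b y \<bullet> q) * \<beta> (F y) (pair_seq p q)) has_derivative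
     (\<lambda>u. \<Sum>p\<in>Basis. \<Sum>q\<in>Basis.
        (a x \<bullet> p) * (b x \<bullet> q) * ?D (pair_seq p q) (F' u)
      + ((a x \<bullet> p) * (b' u \<bullet> q) + (a' u \<bullet> p) * (b x \<bullet> q)) * \<beta> (F x) (pair_seq p q))) (at x)"
    by (intro has_derivative_sum has_derivative_mult DF has_derivative_inner_left a b)
  then have "((\<lambda>y. \<beta> (F y) (pair_seq (a y) (b y))) has_derivative
     (\<lambda>u. \<Sum>p\<in>Basis. \<Sum>q\<in>Basis.
        (a x \<bullet> p) * (b x \<bullet> q) * ?D (pair_seq p q) (F' u)
      + ((a x \<bullet> p) * (b' u \<bullet> q) + (a' u \<bullet> p) * (b x \<bullet> q)) * \<beta> (F x) (pair_seq p q))) (at x)"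
  proof (rule has_derivative_transform_eventually)
    show "\<forall>\<^sub>F y in at x. (\<Sum>p\<in>Basis. \<Sum>q\<in>Basis. (a y \<bullet> p) * (b y \<bullet> q) * \<beta> (F y) (pair_seq p q)) =
        \<beta> (F y) (pair_seq (a y) (b y))"
      using cont by eventually_elim (rule expand[symmetric])
    show "(\<Sum>p\<in>Basis. \<Sum>q\<in>Basis. (a x \<bullet> p) * (b x \<bullet> q) * \<beta> (F x) (pair_seq p q)) =
        \<beta> (F x) (pair_seq (a x) (b x))"
      by (rule expand[symmetric, OF S(2)])
  qed simp
  then show ?thesis
  proof (rule has_derivative_eq_rhs, intro ext)
    fix u
    show "(\<Sum>p\<in>Basis. \<Sum>q\<in>Basis. (a x \<bullet> p) * (b x \<bullet> q) * ?D (pair_seq p q) (F' u)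
      + ((a x \<bullet> p) * (b' u \<bullet> q) + (a' u \<bullet> p) * (b x \<bullet> q)) * \<beta> (F x) (pair_seq p q)) =
      ?D (pair_seq (a x) (b x)) (F' u)
        + \<beta> (F x) (pair_seq (a' u) (b x)) + \<beta> (F x) (pair_seq (a x) (b' u))"
      unfolding Dexpand[of "a x" "b x" "F' u"] expand[OF S(2), of "a' u" "b x"]
        expand[OF S(2), of "a x" "b' u"]
      by (simp add: algebra_simps sum.distrib)
  qed
qed

text \<open>Why \<open>d\<close> commutes with pullback: the terms that contain the second derivative of \<open>F\<close> cancel in
  pairs, because that derivative is symmetric whereas the form is alternating.\<close>

lemma ed_pullback_two_form:
  fixes F :: "'a::euclidean_space \<Rightarrow> 'e::euclidean_space"
  assumes U: "open U" "x \<in> U" and F: "smooth_on U F" and \<alpha>: "smooth_form_on 2 U \<alpha>"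
    and S: "open S" "F ` U \<subseteq> S" and \<beta>: "smooth_form_on 2 S \<beta>"
    and pull: "\<And>y. y \<in> U \<Longrightarrow> \<alpha> y = pullback_lin (frechet_derivative F (at y)) (\<beta> (F y))"
  shows "ed 2 \<alpha> x = pullback_lin (frechet_derivative F (at x)) (ed 2 \<beta> (F x))"
proof
  fix v
  let ?D = "\<lambda>y w. frechet_derivative F (at y) w"
  let ?H = "\<lambda>w u. frechet_derivative (\<lambda>y. ?D y w) (at x) u"
  let ?B = "\<lambda>r s. \<beta> (F x) (pair_seq r s)"
  have H: "?H w u = ?H u w" for w u
    by (rule second_derivative_symmetric[OF U F])
  have "F x \<in> S" using U S by blast
  note B = two_form_antisym[OF smooth_form_onD(1)[OF \<beta> this]]
  have D: "frechet_derivative (\<lambda>y. \<alpha> y (pair_seq r s)) (at x) u =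
       frechet_derivative (\<lambda>z. \<beta> z (pair_seq (?D x r) (?D x s))) (at (F x)) (?D x u)
       + ?B (?H r u) (?D x s) + ?B (?D x r) (?H s u)" for r s u
  proof -
    have "((\<lambda>y. \<beta> (F y) (pair_seq (?D y r) (?D y s))) has_derivative
     (\<lambda>u. frechet_derivative (\<lambda>z. \<beta> z (pair_seq (?D x r) (?D x s))) (at (F x)) (?D x u)
       + ?B (?H r u) (?D x s) + ?B (?D x r) (?H s u))) (at x)"
      using U(2) F \<beta> S \<open>F x \<in> S\<close>
      by (intro has_derivative_two_form smooth_on_has_derivative[of U] smooth_on_derivative) auto
    from frechet_derivative_eqI[OF this] have
      "frechet_derivative (\<lambda>y. \<beta> (F y) (pair_seq (?D y r) (?D y s))) (at x) u =
       frechet_derivative (\<lambda>z. \<beta> z (pair_seq (?D x r) (?D x s))) (at (F x)) (?D x u)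
       + ?B (?H r u) (?D x s) + ?B (?D x r) (?H s u)"
      by simp
    moreover have "\<alpha> y (pair_seq r s) = \<beta> (F y) (pair_seq (?D y r) (?D y s))" if "y \<in> U" for y
      unfolding pull[OF that] pullback_lin_def
      by (rule arg_cong[where f = "\<beta> (F y)"]) (auto simp: pair_seq_def)
    ultimately show ?thesis
      using frechet_derivative_cong_open[OF U, of "\<lambda>y. \<alpha> y (pair_seq r s)"] by simp
  qed
  show "ed 2 \<alpha> x v = pullback_lin (?D x) (ed 2 \<beta> (F x)) v"
    unfolding ed_two_form[OF U \<alpha>] pullback_lin_def ed_two_form[OF S(1) \<open>F x \<in> S\<close> \<beta>] D
    using B[of "?H (v 0) (v 1)" "?D x (v 2)"] B[of "?H (v 0) (v 2)" "?D x (v 1)"]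
      B[of "?H (v 1) (v 2)" "?D x (v 0)"]
      H[of "v 1" "v 0"] H[of "v 2" "v 0"] H[of "v 2" "v 1"]
    by simp
qed

lemma ed_scale:
  assumes "open S" "x \<in> S" "\<And>v. smooth_on S (\<lambda>x. \<alpha> x v)"
  shows "ed k (\<lambda>x v. c * \<alpha> x v) x v = c * ed k \<alpha> x v"
proof -
  have "frechet_derivative (\<lambda>y. c * \<alpha> y w) (at x) = (\<lambda>u. c * frechet_derivative (\<lambda>y. \<alpha> y w) (at x) u)" for w
    using assms by (intro frechet_derivative_eqI has_derivative_mult_right smooth_on_has_derivative[of S])
  then show ?thesis
    by (simp add: ed_def sum_distrib_left algebra_simps)
qed

text \<open>The twelve second derivatives of the coefficients cancel in pairs, again by symmetry.\<close>

lemma ed_ed_two_form: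
  assumes S: "open S" "x \<in> S" and \<alpha>: "smooth_form_on 2 S \<alpha>"
  shows "ed 3 (ed 2 \<alpha>) x v = 0"
proof -
  define H where "H = (\<lambda>i j k l. frechet_derivative
     (\<lambda>y. frechet_derivative (\<lambda>y. \<alpha> y (pair_seq (v i) (v j))) (at y) (v k)) (at x) (v l))"
  have H: "H i j k l = H i j l k" for i j k l
    unfolding H_def by (rule second_derivative_symmetric[OF S smooth_form_onD(2)[OF \<alpha>]])
  have d: "frechet_derivative (\<lambda>y. ed 2 \<alpha> y w) (at x) u =
     frechet_derivative (\<lambda>y. frechet_derivative (\<lambda>y. \<alpha> y (pair_seq (w 1) (w 2))) (at y) (w 0)) (at x) u
   - frechet_derivative (\<lambda>y. frechet_derivative (\<lambda>y. \<alpha> y (pair_seq (w 0) (w 2))) (at y) (w 1)) (at x) u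
   + frechet_derivative (\<lambda>y. frechet_derivative (\<lambda>y. \<alpha> y (pair_seq (w 0) (w 1))) (at y) (w 2)) (at x) u"
    for w u
  proof -
    have "frechet_derivative (\<lambda>y. frechet_derivative (\<lambda>y. \<alpha> y (pair_seq (w 1) (w 2))) (at y) (w 0)
       - frechet_derivative (\<lambda>y. \<alpha> y (pair_seq (w 0) (w 2))) (at y) (w 1)
       + frechet_derivative (\<lambda>y. \<alpha> y (pair_seq (w 0) (w 1))) (at y) (w 2)) (at x) =
      (\<lambda>u. frechet_derivative (\<lambda>y. frechet_derivative (\<lambda>y. \<alpha> y (pair_seq (w 1) (w 2))) (at y) (w 0)) (at x) u
   - frechet_derivative (\<lambda>y. frechet_derivative (\<lambda>y. \<alpha> y (pair_seq (w 0) (w 2))) (at y) (w 1)) (at x) u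
   + frechet_derivative (\<lambda>y. frechet_derivative (\<lambda>y. \<alpha> y (pair_seq (w 0) (w 1))) (at y) (w 2)) (at x) u)"
      by (intro frechet_derivative_eqI has_derivative_add has_derivative_diff
          smooth_on_has_derivative[of S] smooth_on_derivative smooth_form_onD(2)[OF \<alpha>] S)
    then show ?thesis
      using frechet_derivative_cong_open[OF S, of "\<lambda>y. ed 2 \<alpha> y w"] ed_two_form[OF S(1) _ \<alpha>] by simp
  qed
  have "ed 3 (ed 2 \<alpha>) x v =
      (H 2 3 1 0 - H 1 3 2 0 + H 1 2 3 0) - (H 2 3 0 1 - H 0 3 2 1 + H 0 2 3 1)
    + (H 1 3 0 2 - H 0 3 1 2 + H 0 1 3 2) - (H 1 2 0 3 - H 0 2 1 3 + H 0 1 2 3)"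
    unfolding ed_def[of 3] sum_atMost_3 d
    by (simp add: omit_def H_def numeral_2_eq_2 numeral_3_eq_3)
  then show ?thesis
    using H[of 2 3 1 0] H[of 1 3 2 0] H[of 1 2 3 0] H[of 0 3 2 1] H[of 0 2 3 1] H[of 0 1 3 2] by simp
qed

text \<open>The sum is \<open>dt \<and> d\<omega>\<close> evaluated on \<open>v\<close>; its sign comes from moving \<open>d\<close> past the one-form \<open>dt\<close>.\<close>

lemma ed_g2_form:
  fixes \<omega> \<psi> :: "'e::euclidean_space \<Rightarrow> 'e mform"
  assumes S: "open S" "x \<in> S" and \<omega>: "smooth_form_on 2 S \<omega>" and \<psi>: "smooth_form_on 3 S \<psi>"
  shows "ed 3 (\<lambda>z. g2_form (\<omega> (fst z)) (\<psi> (fst z))) (x, t) v =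
    - (\<Sum>i\<le>3. (-1) ^ i * snd (v i) * ed 2 \<omega> x (omit i (\<lambda>j. fst (v j)))) + ed 3 \<psi> x (\<lambda>j. fst (v j))"
proof -
  define u where "u = (\<lambda>j. fst (v j))"
  define W where "W = (\<lambda>i j k. frechet_derivative (\<lambda>y. \<omega> y (pair_seq (u i) (u j))) (at x) (u k))"
  have fst_d: "((\<lambda>y::'e \<times> real. f (fst y)) has_derivative (\<lambda>w. frechet_derivative f (at x) (fst w))) (at (x, t))"
    if "smooth_on S f" for f :: "'e \<Rightarrow> real"
    using smooth_on_has_derivative[OF that S(2)]
    by (intro has_derivative_compose[OF has_derivative_fst[OF has_derivative_ident]]) simp
  have d: "frechet_derivative (\<lambda>z. g2_form (\<omega> (fst z)) (\<psi> (fst z)) w) (at (x, t)) a =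
      snd (w 0) * frechet_derivative (\<lambda>y. \<omega> y (pair_seq (fst (w 1)) (fst (w 2)))) (at x) (fst a)
    - snd (w 1) * frechet_derivative (\<lambda>y. \<omega> y (pair_seq (fst (w 0)) (fst (w 2)))) (at x) (fst a)
    + snd (w 2) * frechet_derivative (\<lambda>y. \<omega> y (pair_seq (fst (w 0)) (fst (w 1)))) (at x) (fst a)
    + frechet_derivative (\<lambda>y. \<psi> y (\<lambda>i. fst (w i))) (at x) (fst a)" for w a
  proof -
    have "frechet_derivative (\<lambda>y. snd (w 0) * \<omega> (fst y) (pair_seq (fst (w 1)) (fst (w 2)))
    - snd (w 1) * \<omega> (fst y) (pair_seq (fst (w 0)) (fst (w 2)))
    + snd (w 2) * \<omega> (fst y) (pair_seq (fst (w 0)) (fst (w 1)))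
    + \<psi> (fst y) (\<lambda>i. fst (w i))) (at (x, t)) =
    (\<lambda>a. snd (w 0) * frechet_derivative (\<lambda>y. \<omega> y (pair_seq (fst (w 1)) (fst (w 2)))) (at x) (fst a)
    - snd (w 1) * frechet_derivative (\<lambda>y. \<omega> y (pair_seq (fst (w 0)) (fst (w 2)))) (at x) (fst a)
    + snd (w 2) * frechet_derivative (\<lambda>y. \<omega> y (pair_seq (fst (w 0)) (fst (w 1)))) (at x) (fst a)
    + frechet_derivative (\<lambda>y. \<psi> y (\<lambda>i. fst (w i))) (at x) (fst a))"
      by (intro frechet_derivative_eqI has_derivative_add has_derivative_diff
          has_derivative_mult_right fst_d smooth_form_onD(2)[OF \<omega>] smooth_form_onD(2)[OF \<psi>])
    then show ?thesis
      by (simp add: g2_form_def)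
  qed
  have \<psi>_omit: "(\<lambda>y. \<psi> y (\<lambda>j. fst (omit i v j))) = (\<lambda>y. \<psi> y (omit i u))" for i
    by (rule ext, rule arg_cong[where f = "\<psi> _"]) (auto simp: omit_def u_def)
  have ed\<omega>: "ed 2 \<omega> x (omit 0 u) = W 2 3 1 - W 1 3 2 + W 1 2 3"
    "ed 2 \<omega> x (omit 1 u) = W 2 3 0 - W 0 3 2 + W 0 2 3"
    "ed 2 \<omega> x (omit 2 u) = W 1 3 0 - W 0 3 1 + W 0 1 3"
    "ed 2 \<omega> x (omit 3 u) = W 1 2 0 - W 0 2 1 + W 0 1 2"
    unfolding ed_two_form[OF S \<omega>] W_def by (simp_all add: omit_def numeral_2_eq_2 numeral_3_eq_3)
  define R where "R = (\<lambda>i. frechet_derivative (\<lambda>y. \<psi> y (omit i u)) (at x) (u i))"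
  have "ed 3 (\<lambda>z. g2_form (\<omega> (fst z)) (\<psi> (fst z))) (x, t) v =
      (snd (v 1) * W 2 3 0 - snd (v 2) * W 1 3 0 + snd (v 3) * W 1 2 0 + R 0)
    - (snd (v 0) * W 2 3 1 - snd (v 2) * W 0 3 1 + snd (v 3) * W 0 2 1 + R 1)
    + (snd (v 0) * W 1 3 2 - snd (v 1) * W 0 3 2 + snd (v 3) * W 0 1 2 + R 2)
    - (snd (v 0) * W 1 2 3 - snd (v 1) * W 0 2 3 + snd (v 2) * W 0 1 3 + R 3)"
    unfolding ed_def[of 3] sum_atMost_3 d \<psi>_omit
    by (simp add: W_def R_def) (simp add: omit_def u_def numeral_2_eq_2 numeral_3_eq_3)
  moreover have "ed 3 \<psi> x u = R 0 - R 1 + R 2 - R 3"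
    by (simp add: ed_def sum_atMost_3 R_def)
  ultimately show ?thesis
    unfolding u_def[symmetric] sum_atMost_3 ed\<omega> by (simp add: algebra_simps)
qed

lemma smooth_form_on_g2_form:
  assumes S: "open S" and \<omega>: "smooth_form_on 2 S \<omega>" and \<psi>: "smooth_form_on 3 S \<psi>"
    and I: "open I"
  shows "smooth_form_on 3 (S \<times> I) (\<lambda>z. g2_form (\<omega> (fst z)) (\<psi> (fst z)))"
proof -
  have *: "smooth_on (S \<times> I) (\<lambda>y. f (fst y))" if "smooth_on S f" for f :: "'a \<Rightarrow> real"
    by (rule smooth_on_compose[of "S \<times> I" S fst f])
      (use S I that in \<open>auto intro: open_Times smooth_on_linear bounded_linear_fst\<close>)
  have "smooth_on (S \<times> I) (\<lambda>y. snd (v 0) *\<^sub>R \<omega> (fst y) (pair_seq (fst (v 1)) (fst (v 2)))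
    + (- snd (v 1)) *\<^sub>R \<omega> (fst y) (pair_seq (fst (v 0)) (fst (v 2)))
    + snd (v 2) *\<^sub>R \<omega> (fst y) (pair_seq (fst (v 0)) (fst (v 1)))
    + \<psi> (fst y) (\<lambda>i. fst (v i)))" for v
    by (intro smooth_on_add smooth_on_scaleR smooth_on_const open_Times[OF S I]
        *[OF smooth_form_onD(2)[OF \<omega>]] *[OF smooth_form_onD(2)[OF \<psi>]])
  moreover have "alternating_form 3 (g2_form (\<omega> x) (\<psi> x))" if "x \<in> S" for x
    using that by (intro alternating_form_g2_form smooth_form_onD(1)[OF \<omega>] smooth_form_onD(1)[OF \<psi>])
  ultimately show ?thesis
    by (auto simp: smooth_form_on_def g2_form_def)
qed

section \<open>Charts and smooth maps\<close>

context
  fixes M :: "('a, 'e::euclidean_space) manifold" and c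
  assumes M: "smooth_manifold M" and c: "c \<in> atlas M"
begin

lemma cdom_open: "openin (mtop M) (cdom c)"
  and cimg_open: "open (cimg c)"
  and chart_homeo: "homeomorphic_map (subtopology (mtop M) (cdom c)) (top_of_set (cimg c)) (coord c)"
  using M c by (auto simp: smooth_manifold_def)

lemma cdom_subset: "cdom c \<subseteq> topspace (mtop M)"
  using cdom_open by (rule openin_subset)

lemma coord_inj: "inj_on (coord c) (cdom c)"
  using chart_homeo cdom_subset
  by (simp add: homeomorphic_eq_everything_map Int_absorb1)

lemma coord_inv_coord: "p \<in> cdom c \<Longrightarrow> coord_inv c (coord c p) = p"
  by (simp add: coord_inv_def coord_inj)

lemma chart_image_open:
  assumes "openin (mtop M) W"
  shows "open (coord c ` (cdom c \<inter> W))"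
proof -
  have "open_map (subtopology (mtop M) (cdom c)) (top_of_set (cimg c)) (coord c)"
    using chart_homeo by (simp add: homeomorphic_eq_everything_map)
  moreover have "openin (subtopology (mtop M) (cdom c)) (cdom c \<inter> W)"
    using assms by (auto simp: openin_subtopology)
  ultimately show ?thesis
    using cimg_open by (auto simp: open_map_def openin_open_eq)
qed

end

lemma chart_around:
  assumes "smooth_manifold M" "p \<in> topspace (mtop M)"
  obtains c where "c \<in> atlas M" "p \<in> cdom c"
proof -
  have "p \<in> (\<Union>c\<in>atlas M. cdom c)"
    using assms by (simp add: smooth_manifold_def)
  then show thesis
    using that by blast
qed

lemma smooth_map_topspace: "smooth_map M M' f \<Longrightarrow> p \<in> topspace (mtop M) \<Longrightarrow> f p \<in> topspace (mtop M')"
  by (auto simp: smooth_map_def continuous_map_def)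

lemma smooth_map_id: "smooth_manifold M \<Longrightarrow> smooth_map M M (\<lambda>p. p)"
  by (auto simp: smooth_map_def smooth_manifold_def Int_def)

definition rep_dom :: "('a, 'e) chart \<Rightarrow> ('b, 'f) chart \<Rightarrow> ('a \<Rightarrow> 'b) \<Rightarrow> 'e set" where
  "rep_dom c d f = coord c ` {p \<in> cdom c. f p \<in> cdom d}"

lemma rep_domI: "p \<in> cdom c \<Longrightarrow> f p \<in> cdom d \<Longrightarrow> coord c p \<in> rep_dom c d f"
  by (auto simp: rep_dom_def)

lemma local_rep_coord:
  assumes "smooth_manifold M" "c \<in> atlas M" "p \<in> cdom c"
  shows "local_rep c d f (coord c p) = coord d (f p)"
  by (simp add: local_rep_def coord_inv_coord[OF assms])

lemma rep_dom_open:
  assumes "smooth_manifold M" "smooth_manifold M'" "smooth_map M M' f" "c \<in> atlas M" "d \<in> atlas M'"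
  shows "open (rep_dom c d f)"
proof -
  have "openin (mtop M) {p \<in> topspace (mtop M). f p \<in> cdom d}"
    using assms(3) cdom_open[OF assms(2,5)] by (auto simp: smooth_map_def continuous_map_def)
  from chart_image_open[OF assms(1,4) this] show ?thesis
    unfolding rep_dom_def
    by (rule back_subst[where P = "open"]) (use cdom_subset[OF assms(1,4)] in auto)
qed

lemma smooth_on_local_rep:
  assumes "smooth_map M M' f" "c \<in> atlas M" "d \<in> atlas M'"
  shows "smooth_on (rep_dom c d f) (local_rep c d f)"
  using assms by (simp add: smooth_map_def rep_dom_def)

text \<open>The representatives compose only where the intermediate point stays in the domain of the
  intermediate chart; this is a neighbourhood of the point considered, and that suffices for both
  smoothness and derivatives.\<close>

lemma local_rep_compose_eventually:
  assumes M: "smooth_manifold M" "smooth_manifold M'" "smooth_manifold M''"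
    and f: "smooth_map M M' f" and h: "smooth_map M' M'' h"
    and charts: "c \<in> atlas M" "e \<in> atlas M'" "d \<in> atlas M''"
    and p: "p \<in> cdom c" "f p \<in> cdom e" "h (f p) \<in> cdom d"
  obtains U where "open U" "coord c p \<in> U" "U \<subseteq> rep_dom c e f"
    "local_rep c e f ` U \<subseteq> rep_dom e d h"
    "\<And>y. y \<in> U \<Longrightarrow> local_rep c d (\<lambda>p. h (f p)) y = local_rep e d h (local_rep c e f y)"
proof
  let ?U = "rep_dom c e f \<inter> local_rep c e f -` rep_dom e d h"
  show "open ?U"
    using smooth_on_imp_continuous_on[OF smooth_on_local_rep[OF f charts(1,2)]]
      rep_dom_open[OF M(1,2) f charts(1,2)] rep_dom_open[OF M(2,3) h charts(2,3)]
    by (rule continuous_open_preimage)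
  show "coord c p \<in> ?U"
    using p by (simp add: rep_domI local_rep_coord[OF M(1) charts(1)])
  show "?U \<subseteq> rep_dom c e f" "local_rep c e f ` ?U \<subseteq> rep_dom e d h"
    by auto
  show "local_rep c d (\<lambda>p. h (f p)) y = local_rep e d h (local_rep c e f y)" if y: "y \<in> ?U" for y
  proof -
    obtain q where "q \<in> cdom c" "f q \<in> cdom e" "y = coord c q"
      using y unfolding rep_dom_def by blast
    then show ?thesis
      by (simp add: local_rep_coord[OF M(1) charts(1)] local_rep_coord[OF M(2) charts(2)])
  qed
qed

lemma smooth_map_compose:
  assumes M: "smooth_manifold M" "smooth_manifold M'" "smooth_manifold M''"
    and f: "smooth_map M M' f" and h: "smooth_map M' M'' h"
  shows "smooth_map M M'' (\<lambda>p. h (f p))"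
  unfolding smooth_map_def
proof (intro conjI ballI)
  show "continuous_map (mtop M) (mtop M'') (\<lambda>p. h (f p))"
    using f h continuous_map_compose[of "mtop M" "mtop M'" f "mtop M''" h]
    by (simp add: smooth_map_def o_def)
  fix c d assume cd: "c \<in> atlas M" "d \<in> atlas M''"
  show "smooth_on (coord c ` {p \<in> cdom c. h (f p) \<in> cdom d}) (local_rep c d (\<lambda>p. h (f p)))"
  proof (rule smooth_on_locally)
    fix x assume "x \<in> coord c ` {p \<in> cdom c. h (f p) \<in> cdom d}"
    then obtain p where p: "p \<in> cdom c" "h (f p) \<in> cdom d" "x = coord c p"
      by blast
    then have "f p \<in> topspace (mtop M')"
      using cdom_subset[OF M(1) cd(1)] smooth_map_topspace[OF f] by blast
    then obtain e where e: "e \<in> atlas M'" "f p \<in> cdom e"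
      using chart_around[OF M(2)] by blast
    obtain U where U: "open U" "coord c p \<in> U" "U \<subseteq> rep_dom c e f"
      "local_rep c e f ` U \<subseteq> rep_dom e d h"
      "\<And>y. y \<in> U \<Longrightarrow> local_rep c d (\<lambda>p. h (f p)) y = local_rep e d h (local_rep c e f y)"
      by (rule local_rep_compose_eventually[OF M f h cd(1) e(1) cd(2) p(1) e(2) p(2)])
        (rule that)
    have "smooth_on U (\<lambda>y. local_rep e d h (local_rep c e f y))"
      by (rule smooth_on_compose[OF U(1) rep_dom_open[OF M(2,3) h e(1) cd(2)] U(4)
          smooth_on_subset[OF smooth_on_local_rep[OF f cd(1) e(1)] U(3)]
          smooth_on_local_rep[OF h e(1) cd(2)]])
    then have "smooth_on U (local_rep c d (\<lambda>p. h (f p)))"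
      using U by (subst smooth_on_cong[OF U(1)]) auto
    then show "\<exists>U. open U \<and> x \<in> U \<and> smooth_on U (local_rep c d (\<lambda>p. h (f p)))"
      using U p by blast
  qed
qed

lemma local_rep_has_derivative:
  assumes "smooth_manifold M" "smooth_map M M' f" "c \<in> atlas M" "d \<in> atlas M'"
    "p \<in> cdom c" "f p \<in> cdom d"
  shows "(local_rep c d f has_derivative frechet_derivative (local_rep c d f) (at (coord c p))) (at (coord c p))"
  using assms by (intro smooth_on_has_derivative[OF smooth_on_local_rep] rep_domI) auto

lemma local_rep_chain_rule:
  assumes M: "smooth_manifold M" "smooth_manifold M'" "smooth_manifold M''"
    and f: "smooth_map M M' f" and h: "smooth_map M' M'' h"
    and charts: "c \<in> atlas M" "e \<in> atlas M'" "d \<in> atlas M''"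
    and p: "p \<in> cdom c" "f p \<in> cdom e" "h (f p) \<in> cdom d"
  shows "frechet_derivative (local_rep c d (\<lambda>p. h (f p))) (at (coord c p)) =
    (\<lambda>v. frechet_derivative (local_rep e d h) (at (coord e (f p)))
           (frechet_derivative (local_rep c e f) (at (coord c p)) v))"
proof -
  obtain U where U: "open U" "coord c p \<in> U" "U \<subseteq> rep_dom c e f"
      "local_rep c e f ` U \<subseteq> rep_dom e d h"
      "\<And>y. y \<in> U \<Longrightarrow> local_rep c d (\<lambda>p. h (f p)) y = local_rep e d h (local_rep c e f y)"
    by (rule local_rep_compose_eventually[OF M f h charts p])
      (rule that)
  have "((\<lambda>y. local_rep e d h (local_rep c e f y)) has_derivative
     (\<lambda>v. frechet_derivative (local_rep e d h) (at (coord e (f p)))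
           (frechet_derivative (local_rep c e f) (at (coord c p)) v))) (at (coord c p))"
    using local_rep_has_derivative[OF M(2) h charts(2,3) p(2,3)]
    by (intro has_derivative_compose[OF local_rep_has_derivative[OF M(1) f charts(1,2) p(1,2)]])
      (simp add: local_rep_coord[OF M(1) charts(1) p(1)])
  from frechet_derivative_eqI[OF this] show ?thesis
    using frechet_derivative_cong_open[OF U(1,2,5)] by simp
qed

section \<open>Invariant forms\<close>

text \<open>\<open>f\<^sup>*\<alpha> = \<alpha>\<close>, expressed in all pairs of charts at once instead of one chosen pair at every point.
  In this form the condition passes to compositions and inverses by the chain rule.\<close>

definition preserves ::
  "('a, 'e::euclidean_space) manifold \<Rightarrow> ('a \<Rightarrow> 'a) \<Rightarrow> ('a, 'e) dform \<Rightarrow> bool" where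
  "preserves M f \<alpha> \<longleftrightarrow> (\<forall>c\<in>atlas M. \<forall>d\<in>atlas M. \<forall>p\<in>cdom c. f p \<in> cdom d \<longrightarrow>
     \<alpha> c (coord c p) =
       pullback_lin (frechet_derivative (local_rep c d f) (at (coord c p))) (\<alpha> d (coord d (f p))))"

lemma preservesD:
  "preserves M f \<alpha> \<Longrightarrow> c \<in> atlas M \<Longrightarrow> d \<in> atlas M \<Longrightarrow> p \<in> cdom c \<Longrightarrow> f p \<in> cdom d \<Longrightarrow>
    pullback_lin (frechet_derivative (local_rep c d f) (at (coord c p))) (\<alpha> d (coord d (f p))) =
    \<alpha> c (coord c p)"
  by (simp add: preserves_def)

lemma pullback_lin_compose:
  "pullback_lin A (pullback_lin B \<alpha>) = pullback_lin (\<lambda>v. B (A v)) \<alpha>"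
  by (simp add: pullback_lin_def)

lemma preserves_id:
  assumes "smooth_manifold M" "diff_form M k \<alpha>"
  shows "preserves M (\<lambda>p. p) \<alpha>"
  unfolding preserves_def
proof (intro ballI impI)
  fix c d p assume cd: "c \<in> atlas M" "d \<in> atlas M" and p: "p \<in> cdom c" "p \<in> cdom d"
  then have "coord c p \<in> coord c ` (cdom c \<inter> cdom d)"
    by blast
  then show "\<alpha> c (coord c p) =
      pullback_lin (frechet_derivative (local_rep c d (\<lambda>p. p)) (at (coord c p))) (\<alpha> d (coord d p))"
    using assms(2) cd local_rep_coord[OF assms(1) cd(1) p(1), of d "\<lambda>p. p"]
    unfolding diff_form_def by metis
qed

lemma preserves_compose:
  assumes M: "smooth_manifold M" and f: "smooth_map M M f" "preserves M f \<alpha>"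
    and h: "smooth_map M M h" "preserves M h \<alpha>"
  shows "preserves M (\<lambda>p. h (f p)) \<alpha>"
  unfolding preserves_def
proof (intro ballI impI)
  fix c d p assume cd: "c \<in> atlas M" "d \<in> atlas M" and p: "p \<in> cdom c" "h (f p) \<in> cdom d"
  then have "f p \<in> topspace (mtop M)"
    using cdom_subset[OF M cd(1)] smooth_map_topspace[OF f(1)] by blast
  then obtain e where e: "e \<in> atlas M" "f p \<in> cdom e"
    using chart_around[OF M] by blast
  show "\<alpha> c (coord c p) = pullback_lin (frechet_derivative (local_rep c d (\<lambda>p. h (f p))) (at (coord c p)))
       (\<alpha> d (coord d (h (f p))))"
    unfolding local_rep_chain_rule[OF M M M f(1) h(1) cd(1) e(1) cd(2) p(1) e(2) p(2)]
      pullback_lin_compose[symmetric] preservesD[OF h(2) e(1) cd(2) e(2) p(2)]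
      preservesD[OF f(2) cd(1) e(1) p(1) e(2)] ..
qed

text \<open>The pullback of a form refers to one chosen chart around the image point; the transformation
  rule of the form carries the invariance over to every other chart.\<close>

lemma preservesI:
  assumes M: "smooth_manifold M" and \<alpha>: "diff_form M k \<alpha>" and f: "smooth_map M M f"
    and inv: "form_eq M (pullback_form M f \<alpha>) \<alpha>"
  shows "preserves M f \<alpha>"
  unfolding preserves_def
proof (intro ballI impI)
  fix c d p assume cd: "c \<in> atlas M" "d \<in> atlas M" and p: "p \<in> cdom c" "f p \<in> cdom d"
  define e where "e = (SOME e. e \<in> atlas M \<and> f p \<in> cdom e)"
  have e: "e \<in> atlas M" "f p \<in> cdom e"
    using someI[of "\<lambda>e. e \<in> atlas M \<and> f p \<in> cdom e" d] cd p by (auto simp: e_def)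
  have "\<alpha> c (coord c p) = pullback_form M f \<alpha> c (coord c p)"
    using inv cd p by (auto simp: form_eq_def)
  also have "\<dots> = pullback_lin (frechet_derivative (local_rep c e f) (at (coord c p))) (\<alpha> e (coord e (f p)))"
    by (simp add: pullback_form_def coord_inv_coord[OF M cd(1) p(1)] e_def[symmetric]
        local_rep_coord[OF M cd(1) p(1)])
  also have "\<alpha> e (coord e (f p)) = pullback_lin
      (frechet_derivative (local_rep e d (\<lambda>p. p)) (at (coord e (f p)))) (\<alpha> d (coord d (f p)))"
    using preservesD[OF preserves_id[OF M \<alpha>] e(1) cd(2) e(2) p(2)] by simp
  finally show "\<alpha> c (coord c p) =
      pullback_lin (frechet_derivative (local_rep c d f) (at (coord c p))) (\<alpha> d (coord d (f p)))"
    using local_rep_chain_rule[OF M M M f smooth_map_id[OF M] cd(1) e(1) cd(2) p(1) e(2) p(2)]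
    by (simp add: pullback_lin_compose)
qed

lemma frechet_derivative_local_rep_self:
  assumes "smooth_manifold M" "c \<in> atlas M" "p \<in> cdom c"
    and "\<And>q. q \<in> topspace (mtop M) \<Longrightarrow> f q = q"
  shows "frechet_derivative (local_rep c c f) (at (coord c p)) = (\<lambda>v. v)"
proof -
  have "local_rep c c f y = y" if "y \<in> cimg c" for y
    using that assms(4) cdom_subset[OF assms(1,2)] local_rep_coord[OF assms(1,2), of _ c f] by auto
  moreover have "coord c p \<in> cimg c"
    using assms by blast
  ultimately show ?thesis
    using frechet_derivative_cong_open[OF cimg_open[OF assms(1,2)], of "coord c p" "local_rep c c f" "\<lambda>y. y"]
      frechet_derivative_eqI[OF has_derivative_ident] by simp
qed

text \<open>Pulling \<open>\<alpha> = f\<^sup>*\<alpha>\<close> back along \<open>g\<close> gives \<open>g\<^sup>*\<alpha> = (f \<circ> g)\<^sup>*\<alpha> = \<alpha>\<close>.\<close>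

lemma preserves_inverse:
  assumes M: "smooth_manifold M" and f: "smooth_map M M f" "preserves M f \<alpha>"
    and g: "smooth_map M M g" and fg: "\<And>q. q \<in> topspace (mtop M) \<Longrightarrow> f (g q) = q"
  shows "preserves M g \<alpha>"
  unfolding preserves_def
proof (intro ballI impI)
  fix c d p assume cd: "c \<in> atlas M" "d \<in> atlas M" and p: "p \<in> cdom c" "g p \<in> cdom d"
  have fgp: "f (g p) = p"
    using fg p cdom_subset[OF M cd(1)] by blast
  then have p': "f (g p) \<in> cdom c"
    using p by simp
  have "pullback_lin (frechet_derivative (local_rep c d g) (at (coord c p))) (\<alpha> d (coord d (g p))) =
    pullback_lin (frechet_derivative (local_rep c c (\<lambda>p. f (g p))) (at (coord c p))) (\<alpha> c (coord c p))"
    unfolding local_rep_chain_rule[OF M M M g f(1) cd(1,2,1) p p']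
      pullback_lin_compose[symmetric]
    using preservesD[OF f(2) cd(2,1) p(2) p'] fgp by simp
  then show "\<alpha> c (coord c p) =
      pullback_lin (frechet_derivative (local_rep c d g) (at (coord c p))) (\<alpha> d (coord d (g p)))"
    using frechet_derivative_local_rep_self[OF M cd(1) p(1) fg] by (simp add: pullback_lin_def)
qed

lemma diff_form_smooth_form_on:
  "diff_form M k \<alpha> \<Longrightarrow> c \<in> atlas M \<Longrightarrow> smooth_form_on k (cimg c) (\<alpha> c)"
  by (auto simp: diff_form_def smooth_form_on_def)

text \<open>Pullback commutes with \<open>d\<close>, so the invariance of \<open>\<omega>\<close> passes to \<open>d\<omega> = r \<psi>\<close>, and \<open>r\<close> can be
  cancelled.\<close>

lemma preserves_ed:
  assumes M: "smooth_manifold M" and \<omega>: "diff_form M 2 \<omega>" and f: "smooth_map M M f" "preserves M f \<omega>"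
    and d\<omega>: "form_eq M (ext_deriv 2 \<omega>) (scale_form r \<psi>)" and "r \<noteq> 0"
  shows "preserves M f \<psi>"
  unfolding preserves_def
proof (intro ballI impI)
  fix c d p assume cd: "c \<in> atlas M" "d \<in> atlas M" and p: "p \<in> cdom c" "f p \<in> cdom d"
  let ?U = "rep_dom c d f" and ?F = "local_rep c d f"
  have ed: "ed 2 (\<omega> c) x v = r * \<psi> c x v" if "c \<in> atlas M" "x \<in> cimg c" for c x v
    using d\<omega> that by (auto simp: form_eq_def ext_deriv_eq_ed scale_form_def)
  have "ed 2 (\<omega> c) (coord c p) = pullback_lin (frechet_derivative ?F (at (coord c p))) (ed 2 (\<omega> d) (?F (coord c p)))"
  proof (rule ed_pullback_two_form)
    show "open ?U" by (rule rep_dom_open[OF M M f(1) cd])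
    show "coord c p \<in> ?U" using p by (rule rep_domI)
    show "smooth_on ?U ?F" by (rule smooth_on_local_rep[OF f(1) cd])
    have "?U \<subseteq> cimg c" by (auto simp: rep_dom_def)
    then show "smooth_form_on 2 ?U (\<omega> c)"
      using diff_form_smooth_form_on[OF \<omega> cd(1)] smooth_on_subset
      unfolding smooth_form_on_def by blast
    show "open (cimg d)" by (rule cimg_open[OF M cd(2)])
    show "?F ` ?U \<subseteq> cimg d"
      by (auto simp: rep_dom_def local_rep_coord[OF M cd(1)])
    show "smooth_form_on 2 (cimg d) (\<omega> d)"
      by (rule diff_form_smooth_form_on[OF \<omega> cd(2)])
    show "\<omega> c y = pullback_lin (frechet_derivative ?F (at y)) (\<omega> d (?F y))" if "y \<in> ?U" for y
      using that preservesD[OF f(2) cd] by (auto simp: rep_dom_def local_rep_coord[OF M cd(1)])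
  qed
  then have "r * \<psi> c (coord c p) v =
      r * \<psi> d (coord d (f p)) (\<lambda>i. frechet_derivative ?F (at (coord c p)) (v i))" for v
    using ed[OF cd(1), of "coord c p"] ed[OF cd(2), of "coord d (f p)"] p
    by (simp add: fun_eq_iff pullback_lin_def local_rep_coord[OF M cd(1) p(1)]) blast
  then show "\<psi> c (coord c p) =
      pullback_lin (frechet_derivative ?F (at (coord c p))) (\<psi> d (coord d (f p)))"
    using \<open>r \<noteq> 0\<close> by (simp add: fun_eq_iff pullback_lin_def)
qed

section \<open>The mapping torus as a smooth manifold\<close>

lemma openin_prod_Times:
  "openin X U \<Longrightarrow> open V \<Longrightarrow> openin (prod_topology X euclideanreal) (U \<times> V)"
  by (simp add: openin_prod_Times_iff)

lemma openin_prod_real_nhd: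
  assumes "openin (prod_topology X euclideanreal) W" "(p, t) \<in> W"
  obtains U \<delta> where "openin X U" "p \<in> U" "\<delta> > 0" "U \<times> {t - \<delta><..<t + \<delta>} \<subseteq> W"
proof -
  obtain U V where UV: "openin X U" "open V" "p \<in> U" "t \<in> V" "U \<times> V \<subseteq> W"
    using assms unfolding openin_prod_topology_alt by force
  then obtain \<delta> where "\<delta> > 0" "ball t \<delta> \<subseteq> V"
    by (meson openE)
  moreover have "ball t \<delta> = {t - \<delta><..<t + \<delta>}"
    by (auto simp: ball_def dist_real_def)
  ultimately show thesis
    using UV by (intro that[of U \<delta>]) auto
qed

lemma second_countable_prod_topology:
  assumes "second_countable X" "second_countable Y"
  shows "second_countable (prod_topology X Y)"
proof -
  obtain A where "countable A \<and> (\<forall>V\<in>A. openin X V) \<and>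
      (\<forall>U x. openin X U \<and> x \<in> U \<longrightarrow> (\<exists>V\<in>A. x \<in> V \<and> V \<subseteq> U))"
    using assms(1) unfolding second_countable_def by (elim exE)
  then have A: "countable A" "\<And>V. V \<in> A \<Longrightarrow> openin X V"
    "\<And>U x. openin X U \<Longrightarrow> x \<in> U \<Longrightarrow> \<exists>V\<in>A. x \<in> V \<and> V \<subseteq> U"
    by simp_all
  obtain B where "countable B \<and> (\<forall>V\<in>B. openin Y V) \<and>
      (\<forall>U x. openin Y U \<and> x \<in> U \<longrightarrow> (\<exists>V\<in>B. x \<in> V \<and> V \<subseteq> U))"
    using assms(2) unfolding second_countable_def by (elim exE)
  then have B: "countable B" "\<And>V. V \<in> B \<Longrightarrow> openin Y V"
    "\<And>U x. openin Y U \<Longrightarrow> x \<in> U \<Longrightarrow> \<exists>V\<in>B. x \<in> V \<and> V \<subseteq> U"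
    by simp_all
  show ?thesis
    unfolding second_countable_def
  proof (intro exI conjI ballI allI impI)
    show "countable ((\<lambda>(U, V). U \<times> V) ` (A \<times> B))"
      using A(1) B(1) by blast
    show "openin (prod_topology X Y) W" if "W \<in> (\<lambda>(U, V). U \<times> V) ` (A \<times> B)" for W
      using that A(2) B(2) by (auto simp: openin_prod_Times_iff)
    fix U z assume U: "openin (prod_topology X Y) U \<and> z \<in> U"
    obtain x y where z: "z = (x, y)" by (cases z)
    obtain P Q where PQ: "openin X P" "openin Y Q" "x \<in> P" "y \<in> Q" "P \<times> Q \<subseteq> U"
      using U unfolding openin_prod_topology_alt z by force
    obtain V where V: "V \<in> A" "x \<in> V" "V \<subseteq> P" using A(3)[OF PQ(1,3)] by blast
    obtain W where W: "W \<in> B" "y \<in> W" "W \<subseteq> Q" using B(3)[OF PQ(2,4)] by blast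
    have "V \<times> W \<subseteq> U" "z \<in> V \<times> W"
      using V W PQ by (auto simp: z)
    with V W show "\<exists>V\<in>(\<lambda>(U, V). U \<times> V) ` (A \<times> B). z \<in> V \<and> V \<subseteq> U"
      by (intro bexI[of _ "V \<times> W"]) auto
  qed
qed

lemma second_countable_euclidean:
  "second_countable (euclidean :: 'a::second_countable_topology topology)"
proof -
  obtain B :: "'a set set" where B: "countable B" "topological_basis B"
    using ex_countable_basis by blast
  show ?thesis
    unfolding second_countable_def
  proof (intro exI conjI ballI allI impI)
    show "countable B" by (rule B)
    show "openin euclidean V" if "V \<in> B" for V
      using topological_basis_open[OF B(2) that] by simp
    fix U and x :: 'a assume "openin euclidean U \<and> x \<in> U"
    then have "open U" "x \<in> U" by auto
    then obtain V where "V \<in> B" "x \<in> V" "V \<subseteq> U"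
      by (rule topological_basisE[OF B(2)])
    then show "\<exists>V\<in>B. x \<in> V \<and> V \<subseteq> U" by blast
  qed
qed

text \<open>The inverse \<open>\<mu>\<close> of the diffeomorphism is a parameter, so that all integer powers of \<open>\<nu>\<close>
  are available as smooth maps.\<close>

locale diffeo_torus =
  fixes N :: "('a, 'e::euclidean_space) manifold" and \<nu> \<mu> :: "'a \<Rightarrow> 'a"
  assumes N: "smooth_manifold N"
    and \<nu>: "smooth_map N N \<nu>" and \<mu>: "smooth_map N N \<mu>"
    and \<mu>\<nu>: "\<And>p. p \<in> topspace (mtop N) \<Longrightarrow> \<mu> (\<nu> p) = p"
    and \<nu>\<mu>: "\<And>p. p \<in> topspace (mtop N) \<Longrightarrow> \<nu> (\<mu> p) = p"
begin

abbreviation X :: "'a set" where "X \<equiv> topspace (mtop N)"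
abbreviation cyl :: "('a \<times> real) topology" where "cyl \<equiv> prod_topology (mtop N) euclideanreal"
abbreviation T :: "(('a \<times> real) set, 'e \<times> real) manifold" where "T \<equiv> mapping_torus N \<nu>"
abbreviation \<pi> :: "'a \<times> real \<Rightarrow> ('a \<times> real) set" where "\<pi> \<equiv> torus_proj N \<nu>"
abbreviation chart :: "('a, 'e) chart \<Rightarrow> real \<Rightarrow> (('a \<times> real) set, 'e \<times> real) chart" where
  "chart \<equiv> torus_chart N \<nu>"

subsection \<open>Integer powers of the diffeomorphism\<close>

definition zpow :: "int \<Rightarrow> 'a \<Rightarrow> 'a" where
  "zpow n = (if n \<ge> 0 then \<nu> ^^ nat n else \<mu> ^^ nat (- n))"

lemma zpow_0 [simp]: "zpow 0 p = p"
  by (simp add: zpow_def)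

lemma funpow_smooth: "smooth_map N N f \<Longrightarrow> smooth_map N N (f ^^ n)"
proof (induction n)
  case 0
  then show ?case using smooth_map_id[OF N] by (simp add: id_def)
next
  case (Suc n)
  then show ?case using smooth_map_compose[OF N N N, of "f ^^ n" f] by (simp add: o_def)
qed

lemma zpow_smooth: "smooth_map N N (zpow n)"
  by (simp add: zpow_def funpow_smooth \<nu> \<mu>)

lemma zpow_X: "p \<in> X \<Longrightarrow> zpow n p \<in> X"
  by (rule smooth_map_topspace[OF zpow_smooth])

lemma zpow_plus_1: "p \<in> X \<Longrightarrow> zpow (n + 1) p = \<nu> (zpow n p)"
proof -
  assume p: "p \<in> X"
  consider "n \<ge> 0" | "n = -1" | "n \<le> -2"
    by linarith
  then show ?thesis
  proof cases
    case 1
    then show ?thesis by (simp add: zpow_def nat_add_distrib)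
  next
    case 2
    then show ?thesis using p by (simp add: zpow_def \<nu>\<mu>)
  next
    case 3
    define m where "m = nat (- n - 2)"
    have m: "n = - int (Suc (Suc m))"
      using 3 by (simp add: m_def)
    have "(\<mu> ^^ Suc m) p \<in> X"
      using p smooth_map_topspace[OF funpow_smooth[OF \<mu>]] by blast
    moreover have "zpow (n + 1) p = (\<mu> ^^ Suc m) p" "zpow n p = \<mu> ((\<mu> ^^ Suc m) p)"
      by (simp_all add: m zpow_def nat_add_distrib)
    ultimately show ?thesis by (simp add: \<nu>\<mu>)
  qed
qed

lemma zpow_minus_1: "p \<in> X \<Longrightarrow> zpow (n - 1) p = \<mu> (zpow n p)"
  using zpow_plus_1[of p "n - 1"] \<mu>\<nu>[of "zpow (n - 1) p"] zpow_X[of p "n - 1"] by simp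

lemma zpow_add: "p \<in> X \<Longrightarrow> zpow (m + n) p = zpow m (zpow n p)"
proof (induction m rule: int_induct[where k = 0])
  case base
  then show ?case by simp
next
  case (step1 i)
  then show ?case
    using zpow_plus_1[of p "i + n"] zpow_plus_1[of "zpow n p" i] zpow_X by (simp add: algebra_simps)
next
  case (step2 i)
  then show ?case
    using zpow_minus_1[of p "i + n"] zpow_minus_1[of "zpow n p" i] zpow_X by (simp add: algebra_simps)
qed

lemma zpow_minus: "p \<in> X \<Longrightarrow> zpow (- n) (zpow n p) = p"
  using zpow_add[of p "- n" n] by simp

lemma zpow_preserves:
  assumes "diff_form N k \<alpha>" "preserves N \<nu> \<alpha>"
  shows "preserves N (zpow n) \<alpha>"
proof -
  have pow: "preserves N (f ^^ m) \<alpha>" if "smooth_map N N f" "preserves N f \<alpha>" for f m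
  proof (induction m)
    case 0
    then show ?case using preserves_id[OF N assms(1)] by (simp add: id_def)
  next
    case (Suc m)
    then show ?case
      using preserves_compose[OF N funpow_smooth[OF that(1)] _ that, of m] by (simp add: o_def)
  qed
  show ?thesis
    using pow[OF \<nu> assms(2)] pow[OF \<mu> preserves_inverse[OF N \<nu> assms(2) \<mu> \<nu>\<mu>]]
    by (simp add: zpow_def)
qed

subsection \<open>The projection\<close>

lemma torus_rel_iff:
  "((p, s), (q, t)) \<in> torus_rel N \<nu> \<longleftrightarrow>
     p \<in> X \<and> q \<in> X \<and> (\<exists>n::int. q = zpow n p \<and> t = s + of_int n)"
proof (cases "p \<in> X \<and> q \<in> X")
  case True
  have "(\<exists>n::nat. (q = (\<nu> ^^ n) p \<and> t = s + real n) \<or> (p = (\<nu> ^^ n) q \<and> s = t + real n)) \<longleftrightarrow>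
     (\<exists>n::int. q = zpow n p \<and> t = s + of_int n)"
  proof
    assume "\<exists>n::nat. (q = (\<nu> ^^ n) p \<and> t = s + real n) \<or> (p = (\<nu> ^^ n) q \<and> s = t + real n)"
    then obtain n :: nat where "(q = zpow (int n) p \<and> t = s + real n) \<or> (p = zpow (int n) q \<and> s = t + real n)"
      by (auto simp: zpow_def)
    then have "(q = zpow (int n) p \<and> t = s + real n) \<or> (q = zpow (- int n) p \<and> t = s - real n)"
      using True zpow_minus[of q "int n"] by auto
    then show "\<exists>n::int. q = zpow n p \<and> t = s + of_int n"
      by (metis diff_conv_add_uminus of_int_minus of_int_of_nat_eq)
  next
    assume "\<exists>n::int. q = zpow n p \<and> t = s + of_int n"
    then obtain n :: int where n: "q = zpow n p" "t = s + of_int n" by blast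
    show "\<exists>n::nat. (q = (\<nu> ^^ n) p \<and> t = s + real n) \<or> (p = (\<nu> ^^ n) q \<and> s = t + real n)"
    proof (cases "n \<ge> 0")
      case True
      with n show ?thesis by (intro exI[of _ "nat n"]) (simp add: zpow_def)
    next
      case False
      then have "p = (\<nu> ^^ nat (- n)) q"
        using zpow_minus[of p n] n \<open>p \<in> X \<and> q \<in> X\<close> by (simp add: zpow_def)
      with n False show ?thesis by (intro exI[of _ "nat (- n)"]) simp
    qed
  qed
  with True show ?thesis by (simp add: torus_rel_def)
qed (auto simp: torus_rel_def)

lemma mem_proj_iff: "(q, t) \<in> \<pi> (p, s) \<longleftrightarrow> p \<in> X \<and> (\<exists>n::int. q = zpow n p \<and> t = s + of_int n)"
  by (auto simp: torus_proj_def torus_rel_iff zpow_X)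

lemma mem_proj_self: "p \<in> X \<Longrightarrow> (p, s) \<in> \<pi> (p, s)"
  by (auto simp: mem_proj_iff intro: exI[of _ 0])

lemma proj_eq_iff:
  assumes "p \<in> X"
  shows "\<pi> (p, s) = \<pi> (q, t) \<longleftrightarrow> q \<in> X \<and> (\<exists>n::int. q = zpow n p \<and> t = s + of_int n)"
proof
  assume eq: "\<pi> (p, s) = \<pi> (q, t)"
  then have "(p, s) \<in> \<pi> (q, t)"
    using mem_proj_self[OF assms] by metis
  then have "q \<in> X" by (simp add: mem_proj_iff)
  then show "q \<in> X \<and> (\<exists>n::int. q = zpow n p \<and> t = s + of_int n)"
    using mem_proj_self[of q t] eq mem_proj_iff[of q t p s] by simp
next
  assume "q \<in> X \<and> (\<exists>n::int. q = zpow n p \<and> t = s + of_int n)"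
  then obtain n :: int where n: "q = zpow n p" "t = s + of_int n" by blast
  show "\<pi> (p, s) = \<pi> (q, t)"
  proof (intro set_eqI)
    fix z :: "'a \<times> real"
    obtain r u where z: "z = (r, u)" by (cases z)
    have 1: "r = zpow m p \<and> u = s + of_int m \<longleftrightarrow> r = zpow (m - n) q \<and> u = t + of_int (m - n)" for m
      using zpow_add[OF assms, of "m - n" n] n by auto
    have "(\<exists>m::int. r = zpow m p \<and> u = s + of_int m) \<longleftrightarrow> (\<exists>m::int. r = zpow m q \<and> u = t + of_int m)"
      by (metis 1 add_diff_cancel_right')
    then show "z \<in> \<pi> (p, s) \<longleftrightarrow> z \<in> \<pi> (q, t)"
      using assms zpow_X[OF assms, of n] n by (simp add: z mem_proj_iff)
  qed
qed

lemma proj_shift: "p \<in> X \<Longrightarrow> \<pi> (zpow n p, s + of_int n) = \<pi> (p, s)"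
  using proj_eq_iff[of p s "zpow n p" "s + of_int n"] zpow_X by auto

lemma mtop_T: "mtop T = quotient_topology cyl \<pi>"
  by (simp add: mapping_torus_def)

lemma topspace_T: "topspace (mtop T) = \<pi> ` (X \<times> UNIV)"
  by (simp add: mtop_T topspace_quotient_topology)

lemma proj_in_T: "p \<in> X \<Longrightarrow> \<pi> (p, t) \<in> topspace (mtop T)"
  by (auto simp: topspace_T)

lemma topspace_T_cases:
  assumes "Y \<in> topspace (mtop T)"
  obtains p t where "p \<in> X" "Y = \<pi> (p, t)"
  using assms by (auto simp: topspace_T)

lemma proj_continuous: "continuous_map cyl (mtop T) \<pi>"
  unfolding mtop_T by (rule quotient_imp_continuous_map[OF quotient_map_quotient_topology])

lemma deck_continuous: "continuous_map cyl cyl (\<lambda>(p, t). (zpow n p, t + of_int n))"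
proof -
  have "continuous_map cyl (mtop N) (\<lambda>x. zpow n (fst x))"
  proof -
    have "continuous_map (mtop N) (mtop N) (zpow n)"
      using zpow_smooth[of n] by (simp add: smooth_map_def)
    from continuous_map_compose[OF continuous_map_fst this] show ?thesis
      by (simp add: o_def)
  qed
  moreover have "continuous_map cyl euclideanreal (\<lambda>x. snd x + of_int n)"
    by (intro continuous_map_add continuous_map_snd continuous_map_const[THEN iffD2]) auto
  ultimately show ?thesis
    by (simp add: continuous_map_pairwise case_prod_beta' o_def)
qed

text \<open>The saturation of an open set is the union of its translates under the deck transformations.\<close>

lemma proj_open_map: "open_map cyl (mtop T) \<pi>"
  unfolding open_map_def
proof (intro allI impI)
  fix U assume U: "openin cyl U"
  have sub: "U \<subseteq> X \<times> UNIV"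
    using openin_subset[OF U] by simp
  have "{x \<in> topspace cyl. \<pi> x \<in> \<pi> ` U} =
      (\<Union>n::int. {x \<in> topspace cyl. (\<lambda>(p, t). (zpow n p, t + of_int n)) x \<in> U})"
  proof (intro set_eqI iffI)
    fix x assume "x \<in> {x \<in> topspace cyl. \<pi> x \<in> \<pi> ` U}"
    then obtain p s q t where x: "x = (p, s)" "p \<in> X" "(q, t) \<in> U" "\<pi> (p, s) = \<pi> (q, t)"
      by (cases x) auto
    then show "x \<in> (\<Union>n::int. {x \<in> topspace cyl. (\<lambda>(p, t). (zpow n p, t + of_int n)) x \<in> U})"
      using proj_eq_iff[of p s q t] by auto
  next
    fix x assume "x \<in> (\<Union>n::int. {x \<in> topspace cyl. (\<lambda>(p, t). (zpow n p, t + of_int n)) x \<in> U})"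
    then obtain n p s where x: "x = (p, s)" "p \<in> X" "(zpow n p, s + of_int n) \<in> U"
      by auto
    then show "x \<in> {x \<in> topspace cyl. \<pi> x \<in> \<pi> ` U}"
      using proj_shift[of p n s] by (metis (mono_tags, lifting) SigmaI UNIV_I image_eqI mem_Collect_eq
          topspace_euclidean topspace_prod_topology)
  qed
  moreover have "openin cyl {x \<in> topspace cyl. (\<lambda>(p, t). (zpow n p, t + of_int n)) x \<in> U}" for n :: int
    using openin_continuous_map_preimage[OF deck_continuous U] .
  ultimately have "openin cyl {x \<in> topspace cyl. \<pi> x \<in> \<pi> ` U}"
    by auto
  then show "openin (mtop T) (\<pi> ` U)"
    using sub by (auto simp: mtop_T openin_quotient_topology)
qed

lemma proj_box_open: "openin (mtop N) U \<Longrightarrow> open I \<Longrightarrow> openin (mtop T) (\<pi> ` (U \<times> I))"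
  using proj_open_map openin_prod_Times unfolding open_map_def by blast

text \<open>Two points of one orbit differ in the real coordinate by an integer, which is \<open>0\<close> in an open interval
  of length \<open>1\<close>.\<close>

lemma proj_inj_on: "inj_on \<pi> (X \<times> {a<..<a + 1})"
proof (rule inj_onI)
  fix x y assume xy: "x \<in> X \<times> {a<..<a + 1}" "y \<in> X \<times> {a<..<a + 1}" "\<pi> x = \<pi> y"
  obtain p s q t where eq: "x = (p, s)" "y = (q, t)" by (cases x; cases y)
  with xy obtain n :: int where n: "q = zpow n p" "t = s + of_int n"
    using proj_eq_iff[of p s q t] by auto
  with xy eq have "\<bar>real_of_int n\<bar> < 1" by auto
  then have "n = 0" by linarith
  with n eq show "x = y" by simp
qed

text \<open>Two distinct orbits have representatives whose real coordinates differ by less than \<open>1\<close>. If these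
  coordinates differ, short intervals around them separate the orbits, since no integer translate of
  the one interval meets the other. If they agree, the points of \<open>N\<close> are distinct and have disjoint
  neighbourhoods, and intervals of length \<open>1\<close> leave no room for a nontrivial translation.\<close>

lemma Hausdorff_T: "Hausdorff_space (mtop T)"
  unfolding Hausdorff_space_def
proof (intro allI impI, elim conjE)
  fix Y Z assume YZ: "Y \<in> topspace (mtop T)" "Z \<in> topspace (mtop T)" "Y \<noteq> Z"
  obtain p s where p: "p \<in> X" "Y = \<pi> (p, s)" by (rule topspace_T_cases[OF YZ(1)])
  obtain q0 t0 where q0: "q0 \<in> X" "Z = \<pi> (q0, t0)" by (rule topspace_T_cases[OF YZ(2)])
  \<comment> \<open>the representative of \<open>Z\<close> whose real coordinate lies in \<open>[s, s + 1)\<close>\<close>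
  define q where "q = zpow (- \<lfloor>t0 - s\<rfloor>) q0"
  define t where "t = t0 - of_int \<lfloor>t0 - s\<rfloor>"
  have q: "q \<in> X" "Z = \<pi> (q, t)"
    using q0 zpow_X proj_shift[of q0 "- \<lfloor>t0 - s\<rfloor>" t0] by (auto simp: q_def t_def)
  have t: "s \<le> t" "t < s + 1"
    unfolding t_def by linarith+
  have sep: "\<exists>U V. openin (mtop T) U \<and> openin (mtop T) V \<and> Y \<in> U \<and> Z \<in> V \<and> disjnt U V"
    if U: "openin (mtop N) U" "p \<in> U" and V: "openin (mtop N) V" "q \<in> V" and "\<delta> > 0"
      and disj: "\<And>n s' t'. \<bar>s' - s\<bar> < \<delta> \<Longrightarrow> \<bar>t' - t\<bar> < \<delta> \<Longrightarrow> t' = s' + of_int n \<Longrightarrow> n = 0 \<and> U \<inter> V = {}"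
    for U V \<delta>
  proof (intro exI conjI)
    let ?U = "U \<times> {s - \<delta><..<s + \<delta>}" and ?V = "V \<times> {t - \<delta><..<t + \<delta>}"
    show "openin (mtop T) (\<pi> ` ?U)" "openin (mtop T) (\<pi> ` ?V)"
      using U V by (auto intro: proj_box_open)
    show "Y \<in> \<pi> ` ?U" "Z \<in> \<pi> ` ?V"
      using p q U V \<open>\<delta> > 0\<close> by auto
    show "disjnt (\<pi> ` ?U) (\<pi> ` ?V)"
    proof (rule ccontr)
      assume "\<not> disjnt (\<pi> ` ?U) (\<pi> ` ?V)"
      then obtain p' s' q' t' where *: "p' \<in> U" "q' \<in> V"
        "s - \<delta> < s'" "s' < s + \<delta>" "t - \<delta> < t'" "t' < t + \<delta>" "\<pi> (p', s') = \<pi> (q', t')"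
        by (auto simp: disjnt_iff)
      have "p' \<in> X" using openin_subset[OF U(1)] * by blast
      then obtain n :: int where "q' = zpow n p'" "t' = s' + of_int n"
        using proj_eq_iff * by blast
      moreover have "\<bar>s' - s\<bar> < \<delta>" "\<bar>t' - t\<bar> < \<delta>"
        using * by linarith+
      ultimately have "n = 0" "U \<inter> V = {}"
        using disj[of s' t' n] by blast+
      with \<open>q' = zpow n p'\<close> * show False by auto
    qed
  qed
  show "\<exists>U V. openin (mtop T) U \<and> openin (mtop T) V \<and> Y \<in> U \<and> Z \<in> V \<and> disjnt U V"
  proof (cases "t = s")
    case True
    then have "p \<noteq> q" using YZ p q by auto
    then obtain U V where UV: "openin (mtop N) U" "openin (mtop N) V" "p \<in> U" "q \<in> V" "disjnt U V"
      using N p q unfolding smooth_manifold_def Hausdorff_space_def by metis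
    show ?thesis
    proof (rule sep[OF UV(1,3,2,4)])
      show "(1/2::real) > 0" by simp
      fix n s' t' assume "\<bar>s' - s\<bar> < 1/2" "\<bar>t' - t\<bar> < 1/2" "t' = s' + of_int n"
      with True have "\<bar>real_of_int n\<bar> < 1" by linarith
      then show "n = 0 \<and> U \<inter> V = {}" using UV by (auto simp: disjnt_def)
    qed
  next
    case False
    \<comment> \<open>half the distance from \<open>t - s\<close> to the nearest integer\<close>
    define \<delta> where "\<delta> = min (t - s) (s + 1 - t) / 2"
    have top: "openin (mtop N) X" by simp
    show ?thesis
    proof (rule sep[OF top p(1) top q(1)])
      show "\<delta> > 0" using t False by (simp add: \<delta>_def)
      fix n s' t' assume *: "\<bar>s' - s\<bar> < \<delta>" "\<bar>t' - t\<bar> < \<delta>" "t' = s' + of_int n"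
      have "2 * \<delta> \<le> t - s" "2 * \<delta> \<le> s + 1 - t" by (auto simp: \<delta>_def)
      with * have "0 < real_of_int n" "real_of_int n < 1" by linarith+
      then have "0 < n" "n < 1" by simp_all
      then have False by linarith
      then show "n = 0 \<and> X \<inter> X = {}" ..
    qed
  qed
qed

text \<open>The projection is a continuous open map from \<open>N \<times> \<real>\<close>.\<close>

lemma second_countable_T: "second_countable (mtop T)"
proof (rule second_countable_open_map_image[OF proj_continuous proj_open_map])
  show "\<pi> ` topspace cyl = topspace (mtop T)"
    by (simp add: topspace_T)
  show "second_countable cyl"
    using N by (intro second_countable_prod_topology second_countable_euclidean)
      (simp add: smooth_manifold_def)
qed

subsection \<open>Charts\<close>

context
  fixes c :: "('a, 'e) chart" and a :: real
  assumes c: "c \<in> atlas N"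
begin

lemma cdom_chart: "cdom (chart c a) = \<pi> ` (cdom c \<times> {a<..<a + 1})"
  by (simp add: torus_chart_def)

lemma chart_domain_inj: "inj_on \<pi> (cdom c \<times> {a<..<a + 1})"
  using cdom_subset[OF N c] by (intro inj_on_subset[OF proj_inj_on]) auto

lemma coord_chart:
  "p \<in> cdom c \<Longrightarrow> t \<in> {a<..<a + 1} \<Longrightarrow> coord (chart c a) (\<pi> (p, t)) = (coord c p, t)"
  unfolding torus_chart_def by (simp add: inv_into_f_f[OF chart_domain_inj])

lemma cimg_chart: "cimg (chart c a) = cimg c \<times> {a<..<a + 1}"
proof -
  have "cimg (chart c a) = (\<lambda>x. coord (chart c a) (\<pi> x)) ` (cdom c \<times> {a<..<a + 1})"
    by (simp add: cdom_chart image_image)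
  also have "\<dots> = map_prod (coord c) (\<lambda>t. t) ` (cdom c \<times> {a<..<a + 1})"
    by (intro image_cong refl) (auto simp: coord_chart)
  finally show ?thesis
    by auto
qed

lemma coord_chart_inj: "inj_on (coord (chart c a)) (cdom (chart c a))"
proof (rule inj_onI)
  fix Y Z assume "Y \<in> cdom (chart c a)" "Z \<in> cdom (chart c a)" "coord (chart c a) Y = coord (chart c a) Z"
  then show "Y = Z"
    unfolding cdom_chart using coord_inj[OF N c] by (auto simp: coord_chart dest: inj_onD)
qed

lemma coord_inv_chart:
  "p \<in> cdom c \<Longrightarrow> t \<in> {a<..<a + 1} \<Longrightarrow> coord_inv (chart c a) (coord c p, t) = \<pi> (p, t)"
  using inv_into_f_f[OF coord_chart_inj, of "\<pi> (p, t)"]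
  by (simp add: coord_inv_def coord_chart) (simp add: cdom_chart)

lemma chart_box_open:
  assumes "openin cyl U" "U \<subseteq> cdom c \<times> {a<..<a + 1}"
  shows "open (coord (chart c a) ` (\<pi> ` U))"
proof -
  have "\<exists>W. open W \<and> z \<in> W \<and> W \<subseteq> coord (chart c a) ` (\<pi> ` U)"
    if z: "z \<in> coord (chart c a) ` (\<pi> ` U)" for z
  proof -
    obtain p t where pt: "(p, t) \<in> U" "z = coord (chart c a) (\<pi> (p, t))"
      using z by auto
    obtain V \<delta> where V: "openin (mtop N) V" "p \<in> V" "\<delta> > 0" "V \<times> {t - \<delta><..<t + \<delta>} \<subseteq> U"
      by (rule openin_prod_real_nhd[OF assms(1) pt(1)])
    let ?W = "coord c ` (cdom c \<inter> V) \<times> {t - \<delta><..<t + \<delta>}"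
    have dom: "p \<in> cdom c" "t \<in> {a<..<a + 1}"
      using pt assms(2) by auto
    have "open ?W"
      by (intro open_Times chart_image_open[OF N c V(1)]) auto
    moreover have "z \<in> ?W"
      using pt dom V by (auto simp: coord_chart)
    moreover have "?W \<subseteq> coord (chart c a) ` (\<pi> ` U)"
    proof
      fix w assume "w \<in> ?W"
      then obtain q u where q: "q \<in> cdom c" "q \<in> V" "u \<in> {t - \<delta><..<t + \<delta>}" "w = (coord c q, u)"
        by auto
      then have "(q, u) \<in> U" using V(4) by auto
      moreover from this have "u \<in> {a<..<a + 1}" using assms(2) by auto
      ultimately show "w \<in> coord (chart c a) ` (\<pi> ` U)"
        using coord_chart[OF q(1)] q(4) by (metis imageI)
    qed
    ultimately show ?thesis by blast
  qed
  then show ?thesis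
    by (subst open_subopen) blast
qed

text \<open>The chart is the inverse of the projection on the box, followed by the product chart. It is
  continuous because the projection is open, and open because the projection is continuous.\<close>

lemma chart_homeomorphic:
  "homeomorphic_map (subtopology (mtop T) (cdom (chart c a))) (top_of_set (cimg (chart c a)))
     (coord (chart c a))"
proof -
  let ?D = "cdom (chart c a)" and ?f = "coord (chart c a)"
  have D_open: "openin (mtop T) ?D"
    unfolding cdom_chart by (intro proj_box_open cdom_open[OF N c]) auto
  then have top: "topspace (subtopology (mtop T) ?D) = ?D"
    using openin_subset[OF D_open] by (simp add: Int_absorb1)
  have img_open: "open (cimg (chart c a))"
    unfolding cimg_chart by (intro open_Times cimg_open[OF N c]) auto
  show ?thesis
  proof (rule bijective_open_imp_homeomorphic_map)
    show "inj_on ?f (topspace (subtopology (mtop T) ?D))"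
      unfolding top by (rule coord_chart_inj)
    show "?f ` topspace (subtopology (mtop T) ?D) = topspace (top_of_set (cimg (chart c a)))"
      unfolding top by simp
    show "open_map (subtopology (mtop T) ?D) (top_of_set (cimg (chart c a))) ?f"
      unfolding open_map_def
    proof (intro allI impI)
      fix U assume "openin (subtopology (mtop T) ?D) U"
      then have U: "openin (mtop T) U" "U \<subseteq> ?D"
        using openin_open_subtopology[OF D_open] by blast+
      let ?V = "{x \<in> topspace cyl. \<pi> x \<in> U} \<inter> cdom c \<times> {a<..<a + 1}"
      have "openin cyl ?V"
        by (intro openin_Int openin_continuous_map_preimage[OF proj_continuous U(1)]
            openin_prod_Times cdom_open[OF N c]) auto
      moreover have "\<pi> ` ?V = U"
        using U(2) cdom_subset[OF N c] unfolding cdom_chart by auto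
      ultimately have "open (?f ` U)"
        using chart_box_open[of ?V] by auto
      then show "openin (top_of_set (cimg (chart c a))) (?f ` U)"
        using U(2) img_open by (auto simp: openin_open_eq)
    qed
    show "continuous_map (subtopology (mtop T) ?D) (top_of_set (cimg (chart c a))) ?f"
      unfolding continuous_map_openin_preimage_eq top
    proof (intro conjI allI impI)
      show "?f \<in> ?D \<rightarrow> topspace (top_of_set (cimg (chart c a)))"
        by auto
      fix W assume "openin (top_of_set (cimg (chart c a))) W"
      then have W: "open W" "W \<subseteq> cimg c \<times> {a<..<a + 1}"
        using img_open by (auto simp: openin_open_eq cimg_chart)
      let ?V = "{x \<in> cdom c \<times> {a<..<a + 1}. (coord c (fst x), snd x) \<in> W}"
      have "?D \<inter> ?f -` W = \<pi> ` ?V"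
        unfolding cdom_chart by (auto simp: coord_chart)
      moreover have "openin cyl ?V"
      proof (subst openin_subopen, intro ballI)
        fix x assume x: "x \<in> ?V"
        obtain p t where pt: "x = (p, t)" by (cases x)
        have "(coord c p, t) \<in> W"
          using x pt by simp
        then obtain A I where "open A" "open I" "(coord c p, t) \<in> A \<times> I" "A \<times> I \<subseteq> W"
          by (rule open_prod_elim[OF W(1)])
        then have AI: "open A" "open I" "coord c p \<in> A" "t \<in> I" "A \<times> I \<subseteq> W"
          by auto
        have "continuous_map (subtopology (mtop N) (cdom c)) (top_of_set (cimg c)) (coord c)"
          using chart_homeo[OF N c] by (simp add: homeomorphic_eq_everything_map)
        then have "openin (subtopology (mtop N) (cdom c))
            {q \<in> topspace (subtopology (mtop N) (cdom c)). coord c q \<in> cimg c \<inter> A}"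
          by (rule openin_continuous_map_preimage) (use AI in auto)
        then have "openin (mtop N) {q \<in> cdom c. coord c q \<in> A}"
          using cdom_open[OF N c] cdom_subset[OF N c]
          by (simp add: openin_open_subtopology Int_absorb1) (elim back_subst[where P = "openin (mtop N)"], auto)
        then have "openin cyl ({q \<in> cdom c. coord c q \<in> A} \<times> (I \<inter> {a<..<a + 1}))"
          using AI by (intro openin_prod_Times) auto
        then show "\<exists>U. openin cyl U \<and> x \<in> U \<and> U \<subseteq> ?V"
          using AI x pt by (intro exI[of _ "{q \<in> cdom c. coord c q \<in> A} \<times> (I \<inter> {a<..<a + 1})"]) auto
      qed
      ultimately have "openin (mtop T) (?D \<inter> ?f -` W)"
        using proj_open_map by (simp add: open_map_def)
      then show "openin (subtopology (mtop T) ?D) (?D \<inter> ?f -` W)"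
        using openin_open_subtopology[OF D_open] by blast
    qed
  qed
qed

end

lemma atlas_T: "atlas T = {chart c a |c a. c \<in> atlas N}"
  by (simp add: mapping_torus_def)

lemma chart_in_atlas: "c \<in> atlas N \<Longrightarrow> chart c a \<in> atlas T"
  unfolding atlas_T by blast

lemma charts_cover:
  assumes "Y \<in> topspace (mtop T)"
  obtains c a p t where "c \<in> atlas N" "p \<in> cdom c" "t \<in> {a<..<a + 1}" "Y = \<pi> (p, t)"
proof -
  obtain p t where pt: "p \<in> X" "Y = \<pi> (p, t)"
    by (rule topspace_T_cases[OF assms])
  obtain c where "c \<in> atlas N" "p \<in> cdom c"
    by (rule chart_around[OF N pt(1)])
  then show thesis
    \<comment> \<open>any interval of length \<open>1\<close> around \<open>t\<close> will do\<close>
    using pt by (intro that[of c p t "t - 1/2"]) auto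
qed

subsection \<open>The flow\<close>

text \<open>Translation along the real line commutes with the deck transformations, hence descends. Any
  representative of the class may be translated.\<close>

definition flow :: "real \<Rightarrow> ('a \<times> real) set \<Rightarrow> ('a \<times> real) set" where
  "flow s Y = (let (p, t) = SOME y. y \<in> Y in \<pi> (p, t + s))"

lemma flow_proj:
  assumes "p \<in> X"
  shows "flow s (\<pi> (p, t)) = \<pi> (p, t + s)"
proof -
  obtain q u where qu: "(SOME y. y \<in> \<pi> (p, t)) = (q, u)"
    by (cases "SOME y. y \<in> \<pi> (p, t)")
  then have "(q, u) \<in> \<pi> (p, t)"
    using mem_proj_self[OF assms] by (metis someI)
  then obtain n :: int where "q = zpow n p" "u = t + of_int n"
    by (auto simp: mem_proj_iff)
  then have "flow s (\<pi> (p, t)) = \<pi> (zpow n p, t + s + of_int n)"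
    by (simp add: flow_def qu add_ac)
  then show ?thesis
    using proj_shift[OF assms] by simp
qed

lemma flow_0: "Y \<in> topspace (mtop T) \<Longrightarrow> flow 0 Y = Y"
  by (auto simp: topspace_T flow_proj)

lemma flow_T: "Y \<in> topspace (mtop T) \<Longrightarrow> flow s Y \<in> topspace (mtop T)"
  by (auto simp: topspace_T flow_proj)

text \<open>As the projection is open, a box around a representative on which the translation stays in a given
  open set projects to a neighbourhood with the same property. Half of the radius goes to the time and
  half to the point.\<close>

lemma flow_continuous:
  "continuous_map (prod_topology (top_of_set I) (mtop T)) (mtop T) (\<lambda>(s, Y). flow s Y)"
  unfolding continuous_map_def
proof (intro conjI allI impI)
  show "(\<lambda>(s, Y). flow s Y) \<in> topspace (prod_topology (top_of_set I) (mtop T)) \<rightarrow> topspace (mtop T)"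
    by (auto simp: flow_T)
  fix V assume V: "openin (mtop T) V"
  let ?P = "{z \<in> topspace (prod_topology (top_of_set I) (mtop T)). (\<lambda>(s, Y). flow s Y) z \<in> V}"
  show "openin (prod_topology (top_of_set I) (mtop T)) ?P"
  proof (subst openin_subopen, intro ballI)
    fix z assume z: "z \<in> ?P"
    then obtain s p t where p: "p \<in> X" "s \<in> I" "z = (s, \<pi> (p, t))"
      by (auto simp: topspace_T)
    then have pV: "\<pi> (p, t + s) \<in> V"
      using z by (simp add: flow_proj)
    have "openin cyl {x \<in> topspace cyl. \<pi> x \<in> V}"
      by (rule openin_continuous_map_preimage[OF proj_continuous V])
    moreover have "(p, t + s) \<in> {x \<in> topspace cyl. \<pi> x \<in> V}"
      using p pV by simp
    ultimately obtain U \<delta> where U: "openin (mtop N) U" "p \<in> U" "\<delta> > 0"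
        "U \<times> {t + s - \<delta><..<t + s + \<delta>} \<subseteq> {x \<in> topspace cyl. \<pi> x \<in> V}"
      by (rule openin_prod_real_nhd)
    let ?W = "(I \<inter> {s - \<delta>/2<..<s + \<delta>/2}) \<times> \<pi> ` (U \<times> {t - \<delta>/2<..<t + \<delta>/2})"
    have "openin (prod_topology (top_of_set I) (mtop T)) ?W"
      unfolding openin_prod_Times_iff using U by (auto intro: proj_box_open)
    moreover have "z \<in> ?W"
      using p U by auto
    moreover have "?W \<subseteq> ?P"
    proof
      fix w assume "w \<in> ?W"
      then obtain s' q t' where w: "w = (s', \<pi> (q, t'))" "s' \<in> I" "q \<in> U"
        "s' \<in> {s - \<delta>/2<..<s + \<delta>/2}" "t' \<in> {t - \<delta>/2<..<t + \<delta>/2}"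
        by auto
      then have q: "q \<in> X" using openin_subset[OF U(1)] by blast
      have "(q, t' + s') \<in> U \<times> {t + s - \<delta><..<t + s + \<delta>}"
        using w by auto
      from subsetD[OF U(4) this] have "\<pi> (q, t' + s') \<in> V" by simp
      then show "w \<in> ?P"
        using w q by (auto simp: flow_proj proj_in_T)
    qed
    ultimately show "\<exists>W. openin (prod_topology (top_of_set I) (mtop T)) W \<and> z \<in> W \<and> W \<subseteq> ?P"
      by blast
  qed
qed

text \<open>In charts the flow is, near every point, a translation of the real coordinate combined with
  one fixed power of the diffeomorphism. All statements about the smooth structure of the mapping
  torus rest on this; the time \<open>0\<close> gives the transition maps.\<close>

lemma flow_local_rep:
  assumes c: "c \<in> atlas N" and d: "d \<in> atlas N"
    and p: "p \<in> cdom c" and t: "t \<in> {a<..<a + 1}" and img: "\<pi> (p, t + s) \<in> cdom (chart d b)"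
  obtains n U where "zpow n p \<in> cdom d" "t + s + of_int n \<in> {b<..<b + 1}"
    "open U" "(s, coord c p, t) \<in> U"
    "U \<subseteq> UNIV \<times> rep_dom c d (zpow n) \<times> {a<..<a + 1}"
    "\<And>r y \<tau>. (r, y, \<tau>) \<in> U \<Longrightarrow>
       local_rep (chart c a) (chart d b) (flow r) (y, \<tau>) = (local_rep c d (zpow n) y, \<tau> + r + of_int n)"
proof -
  have pX: "p \<in> X" using cdom_subset[OF N c] p by blast
  obtain q u where q: "q \<in> cdom d" "u \<in> {b<..<b + 1}" "\<pi> (p, t + s) = \<pi> (q, u)"
    using img unfolding cdom_chart[OF d] by auto
  then obtain n :: int where n: "q = zpow n p" "u = t + s + of_int n"
    using proj_eq_iff[OF pX, of "t + s" q u] by auto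
  let ?J = "(\<lambda>(r, y, \<tau>). \<tau> + r + of_int n) -` {b<..<b + 1} :: (real \<times> 'e \<times> real) set"
  let ?U = "(UNIV \<times> rep_dom c d (zpow n) \<times> {a<..<a + 1}) \<inter> ?J"
  show thesis
  proof (rule that)
    show "zpow n p \<in> cdom d" "t + s + of_int n \<in> {b<..<b + 1}"
      using n q by auto
    have "open ?J"
      by (rule open_vimage) (auto simp: case_prod_beta' intro!: continuous_intros)
    then show "open ?U"
      using rep_dom_open[OF N N zpow_smooth c d] by (intro open_Int open_Times) auto
    show "(s, coord c p, t) \<in> ?U"
      using n q t p by (auto intro: rep_domI)
    show "?U \<subseteq> UNIV \<times> rep_dom c d (zpow n) \<times> {a<..<a + 1}"
      by blast
    fix r y \<tau> assume "(r, y, \<tau>) \<in> ?U"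
    then have *: "y \<in> rep_dom c d (zpow n)" "\<tau> \<in> {a<..<a + 1}" "\<tau> + r + of_int n \<in> {b<..<b + 1}"
      by auto
    then obtain x where x: "x \<in> cdom c" "zpow n x \<in> cdom d" "y = coord c x"
      unfolding rep_dom_def by blast
    then have xX: "x \<in> X" using cdom_subset[OF N c] by blast
    have "local_rep (chart c a) (chart d b) (flow r) (y, \<tau>) = coord (chart d b) (\<pi> (x, \<tau> + r))"
      using x * by (simp add: local_rep_def coord_inv_chart[OF c] flow_proj[OF xX])
    also have "\<dots> = coord (chart d b) (\<pi> (zpow n x, \<tau> + r + of_int n))"
      using proj_shift[OF xX] by simp
    also have "\<dots> = (coord d (zpow n x), \<tau> + r + of_int n)"
      using x * by (simp add: coord_chart[OF d])
    finally show "local_rep (chart c a) (chart d b) (flow r) (y, \<tau>) =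
        (local_rep c d (zpow n) y, \<tau> + r + of_int n)"
      using x by (simp add: local_rep_coord[OF N c])
  qed
qed

subsection \<open>Smoothness of transition maps and flow\<close>

lemma translation_rep_smooth:
  assumes "c \<in> atlas N" "d \<in> atlas N"
  shows "smooth_on (UNIV \<times> rep_dom c d (zpow n) \<times> {a<..<a + 1})
     (\<lambda>(r, y, \<tau>). (local_rep c d (zpow n) y, \<tau> + r + of_int n :: real))"
proof -
  let ?W = "UNIV \<times> rep_dom c d (zpow n) \<times> {a<..<a + 1} :: (real \<times> 'e \<times> real) set"
  have W: "open ?W"
    using rep_dom_open[OF N N zpow_smooth assms] by (intro open_Times) auto
  have fs: "bounded_linear (\<lambda>w :: real \<times> 'e \<times> real. fst (snd w))"
    "bounded_linear (\<lambda>w :: real \<times> 'e \<times> real. snd (snd w))"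
    using bounded_linear_compose[OF bounded_linear_fst bounded_linear_snd]
      bounded_linear_compose[OF bounded_linear_snd bounded_linear_snd] .
  have "smooth_on ?W (\<lambda>w. local_rep c d (zpow n) (fst (snd w)))"
    by (rule smooth_on_compose[OF W rep_dom_open[OF N N zpow_smooth assms] _ smooth_on_linear[OF fs(1)]
          smooth_on_local_rep[OF zpow_smooth assms]]) auto
  moreover have "smooth_on ?W (\<lambda>w. snd (snd w) + fst w + of_int n)"
    by (intro smooth_on_add smooth_on_const smooth_on_linear fs bounded_linear_fst W)
  ultimately show ?thesis
    using smooth_on_Pair[OF W] by (simp add: case_prod_beta')
qed

lemma open_time_slice: "open U \<Longrightarrow> open {z. (s, z) \<in> U}" for U :: "('b::topological_space \<times> 'c::topological_space) set"
  using open_vimage[of U "Pair s"] by (simp add: vimage_def continuous_intros)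

lemma flow_smooth_locally:
  assumes c: "c \<in> atlas N" and d: "d \<in> atlas N"
    and p: "p \<in> cdom c" and t: "t \<in> {a<..<a + 1}" and img: "\<pi> (p, t + s) \<in> cdom (chart d b)"
  shows "\<exists>U. open U \<and> (s, coord c p, t) \<in> U \<and> U \<subseteq> UNIV \<times> cimg (chart c a) \<and>
     smooth_on U (\<lambda>(r, z). local_rep (chart c a) (chart d b) (flow r) z)"
proof -
  obtain n U where U: "open U" "(s, coord c p, t) \<in> U"
    "U \<subseteq> UNIV \<times> rep_dom c d (zpow n) \<times> {a<..<a + 1}"
    "\<And>r y \<tau>. (r, y, \<tau>) \<in> U \<Longrightarrow>
       local_rep (chart c a) (chart d b) (flow r) (y, \<tau>) = (local_rep c d (zpow n) y, \<tau> + r + of_int n)"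
    by (rule flow_local_rep[OF assms]) (rule that)
  have "smooth_on U (\<lambda>(r, z). local_rep (chart c a) (chart d b) (flow r) z) \<longleftrightarrow>
      smooth_on U (\<lambda>(r, y, \<tau>). (local_rep c d (zpow n) y, \<tau> + r + of_int n :: real))"
    by (rule smooth_on_cong[OF U(1)]) (use U(4) in auto)
  moreover have "smooth_on U (\<lambda>(r, y, \<tau>). (local_rep c d (zpow n) y, \<tau> + r + of_int n :: real))"
    by (rule smooth_on_subset[OF translation_rep_smooth[OF c d] U(3)])
  moreover have "U \<subseteq> UNIV \<times> cimg (chart c a)"
    using U(3) unfolding cimg_chart[OF c] rep_dom_def by blast
  ultimately show ?thesis
    using U(1,2) by blast
qed

lemma chart_cimg_cases:
  assumes "c \<in> atlas N" "z \<in> cimg (chart c a)"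
  obtains p t where "p \<in> cdom c" "t \<in> {a<..<a + 1}" "z = (coord c p, t)"
  using assms(2) unfolding cimg_chart[OF assms(1)] by auto

lemma local_rep_flow_0:
  assumes "c \<in> atlas N" "z \<in> cimg (chart c a)"
  shows "local_rep (chart c a) d (flow 0) z = local_rep (chart c a) d (\<lambda>p. p) z"
proof -
  obtain p t where "p \<in> cdom c" "t \<in> {a<..<a + 1}" "z = (coord c p, t)"
    by (rule chart_cimg_cases[OF assms])
  moreover from this have "p \<in> X" using cdom_subset[OF N assms(1)] by blast
  ultimately show ?thesis
    by (simp add: local_rep_def coord_inv_chart[OF assms(1)] flow_proj)
qed

lemma transition_smooth:
  assumes c: "c \<in> atlas N" and d: "d \<in> atlas N"
  shows "smooth_on (coord (chart c a) ` (cdom (chart c a) \<inter> cdom (chart d b)))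
     (local_rep (chart c a) (chart d b) (\<lambda>p. p))"
proof (rule smooth_on_locally)
  fix z assume "z \<in> coord (chart c a) ` (cdom (chart c a) \<inter> cdom (chart d b))"
  then obtain p t where p: "p \<in> cdom c" "t \<in> {a<..<a + 1}" "\<pi> (p, t + 0) \<in> cdom (chart d b)"
    "z = (coord c p, t)"
    by (auto simp: cdom_chart[OF c] coord_chart[OF c])
  obtain U where U: "open U" "(0, z) \<in> U" "U \<subseteq> UNIV \<times> cimg (chart c a)"
    "smooth_on U (\<lambda>(r, z). local_rep (chart c a) (chart d b) (flow r) z)"
    using flow_smooth_locally[OF c d p(1,2,3)] p(4) by blast
  let ?V = "{z. (0, z) \<in> U}"
  have V: "open ?V" by (rule open_time_slice[OF U(1)])
  have "smooth_on ?V (\<lambda>z. (0::real, z))"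
    by (rule smooth_on_linear) (intro bounded_linear_Pair bounded_linear_zero bounded_linear_ident)
  from smooth_on_compose[OF V U(1) _ this U(4)]
  have smooth: "smooth_on ?V (local_rep (chart c a) (chart d b) (flow 0))"
    by auto
  have eq: "local_rep (chart c a) (chart d b) (flow 0) z =
      local_rep (chart c a) (chart d b) (\<lambda>p. p) z" if "z \<in> ?V" for z
  proof -
    have "z \<in> cimg (chart c a)" using that U(3) by blast
    then show ?thesis by (rule local_rep_flow_0[OF c])
  qed
  have "smooth_on ?V (local_rep (chart c a) (chart d b) (\<lambda>p. p))"
    by (rule iffD1[OF smooth_on_cong[OF V eq] smooth])
  then show "\<exists>V. open V \<and> z \<in> V \<and> smooth_on V (local_rep (chart c a) (chart d b) (\<lambda>p. p))"
    using V U(2) by blast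
qed

lemma smooth_manifold_T: "smooth_manifold T"
  unfolding smooth_manifold_def
proof (intro conjI ballI)
  show "Hausdorff_space (mtop T)" by (rule Hausdorff_T)
  show "second_countable (mtop T)" by (rule second_countable_T)
  fix c' assume "c' \<in> atlas T"
  then obtain c a where c: "c \<in> atlas N" "c' = chart c a"
    unfolding atlas_T by blast
  show "openin (mtop T) (cdom c')"
    unfolding c(2) cdom_chart[OF c(1)] by (intro proj_box_open cdom_open[OF N c(1)]) auto
  show "open (cimg c')"
    unfolding c(2) cimg_chart[OF c(1)] by (intro open_Times cimg_open[OF N c(1)]) auto
  show "homeomorphic_map (subtopology (mtop T) (cdom c')) (top_of_set (cimg c')) (coord c')"
    unfolding c(2) by (rule chart_homeomorphic[OF c(1)])
  fix d' assume "d' \<in> atlas T"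
  then obtain d b where d: "d \<in> atlas N" "d' = chart d b"
    unfolding atlas_T by blast
  show "smooth_on (coord c' ` (cdom c' \<inter> cdom d')) (local_rep c' d' (\<lambda>p. p))"
    unfolding c(2) d(2) by (rule transition_smooth[OF c(1) d(1)])
next
  show "(\<Union>c\<in>atlas T. cdom c) = topspace (mtop T)"
  proof
    show "(\<Union>c\<in>atlas T. cdom c) \<subseteq> topspace (mtop T)"
    proof
      fix Y assume "Y \<in> (\<Union>c\<in>atlas T. cdom c)"
      then obtain c a where "c \<in> atlas N" "Y \<in> cdom (chart c a)"
        unfolding atlas_T by blast
      then show "Y \<in> topspace (mtop T)"
        using cdom_subset[OF N, of c] unfolding cdom_chart[OF \<open>c \<in> atlas N\<close>] topspace_T by blast
    qed
    show "topspace (mtop T) \<subseteq> (\<Union>c\<in>atlas T. cdom c)"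
    proof
      fix Y assume "Y \<in> topspace (mtop T)"
      then obtain c a p t where "c \<in> atlas N" "p \<in> cdom c" "t \<in> {a<..<a + 1}" "Y = \<pi> (p, t)"
        by (rule charts_cover)
      then have "chart c a \<in> atlas T" "Y \<in> cdom (chart c a)"
        by (auto intro: chart_in_atlas simp: cdom_chart)
      then show "Y \<in> (\<Union>c\<in>atlas T. cdom c)" by blast
    qed
  qed
qed

lemma flow_add: "Y \<in> topspace (mtop T) \<Longrightarrow> flow r (flow s Y) = flow (s + r) Y"
  by (auto simp: topspace_T flow_proj add.assoc)

lemma has_vector_derivative_vertical:
  assumes c: "c \<in> atlas N" and p: "p \<in> cdom c" and t: "t \<in> {a<..<a + 1}"
  shows "((\<lambda>r. coord (chart c a) (\<pi> (p, t + (r - s)))) has_vector_derivative (0, 1)) (at s)"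
proof -
  let ?I = "{s + (a - t)<..<s + (a + 1 - t)}"
  have "((\<lambda>r. (coord c p, t + (r - s))) has_vector_derivative (0, 1)) (at s)"
    by (auto intro!: derivative_eq_intros)
  then show ?thesis
  proof (rule has_vector_derivative_transform_within_open[where S = ?I])
    show "s \<in> ?I" using t by auto
    fix r assume "r \<in> ?I"
    then show "(coord c p, t + (r - s)) = coord (chart c a) (\<pi> (p, t + (r - s)))"
      using p by (subst coord_chart[OF c]) auto
  qed auto
qed

text \<open>The representative chosen in the definition of the field need not lie in the box of the chart, but
  the curve through it projects to the same curve as the vertical line in the box.\<close>

lemma torus_field_chart:
  assumes c: "c \<in> atlas N" and z: "z \<in> cimg (chart c a)"
  shows "torus_field N \<nu> (chart c a) z = (0, 1)"
proof -
  obtain p t where p: "p \<in> cdom c" "t \<in> {a<..<a + 1}" "z = (coord c p, t)"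
    by (rule chart_cimg_cases[OF c z])
  have pX: "p \<in> X" using cdom_subset[OF N c] p by blast
  obtain q u where qu: "(SOME y. y \<in> \<pi> (p, t)) = (q, u)"
    by (cases "SOME y. y \<in> \<pi> (p, t)")
  then have "(q, u) \<in> \<pi> (p, t)"
    using mem_proj_self[OF pX] by (metis someI)
  then obtain n :: int where n: "q = zpow n p" "u = t + of_int n"
    by (auto simp: mem_proj_iff)
  have "\<pi> (q, u + s) = \<pi> (p, t + (s - 0))" for s
    using proj_shift[OF pX, of n "t + s"] by (simp add: n add_ac)
  then have "((\<lambda>s. coord (chart c a) (\<pi> (q, u + s))) has_vector_derivative (0, 1)) (at 0)"
    using has_vector_derivative_vertical[OF c p(1,2), of 0] by simp
  then show ?thesis
    using p by (simp add: torus_field_def coord_inv_chart[OF c] qu vector_derivative_at)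
qed

lemma local_flow_T: "local_flow T (torus_field N \<nu>) 1 (topspace (mtop T)) flow"
  unfolding local_flow_def
proof (intro conjI ballI impI)
  show "(0::real) < 1" "openin (mtop T) (topspace (mtop T))" by simp_all
  show "flow 0 Y = Y" if "Y \<in> topspace (mtop T)" for Y
    by (rule flow_0[OF that])
  show "continuous_map (prod_topology (top_of_set {- 1<..<1}) (subtopology (mtop T) (topspace (mtop T))))
     (mtop T) (\<lambda>(s, Y). flow s Y)"
    unfolding subtopology_topspace by (rule flow_continuous)
next
  fix Y s c' assume Y: "Y \<in> topspace (mtop T)" and c': "c' \<in> atlas T" "flow s Y \<in> cdom c'"
  obtain c a where c: "c \<in> atlas N" "c' = chart c a"
    using c' unfolding atlas_T by blast
  obtain p t where p: "p \<in> cdom c" "t \<in> {a<..<a + 1}" "flow s Y = \<pi> (p, t)"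
    using c' unfolding c(2) cdom_chart[OF c(1)] by auto
  have pX: "p \<in> X" using cdom_subset[OF N c(1)] p by blast
  have "flow r Y = \<pi> (p, t + (r - s))" for r
    using flow_add[OF Y, of "r - s" s] p(3) flow_proj[OF pX] by simp
  moreover have "torus_field N \<nu> c' (coord c' (flow s Y)) = (0, 1)"
    unfolding c(2) using c' c by (intro torus_field_chart) auto
  ultimately show "((\<lambda>r. coord c' (flow r Y)) has_vector_derivative
      torus_field N \<nu> c' (coord c' (flow s Y))) (at s)"
    using has_vector_derivative_vertical[OF c(1) p(1,2)] c(2) by simp
next
  fix c' d' assume "c' \<in> atlas T" "d' \<in> atlas T"
  then obtain c a d b where c: "c \<in> atlas N" "c' = chart c a" and d: "d \<in> atlas N" "d' = chart d b"
    unfolding atlas_T by blast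
  show "smooth_on {(s, x). s \<in> {- 1<..<1} \<and> x \<in> coord c' ` (cdom c' \<inter> topspace (mtop T)) \<and>
      flow s (coord_inv c' x) \<in> cdom d'} (\<lambda>(s, x). local_rep c' d' (flow s) x)"
    (is "smooth_on ?S _")
  proof (rule smooth_on_locally)
    fix w assume w: "w \<in> ?S"
    obtain s z where sz: "w = (s, z)" by (cases w)
    have z: "flow s (coord_inv c' z) \<in> cdom d'" "z \<in> cimg (chart c a)"
      using w c(2) unfolding sz by blast+
    obtain p t where p: "p \<in> cdom c" "t \<in> {a<..<a + 1}" "z = (coord c p, t)"
      by (rule chart_cimg_cases[OF c(1) z(2)])
    have "p \<in> X" using cdom_subset[OF N c(1)] p by blast
    then have "\<pi> (p, t + s) \<in> cdom (chart d b)"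
      using z(1) p by (simp add: c(2) d(2) coord_inv_chart[OF c(1)] flow_proj)
    from flow_smooth_locally[OF c(1) d(1) p(1,2) this]
    show "\<exists>U. open U \<and> w \<in> U \<and> smooth_on U (\<lambda>(s, x). local_rep c' d' (flow s) x)"
      unfolding sz p(3) c(2) d(2) by blast
  qed
qed

lemma flow_local_rep_derivative:
  assumes c: "c \<in> atlas N" and d: "d \<in> atlas N" and p: "p \<in> cdom c" and t: "t \<in> {a<..<a + 1}"
    and img: "\<pi> (p, t + s) \<in> cdom (chart d b)"
  obtains n :: int where "zpow n p \<in> cdom d"
    "coord (chart d b) (\<pi> (p, t + s)) = (coord d (zpow n p), t + s + of_int n)"
    "frechet_derivative (local_rep (chart c a) (chart d b) (flow s)) (at (coord c p, t)) =
      (\<lambda>w. (frechet_derivative (local_rep c d (zpow n)) (at (coord c p)) (fst w), snd w))"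
proof -
  obtain n U where n: "zpow n p \<in> cdom d" "t + s + of_int n \<in> {b<..<b + 1}"
    and U: "open U" "(s, coord c p, t) \<in> U"
    "U \<subseteq> UNIV \<times> rep_dom c d (zpow n) \<times> {a<..<a + 1}"
    "\<And>r y \<tau>. (r, y, \<tau>) \<in> U \<Longrightarrow>
       local_rep (chart c a) (chart d b) (flow r) (y, \<tau>) = (local_rep c d (zpow n) y, \<tau> + r + of_int n)"
    by (rule flow_local_rep[OF c d p t img]) (rule that)
  have pX: "p \<in> X" using cdom_subset[OF N c] p by blast
  let ?A = "frechet_derivative (local_rep c d (zpow n)) (at (coord c p))"
  have "((\<lambda>z. (local_rep c d (zpow n) (fst z), snd z + s + of_int n)) has_derivative
      (\<lambda>w. (?A (fst w), snd w))) (at (coord c p, t))"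
  proof (rule has_derivative_Pair)
    show "((\<lambda>z. local_rep c d (zpow n) (fst z)) has_derivative (\<lambda>w. ?A (fst w))) (at (coord c p, t))"
      using local_rep_has_derivative[OF N zpow_smooth c d p n(1)]
      by (intro has_derivative_compose[OF has_derivative_fst[OF has_derivative_ident]]) simp
    show "((\<lambda>z. snd z + s + of_int n) has_derivative snd) (at (coord c p, t))"
      by (auto intro!: derivative_eq_intros)
  qed
  from frechet_derivative_eqI[OF this]
  have "frechet_derivative (local_rep (chart c a) (chart d b) (flow s)) (at (coord c p, t)) =
      (\<lambda>w. (?A (fst w), snd w))"
    using frechet_derivative_cong_open[OF open_time_slice[OF U(1)], of "(coord c p, t)" s
        "local_rep (chart c a) (chart d b) (flow s)"
        "\<lambda>z. (local_rep c d (zpow n) (fst z), snd z + s + of_int n)"] U(2,4) by auto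
  moreover have "coord (chart d b) (\<pi> (p, t + s)) = (coord d (zpow n p), t + s + of_int n)"
    using proj_shift[OF pX, of n "t + s"] coord_chart[OF d n] by simp
  ultimately show thesis
    using that[OF n(1)] by blast
qed

lemma frechet_derivative_transition:
  assumes c: "c \<in> atlas N" and z: "z \<in> cimg (chart c a)"
  shows "frechet_derivative (local_rep (chart c a) d' (\<lambda>p. p)) (at z) =
    frechet_derivative (local_rep (chart c a) d' (flow 0)) (at z)"
proof -
  have "open (cimg (chart c a))"
    using cimg_open[OF N c] unfolding cimg_chart[OF c] by (auto intro: open_Times)
  then show ?thesis
    using z by (rule frechet_derivative_cong_open) (rule local_rep_flow_0[OF c, symmetric])
qed

lemma vector_field_T: "vector_field T (torus_field N \<nu>)"
  unfolding vector_field_def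
proof (intro conjI ballI)
  fix c' assume "c' \<in> atlas T"
  then obtain c a where c: "c \<in> atlas N" "c' = chart c a"
    unfolding atlas_T by blast
  have "open (cimg c')"
    using cimg_open[OF N c(1)] unfolding c(2) cimg_chart[OF c(1)] by (auto intro: open_Times)
  then show "smooth_on (cimg c') (torus_field N \<nu> c')"
    by (subst smooth_on_cong[where g = "\<lambda>z. (0, 1)"])
      (auto simp: c(2) torus_field_chart[OF c(1)] smooth_on_const)
  fix d' z assume "d' \<in> atlas T" and z: "z \<in> coord c' ` (cdom c' \<inter> cdom d')"
  then obtain d b where d: "d \<in> atlas N" "d' = chart d b"
    unfolding atlas_T by blast
  obtain p t where p: "p \<in> cdom c" "t \<in> {a<..<a + 1}" "z = (coord c p, t)" "\<pi> (p, t + 0) \<in> cdom (chart d b)"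
    using z by (auto simp: c(2) d(2) cdom_chart[OF c(1)] coord_chart[OF c(1)])
  obtain n :: int where n: "zpow n p \<in> cdom d"
    "frechet_derivative (local_rep (chart c a) (chart d b) (flow 0)) (at (coord c p, t)) =
      (\<lambda>w. (frechet_derivative (local_rep c d (zpow n)) (at (coord c p)) (fst w), snd w))"
    by (rule flow_local_rep_derivative[OF c(1) d(1) p(1,2,4)])
  have "linear (frechet_derivative (local_rep c d (zpow n)) (at (coord c p)))"
    using local_rep_has_derivative[OF N zpow_smooth c(1) d(1) p(1) n(1)] has_derivative_linear by blast
  then have "frechet_derivative (local_rep c' d' (\<lambda>p. p)) (at z) (0, 1) = (0, 1)"
    using z frechet_derivative_transition[OF c(1), of z a "chart d b"]
    by (auto simp: c(2) d(2) p(3) n(2) linear_0)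
  moreover have "local_rep c' d' (\<lambda>p. p) z \<in> cimg d'"
    using p by (simp add: local_rep_def c(2) d(2) coord_inv_chart[OF c(1)])
  ultimately show "torus_field N \<nu> d' (local_rep c' d' (\<lambda>p. p) z) =
       frechet_derivative (local_rep c' d' (\<lambda>p. p)) (at z) (torus_field N \<nu> c' z)"
    using z torus_field_chart[OF c(1), of z a] torus_field_chart[OF d(1)] unfolding c(2) d(2) by auto
qed

subsection \<open>Flow-invariant forms\<close>

text \<open>A family of forms on \<open>cimg c \<times> \<real>\<close>, one for each chart \<open>c\<close> of \<open>N\<close>, that is compatible with
  the local representatives of the flow at all times defines a form on the mapping torus. The time
  \<open>0\<close> accounts for the change of charts, the other times for the vanishing of the Lie derivative.\<close>

definition flow_invariant :: "(('a, 'e) chart \<Rightarrow> 'e \<times> real \<Rightarrow> ('e \<times> real) mform) \<Rightarrow> bool" where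
  "flow_invariant G \<longleftrightarrow> (\<forall>c\<in>atlas N. \<forall>d\<in>atlas N. \<forall>a b s. \<forall>p\<in>cdom c. \<forall>t\<in>{a<..<a + 1}.
     \<pi> (p, t + s) \<in> cdom (chart d b) \<longrightarrow>
     G c (coord c p, t) =
       pullback_lin (frechet_derivative (local_rep (chart c a) (chart d b) (flow s)) (at (coord c p, t)))
         (G d (coord (chart d b) (\<pi> (p, t + s)))))"

text \<open>Different charts of \<open>N\<close> may induce the same chart of the mapping torus; an arbitrary one of them is
  chosen.\<close>

definition lift_form ::
  "(('a, 'e) chart \<Rightarrow> 'e \<times> real \<Rightarrow> ('e \<times> real) mform) \<Rightarrow> (('a \<times> real) set, 'e \<times> real) dform" where
  "lift_form G = (\<lambda>c'. G (SOME c. c \<in> atlas N \<and> (\<exists>a. c' = chart c a)))"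

text \<open>The derivative of a local representative of the flow is \<open>D(\<nu>\<^sup>n) \<times> id\<close> for some integer \<open>n\<close>.\<close>

lemma flow_invariantI:
  assumes "\<And>c d n p t r. \<lbrakk>c \<in> atlas N; d \<in> atlas N; p \<in> cdom c; zpow n p \<in> cdom d\<rbrakk> \<Longrightarrow>
     G c (coord c p, t) =
       pullback_lin (\<lambda>w. (frechet_derivative (local_rep c d (zpow n)) (at (coord c p)) (fst w), snd w))
         (G d (coord d (zpow n p), r))"
  shows "flow_invariant G"
  unfolding flow_invariant_def
proof (intro ballI allI impI)
  fix c d a b s p t
  assume c: "c \<in> atlas N" and d: "d \<in> atlas N" and p: "p \<in> cdom c" and t: "t \<in> {a<..<a + 1}"
    and img: "\<pi> (p, t + s) \<in> cdom (chart d b)"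
  obtain n :: int where n: "zpow n p \<in> cdom d"
    "coord (chart d b) (\<pi> (p, t + s)) = (coord d (zpow n p), t + s + of_int n)"
    "frechet_derivative (local_rep (chart c a) (chart d b) (flow s)) (at (coord c p, t)) =
      (\<lambda>w. (frechet_derivative (local_rep c d (zpow n)) (at (coord c p)) (fst w), snd w))"
    by (rule flow_local_rep_derivative[OF c d p t img])
  show "G c (coord c p, t) =
       pullback_lin (frechet_derivative (local_rep (chart c a) (chart d b) (flow s)) (at (coord c p, t)))
         (G d (coord (chart d b) (\<pi> (p, t + s))))"
    unfolding n(2,3) by (rule assms[OF c d p n(1)])
qed

context
  fixes G :: "('a, 'e) chart \<Rightarrow> 'e \<times> real \<Rightarrow> ('e \<times> real) mform" and k :: nat
  assumes G: "flow_invariant G"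
begin

lemma flow_invariant_pullback:
  assumes "c \<in> atlas N" "d \<in> atlas N" "p \<in> cdom c" "t \<in> {a<..<a + 1}"
    "\<pi> (p, t + s) \<in> cdom (chart d b)"
  shows "pullback_lin (frechet_derivative (local_rep (chart c a) (chart d b) (flow s)) (at (coord c p, t)))
         (G d (coord (chart d b) (\<pi> (p, t + s)))) = G c (coord c p, t)"
  using G assms unfolding flow_invariant_def by metis

lemma flow_invariant_transition:
  assumes c: "c \<in> atlas N" and d: "d \<in> atlas N" and p: "p \<in> cdom c" and t: "t \<in> {a<..<a + 1}"
    and img: "\<pi> (p, t) \<in> cdom (chart d b)"
  shows "pullback_lin (frechet_derivative (local_rep (chart c a) (chart d b) (\<lambda>p. p)) (at (coord c p, t)))
         (G d (coord (chart d b) (\<pi> (p, t)))) = G c (coord c p, t)"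
proof -
  have "(coord c p, t) \<in> cimg (chart c a)"
    using p t unfolding cimg_chart[OF c] by auto
  note frechet_derivative_transition[OF c this, of "chart d b"]
  then show ?thesis
    using flow_invariant_pullback[OF c d p t, of 0 b] img by simp
qed

text \<open>If two charts of \<open>N\<close> induce the same chart of the mapping torus, the transition map between
  them is the identity, so both give the same form.\<close>

lemma lift_form_chart:
  assumes c: "c \<in> atlas N" and z: "z \<in> cimg (chart c a)"
  shows "lift_form G (chart c a) z = G c z"
proof -
  define d where "d = (SOME d. d \<in> atlas N \<and> (\<exists>b. chart c a = chart d b))"
  have "d \<in> atlas N \<and> (\<exists>b. chart c a = chart d b)"
    unfolding d_def by (rule someI[of _ c]) (use c in blast)
  then obtain b where d: "d \<in> atlas N" "chart c a = chart d b" by blast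
  obtain p t where p: "p \<in> cdom c" "t \<in> {a<..<a + 1}" "z = (coord c p, t)"
    by (rule chart_cimg_cases[OF c z])
  have Y: "\<pi> (p, t) \<in> cdom (chart c a)"
    using p by (auto simp: cdom_chart[OF c])
  have "frechet_derivative (local_rep (chart c a) (chart c a) (\<lambda>p. p)) (at (coord (chart c a) (\<pi> (p, t)))) = (\<lambda>v. v)"
    by (rule frechet_derivative_local_rep_self[OF smooth_manifold_T chart_in_atlas[OF c] Y]) simp
  then have "G d z = G c z"
    using flow_invariant_transition[OF c d(1) p(1,2), of b] Y
    by (simp add: d(2)[symmetric] coord_chart[OF c p(1,2)] p(3) pullback_lin_def)
  then show ?thesis
    by (simp add: lift_form_def d_def)
qed

lemma diff_form_lift_form:
  assumes smooth: "\<And>c. c \<in> atlas N \<Longrightarrow> smooth_form_on k (cimg c \<times> UNIV) (G c)"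
  shows "diff_form T k (lift_form G)"
  unfolding diff_form_def
proof (intro conjI ballI allI)
  fix c' assume "c' \<in> atlas T"
  then obtain c a where c: "c \<in> atlas N" "c' = chart c a"
    unfolding atlas_T by blast
  have img: "cimg c' \<subseteq> cimg c \<times> UNIV" "open (cimg c')"
    using cimg_open[OF N c(1)] unfolding c(2) cimg_chart[OF c(1)] by (auto intro: open_Times)
  show "alternating_form k (lift_form G c' z)" if "z \<in> cimg c'" for z
    using smooth_form_onD(1)[OF smooth[OF c(1)]] img that lift_form_chart[OF c(1)] c(2) by auto
  show "smooth_on (cimg c') (\<lambda>z. lift_form G c' z v)" for v
    using smooth_on_subset[OF smooth_form_onD(2)[OF smooth[OF c(1)]] img(1)]
    by (subst smooth_on_cong[OF img(2), where g = "\<lambda>z. G c z v"]) (auto simp: c(2) lift_form_chart[OF c(1)])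
  fix d' z assume "d' \<in> atlas T" and z: "z \<in> coord c' ` (cdom c' \<inter> cdom d')"
  then obtain d b where d: "d \<in> atlas N" "d' = chart d b"
    unfolding atlas_T by blast
  obtain p t where p: "p \<in> cdom c" "t \<in> {a<..<a + 1}" "z = (coord c p, t)" "\<pi> (p, t) \<in> cdom (chart d b)"
    using z by (auto simp: c(2) d(2) cdom_chart[OF c(1)] coord_chart[OF c(1)])
  have rep: "local_rep c' d' (\<lambda>p. p) z = coord (chart d b) (\<pi> (p, t))"
    using p by (simp add: local_rep_def c(2) d(2) coord_inv_chart[OF c(1)])
  have "z \<in> cimg c'" using z by blast
  then show "lift_form G c' z = pullback_lin (frechet_derivative (local_rep c' d' (\<lambda>p. p)) (at z))
      (lift_form G d' (local_rep c' d' (\<lambda>p. p) z))"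
    using flow_invariant_transition[OF c(1) d(1) p(1,2,4)] p(4)
      lift_form_chart[OF c(1), of z a] lift_form_chart[OF d(1), of _ b]
    unfolding rep by (simp add: c(2) d(2) p(3))
qed

lemma ext_deriv_lift_form:
  assumes "c \<in> atlas N" "z \<in> cimg (chart c a)"
  shows "ext_deriv k (lift_form G) (chart c a) z = ed k (G c) z"
proof -
  have "open (cimg (chart c a))"
    using cimg_open[OF N assms(1)] unfolding cimg_chart[OF assms(1)] by (auto intro: open_Times)
  then show ?thesis
    unfolding ext_deriv_eq_ed using assms by (intro ed_cong_open lift_form_chart)
qed

text \<open>The pullback of the form along the flow is the form itself at all times, hence constant in time.\<close>

lemma lift_form_Lie_derivative: "has_Lie_derivative T (torus_field N \<nu>) (lift_form G) zero_form"
  unfolding has_Lie_derivative_def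
proof (intro conjI ballI)
  show "vector_field T (torus_field N \<nu>)" by (rule vector_field_T)
  fix Y assume Y: "Y \<in> topspace (mtop T)"
  show "\<exists>\<epsilon> W \<Phi>. local_flow T (torus_field N \<nu>) \<epsilon> W \<Phi> \<and> Y \<in> W \<and>
     (\<forall>c\<in>atlas T. Y \<in> cdom c \<longrightarrow> (\<forall>v.
        ((\<lambda>s. pullback_form T (\<Phi> s) (lift_form G) c (coord c Y) v) has_real_derivative
          zero_form c (coord c Y) v) (at 0)))"
  proof (intro exI conjI ballI impI allI)
    show "local_flow T (torus_field N \<nu>) 1 (topspace (mtop T)) flow" by (rule local_flow_T)
    show "Y \<in> topspace (mtop T)" by (rule Y)
    fix c' v assume c': "c' \<in> atlas T" "Y \<in> cdom c'"
    then obtain c a where c: "c \<in> atlas N" "c' = chart c a"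
      unfolding atlas_T by blast
    obtain p t where p: "p \<in> cdom c" "t \<in> {a<..<a + 1}" "Y = \<pi> (p, t)"
      using c' unfolding c(2) cdom_chart[OF c(1)] by auto
    have pX: "p \<in> X" using cdom_subset[OF N c(1)] p by blast
    have "pullback_form T (flow s) (lift_form G) c' (coord c' Y) = G c (coord c p, t)" for s
    proof -
      define d' where "d' = (SOME d. d \<in> atlas T \<and> flow s Y \<in> cdom d)"
      obtain e where "e \<in> atlas T" "flow s Y \<in> cdom e"
        using chart_around[OF smooth_manifold_T flow_T[OF Y]] by blast
      then have d': "d' \<in> atlas T" "flow s Y \<in> cdom d'"
        unfolding d'_def by (metis (mono_tags, lifting) someI_ex)+
      then obtain d b where d: "d \<in> atlas N" "d' = chart d b"
        unfolding atlas_T by blast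
      have img: "\<pi> (p, t + s) \<in> cdom (chart d b)"
        using d' d(2) p(3) flow_proj[OF pX] by simp
      then have "lift_form G (chart d b) (coord (chart d b) (\<pi> (p, t + s))) =
          G d (coord (chart d b) (\<pi> (p, t + s)))"
        by (intro lift_form_chart d) auto
      moreover have "local_rep c' d' (flow s) (coord c' Y) = coord d' (flow s Y)"
        by (rule local_rep_coord[OF smooth_manifold_T c'])
      moreover have "pullback_form T (flow s) (lift_form G) c' (coord c' Y) =
          pullback_lin (frechet_derivative (local_rep c' d' (flow s)) (at (coord c' Y)))
            (lift_form G d' (local_rep c' d' (flow s) (coord c' Y)))"
        unfolding pullback_form_def coord_inv_coord[OF smooth_manifold_T c'] d'_def[symmetric] Let_def ..
      moreover have "coord c' Y = (coord c p, t)"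
        using p coord_chart[OF c(1)] c(2) by simp
      ultimately show ?thesis
        using flow_invariant_pullback[OF c(1) d(1) p(1,2) img] flow_proj[OF pX, of s t] p(3)
        by (simp add: d(2) c(2))
    qed
    then show "((\<lambda>s. pullback_form T (flow s) (lift_form G) c' (coord c' Y) v) has_real_derivative
          zero_form c' (coord c' Y) v) (at 0)"
      by (simp add: zero_form_def)
  qed
qed

end

subsection \<open>The \<open>G\<^sub>2\<close>-structure\<close>

lemma flow_invariant_g2_form:
  assumes "diff_form N 2 \<omega>" "preserves N \<nu> \<omega>" "diff_form N 3 \<psi>" "preserves N \<nu> \<psi>"
  shows "flow_invariant (\<lambda>c z. g2_form (\<omega> c (fst z)) (\<psi> c (fst z)))"
proof (rule flow_invariantI)
  fix c d n p and t r :: real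
  assume cd: "c \<in> atlas N" "d \<in> atlas N" "p \<in> cdom c" "zpow n p \<in> cdom d"
  show "g2_form (\<omega> c (fst (coord c p, t))) (\<psi> c (fst (coord c p, t))) =
      pullback_lin (\<lambda>w. (frechet_derivative (local_rep c d (zpow n)) (at (coord c p)) (fst w), snd w))
       (g2_form (\<omega> d (fst (coord d (zpow n p), r))) (\<psi> d (fst (coord d (zpow n p), r))))"
    unfolding fst_conv
    by (rule sym, rule g2_form_pullback[OF preservesD[OF zpow_preserves[OF assms(1,2)] cd]
          preservesD[OF zpow_preserves[OF assms(3,4)] cd]]) simp_all
qed

lemma flow_invariant_dt: "flow_invariant (\<lambda>c z v. r * snd (v 0))"
  by (rule flow_invariantI) (simp add: pullback_lin_def)

text \<open>With \<open>\<phi> = dt \<and> \<omega> + \<psi>\<close> and \<open>\<theta> = r dt\<close>: applying \<open>d\<close> to \<open>d\<omega> = r \<psi>\<close> shows \<open>d\<psi> = 0\<close>, hence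
  \<open>d\<phi> = -dt \<and> d\<omega> = -r dt \<and> \<psi> = -\<theta> \<and> \<phi>\<close>, where the last step uses \<open>dt \<and> dt = 0\<close>.\<close>

lemma locally_conformal_calibrated:
  assumes SU3: "coupled_SU3_structure N \<omega> \<psi> r" and inv: "preserves N \<nu> \<omega>"
  shows "\<exists>\<phi>. locally_conformal_calibrated_G2 T \<phi> \<and> has_Lie_derivative T (torus_field N \<nu>) \<phi> zero_form"
proof -
  have r: "r \<noteq> 0" and dim: "DIM('e) = 6" and \<omega>: "diff_form N 2 \<omega>" and \<psi>: "diff_form N 3 \<psi>"
    and d\<omega>: "form_eq N (ext_deriv 2 \<omega>) (scale_form r \<psi>)"
    and std: "\<And>c x. c \<in> atlas N \<Longrightarrow> x \<in> cimg c \<Longrightarrow> \<exists>e. coframe 6 e \<and>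
        \<omega> c x = (\<lambda>v. cowedge e [1,2] v + cowedge e [3,4] v + cowedge e [5,6] v) \<and>
        \<psi> c x = (\<lambda>v. cowedge e [1,3,5] v - cowedge e [1,4,6] v
                    - cowedge e [2,3,6] v - cowedge e [2,4,5] v)"
    using SU3 unfolding coupled_SU3_structure_def SU3_structure_def by blast+
  note \<omega>_smooth = diff_form_smooth_form_on[OF \<omega>] and \<psi>_smooth = diff_form_smooth_form_on[OF \<psi>]
  define G :: "('a, 'e) chart \<Rightarrow> 'e \<times> real \<Rightarrow> ('e \<times> real) mform"
    where "G = (\<lambda>c z. g2_form (\<omega> c (fst z)) (\<psi> c (fst z)))"
  define H :: "('a, 'e) chart \<Rightarrow> 'e \<times> real \<Rightarrow> ('e \<times> real) mform"
    where "H = (\<lambda>c z v. r * snd (v 0))"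
  have G: "flow_invariant G"
    unfolding G_def
    by (rule flow_invariant_g2_form[OF \<omega> inv \<psi> preserves_ed[OF N \<omega> \<nu> inv d\<omega> r]])
  have H: "flow_invariant H"
    unfolding H_def by (rule flow_invariant_dt)
  have G_smooth: "smooth_form_on 3 (cimg c \<times> UNIV) (G c)" if "c \<in> atlas N" for c
    unfolding G_def using cimg_open[OF N that] \<omega>_smooth[OF that] \<psi>_smooth[OF that]
    by (intro smooth_form_on_g2_form) auto
  have "alternating_form 1 (\<lambda>v :: nat \<Rightarrow> 'e \<times> real. r * snd (v 0))"
    by (auto simp: alternating_form_def intro!: linearI simp: algebra_simps)
  then have H_smooth: "smooth_form_on 1 (cimg c \<times> UNIV) (H c)" for c
    by (simp add: smooth_form_on_def H_def smooth_on_const)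
  let ?\<phi> = "lift_form G" and ?\<theta> = "lift_form H"

  have d\<omega>_chart: "ed 2 (\<omega> c) x = (\<lambda>v. r * \<psi> c x v)" if "c \<in> atlas N" "x \<in> cimg c" for c x
    using d\<omega> that by (auto simp: form_eq_def ext_deriv_eq_ed scale_form_def)
  have d\<psi>: "ed 3 (\<psi> c) x v = 0" if c: "c \<in> atlas N" "x \<in> cimg c" for c x v
  proof -
    have "r * ed 3 (\<psi> c) x v = ed 3 (\<lambda>x v. r * \<psi> c x v) x v"
      by (rule ed_scale[OF cimg_open[OF N c(1)] c(2) smooth_form_onD(2)[OF \<psi>_smooth[OF c(1)]], symmetric])
    also have "\<dots> = ed 3 (ed 2 (\<omega> c)) x v"
      using ed_cong_open[OF cimg_open[OF N c(1)] c(2)] d\<omega>_chart[OF c(1)] by metis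
    also have "\<dots> = 0"
      by (rule ed_ed_two_form[OF cimg_open[OF N c(1)] c(2) \<omega>_smooth[OF c(1)]])
    finally show ?thesis using r by simp
  qed

  have "G2_structure T ?\<phi>"
    unfolding G2_structure_def
  proof (intro conjI ballI)
    show "smooth_manifold T" by (rule smooth_manifold_T)
    show "DIM('e \<times> real) = 7" using dim by simp
    show "diff_form T 3 ?\<phi>" by (rule diff_form_lift_form[OF G G_smooth])
    fix c' z assume "c' \<in> atlas T" and z: "z \<in> cimg c'"
    then obtain c a where c: "c \<in> atlas N" "c' = chart c a"
      unfolding atlas_T by blast
    have "fst z \<in> cimg c"
      using z unfolding c(2) cimg_chart[OF c(1)] by auto
    then obtain e where e: "coframe 6 e"
      "\<omega> c (fst z) = (\<lambda>v. cowedge e [1,2] v + cowedge e [3,4] v + cowedge e [5,6] v)"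
      "\<psi> c (fst z) = (\<lambda>v. cowedge e [1,3,5] v - cowedge e [1,4,6] v
                    - cowedge e [2,3,6] v - cowedge e [2,4,5] v)"
      using std[OF c(1)] by blast
    have "?\<phi> c' z = g2_form (\<omega> c (fst z)) (\<psi> c (fst z))"
      using lift_form_chart[OF G c(1)] z unfolding c(2) G_def by blast
    with g2_form_standard[OF e] show "\<exists>e. coframe 7 e \<and>
        ?\<phi> c' z = (\<lambda>v. cowedge e [1,2,7] v + cowedge e [3,4,7] v + cowedge e [5,6,7] v
                    + cowedge e [1,3,5] v - cowedge e [1,4,6] v
                    - cowedge e [2,3,6] v - cowedge e [2,4,5] v)"
      by simp
  qed
  moreover have "diff_form T 1 ?\<theta>"
    by (rule diff_form_lift_form[OF H H_smooth])
  moreover have "form_eq T (ext_deriv 1 ?\<theta>) zero_form"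
    unfolding form_eq_def
  proof (intro ballI)
    fix c' z assume "c' \<in> atlas T" and z: "z \<in> cimg c'"
    then obtain c a where c: "c \<in> atlas N" "c' = chart c a"
      unfolding atlas_T by blast
    have "ext_deriv 1 ?\<theta> c' z = ed 1 (H c) z"
      using z unfolding c(2) by (rule ext_deriv_lift_form[OF H c(1)])
    also have "\<dots> = zero_form c' z"
      by (simp add: ed_def H_def zero_form_def fun_eq_iff frechet_derivative_const)
    finally show "ext_deriv 1 ?\<theta> c' z = zero_form c' z" .
  qed
  moreover have "nowhere_zero T ?\<theta>"
    unfolding nowhere_zero_def
  proof (intro ballI)
    fix c' z assume "c' \<in> atlas T" and z: "z \<in> cimg c'"
    then obtain c a where c: "c \<in> atlas N" "c' = chart c a"
      unfolding atlas_T by blast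
    have "?\<theta> c' z (\<lambda>i. (0, 1)) = r"
      unfolding c(2) lift_form_chart[OF H c(1) z[unfolded c(2)]] by (simp add: H_def)
    then show "\<exists>v. ?\<theta> c' z v \<noteq> 0" using r by metis
  qed
  moreover have "form_eq T (ext_deriv 3 ?\<phi>) (scale_form (- 1) (wedge_form 1 3 ?\<theta> ?\<phi>))"
    unfolding form_eq_def
  proof (intro ballI ext)
    fix c' z v assume "c' \<in> atlas T" and z: "z \<in> cimg c'"
    then obtain c a where c: "c \<in> atlas N" "c' = chart c a"
      unfolding atlas_T by blast
    have x: "fst z \<in> cimg c"
      using z unfolding c(2) cimg_chart[OF c(1)] by auto
    let ?S = "\<Sum>i\<le>3. (-1) ^ i * snd (v i) * \<psi> c (fst z) (omit i (\<lambda>j. fst (v j)))"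
    have "ext_deriv 3 ?\<phi> c' z v = ed 3 (G c) (fst z, snd z) v"
      using z unfolding c(2) by (simp add: ext_deriv_lift_form[OF G c(1)])
    also have "\<dots> = - (\<Sum>i\<le>3. (-1) ^ i * snd (v i) * ed 2 (\<omega> c) (fst z) (omit i (\<lambda>j. fst (v j))))
        + ed 3 (\<psi> c) (fst z) (\<lambda>j. fst (v j))"
      unfolding G_def
      by (rule ed_g2_form[OF cimg_open[OF N c(1)] x \<omega>_smooth[OF c(1)] \<psi>_smooth[OF c(1)]])
    also have "\<dots> = - (r * ?S)"
      by (simp add: d\<psi>[OF c(1) x] d\<omega>_chart[OF c(1) x] sum_distrib_left algebra_simps)
    also have "r * ?S = wedge 1 3 (H c z) (G c z) v"
      unfolding H_def G_def
      by (rule wedge_dt_g2_form[symmetric]) (use smooth_form_onD(1) \<omega>_smooth \<psi>_smooth c(1) x in blast)+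
    also have "- wedge 1 3 (H c z) (G c z) v = scale_form (- 1) (wedge_form 1 3 ?\<theta> ?\<phi>) c' z v"
      using z unfolding c(2)
      by (simp add: scale_form_def wedge_form_def lift_form_chart[OF H c(1)] lift_form_chart[OF G c(1)])
    finally show "ext_deriv 3 ?\<phi> c' z v = scale_form (- 1) (wedge_form 1 3 ?\<theta> ?\<phi>) c' z v" .
  qed
  ultimately have "locally_conformal_calibrated_G2 T ?\<phi>"
    unfolding locally_conformal_calibrated_G2_def by blast
  with lift_form_Lie_derivative[OF G] show ?thesis by blast
qed

end

theorem proposition3p1:
  fixes N :: "('a, 'e::euclidean_space) manifold"
    and \<omega> \<psi> :: "('a, 'e) dform"
    and c :: real
    and \<nu> :: "'a \<Rightarrow> 'a"
  assumes "smooth_manifold N" and "DIM('e) = 6"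
    and "compact_space (mtop N)" and "connected_space (mtop N)"
    and "c \<noteq> 0" and "coupled_SU3_structure N \<omega> \<psi> c"
    and "diffeomorphism N N \<nu>"
    and "form_eq N (pullback_form N \<nu> \<omega>) \<omega>"
  shows "\<exists>\<phi>. locally_conformal_calibrated_G2 (mapping_torus N \<nu>) \<phi> \<and>
             has_Lie_derivative (mapping_torus N \<nu>) (torus_field N \<nu>) \<phi> zero_form"
proof -
  obtain \<mu> where \<nu>: "smooth_map N N \<nu>" and \<mu>: "smooth_map N N \<mu>"
    and "\<forall>p\<in>topspace (mtop N). \<mu> (\<nu> p) = p" "\<forall>q\<in>topspace (mtop N). \<nu> (\<mu> q) = q"
    using assms(7) unfolding diffeomorphism_def by blast
  then interpret diffeo_torus N \<nu> \<mu>
    using assms(1) by unfold_locales auto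
  have "diff_form N 2 \<omega>"
    using assms(6) unfolding coupled_SU3_structure_def SU3_structure_def by blast
  then have "preserves N \<nu> \<omega>"
    by (rule preservesI[OF assms(1) _ \<nu> assms(8)])
  then show ?thesis
    by (rule locally_conformal_calibrated[OF assms(6)])
qed

end
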